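(* Let $$\bar f(z)=\frac{\beta u_0}{r}-\frac1r\,\frac{\alpha_2e^{\alpha_1z}+\alpha_1e^{-\alpha_2z}}{(\alpha_1+\alpha_2)e^{\alpha_1d}},\quad z\in[0,d],$$ $$\bar g(z)=\frac{\beta u_0-1}{r}+\frac1r\,\frac{\alpha_1(e^{\alpha_1d}-e^{-\alpha_2d})}{(\alpha_1+\alpha_2)e^{\alpha_1d}}\,e^{-\alpha_2(z-d)},\quad z>d.$$ Then $v(z)=\bar f(z)\mathbf 1_{[0,d]}(z)+\bar g(z)\mathbf 1_{(d,\infty)}(z)$ for all $z\ge0$ if and only if $$\beta\ge\zeta:=\frac{\alpha_1\alpha_2(e^{\alpha_1d}-e^{-\alpha_2d})}{r(\alpha_1+\alpha_2)e^{\alpha_1d}}\ (>0).$$ In this case, the strategy $U(t)=u_0$ for all $t\ge0$ is optimal.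
   Context: Let $(\Omega,\mathcal F,\mathbb P)$ be a complete probability space carrying a standard Brownian motion $W$. Fix $\mu\in\mathbb R$, $\sigma>0$, $u_0>0$, $r>0$, $\beta>0$, $d>0$. Let $\mathcal U$ be the set of adapted processes $U$ with $0\le U(t)\le u_0$. For $U\in\mathcal U$: $X^U(t)=\mu t+\sigma W(t)-\int_0^tU(s)\,ds$, $M_z^U(t)=\max\{z,\sup_{s\le t}X^U(s)\}$, $\Delta_z^U(t)=M_z^U(t)-X^U(t)$ for $z\ge0$; $v^U(z)=\mathbb E\big[\beta\int_0^\infty e^{-rt}U(t)\,dt-\int_0^\infty e^{-rt}\mathbf 1_{\{\Delta_z^U(t)>d\}}\,dt\big]$ and $v(z)=\sup_{U\in\mathcal U}v^U(z)$. A strategy $U^*$ is optimal if $v^{U^*}(z)=v(z)$. For $u\in[0,u_0]$ let $\theta_1(u)=\frac{\sqrt{(\mu-u)^2+2r\sigma^2}+(\mu-u)}{\sigma^2}$, $\theta_2(u)=\frac{\sqrt{(\mu-u)^2+2r\sigma^2}-(\mu-u)}{\sigma^2}$, and write $\alpha_1=\theta_1(u_0)$, $\alpha_2=\theta_2(u_0)$. *)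

theory Defs
  imports "HOL-Probability.Probability"
begin

definition nat_sets :: "'a measure \<Rightarrow> (real \<Rightarrow> 'a \<Rightarrow> real) \<Rightarrow> real \<Rightarrow> 'a set set" where
  "nat_sets M W s = sigma_sets (space M)
     (\<Union>u\<in>{0..s}. {W u -` B \<inter> space M | B. B \<in> sets (borel :: real measure)})"

definition std_BM :: "'a measure \<Rightarrow> (real \<Rightarrow> 'a \<Rightarrow> real) \<Rightarrow> bool" where
  "std_BM M W \<longleftrightarrow>
     (\<forall>t\<ge>0. W t \<in> borel_measurable M) \<and>
     (AE \<omega> in M. W 0 \<omega> = 0) \<and>
     (AE \<omega> in M. continuous_on {0..} (\<lambda>t. W t \<omega>)) \<and>
     (\<forall>s t. 0 \<le> s \<and> s < t \<longrightarrow>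
        distributed M lborel (\<lambda>\<omega>. W t \<omega> - W s \<omega>) (\<lambda>x. ennreal (normal_density 0 (sqrt (t - s)) x))) \<and>
     (\<forall>s t. 0 \<le> s \<and> s < t \<longrightarrow>
        prob_space.indep_set M (nat_sets M W s)
          (sigma_sets (space M) {(\<lambda>\<omega>. W t \<omega> - W s \<omega>) -` B \<inter> space M | B. B \<in> sets (borel :: real measure)}))"

definition filt :: "'a measure \<Rightarrow> (real \<Rightarrow> 'a \<Rightarrow> real) \<Rightarrow> real \<Rightarrow> 'a measure" where
  "filt M W t = sigma (space M) (nat_sets M W t \<union> null_sets M)"

definition admissible :: "'a measure \<Rightarrow> (real \<Rightarrow> 'a \<Rightarrow> real) \<Rightarrow> real \<Rightarrow> (real \<Rightarrow> 'a \<Rightarrow> real) set" where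
  "admissible M W u0 = {U.
     (\<forall>t\<ge>0. (\<lambda>(s, \<omega>). U s \<omega>) \<in> borel_measurable (restrict_space lborel {0..t} \<Otimes>\<^sub>M filt M W t)) \<and>
     (\<forall>t\<ge>0. \<forall>\<omega>\<in>space M. 0 \<le> U t \<omega> \<and> U t \<omega> \<le> u0)}"

definition Xproc :: "(real \<Rightarrow> 'a \<Rightarrow> real) \<Rightarrow> real \<Rightarrow> real \<Rightarrow> (real \<Rightarrow> 'a \<Rightarrow> real) \<Rightarrow> real \<Rightarrow> 'a \<Rightarrow> real" where
  "Xproc W \<mu> \<sigma> U t \<omega> = \<mu> * t + \<sigma> * W t \<omega> - (LBINT s=0..t. U s \<omega>)"

definition Mproc :: "(real \<Rightarrow> 'a \<Rightarrow> real) \<Rightarrow> real \<Rightarrow> real \<Rightarrow> (real \<Rightarrow> 'a \<Rightarrow> real) \<Rightarrow> real \<Rightarrow> real \<Rightarrow> 'a \<Rightarrow> real" where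
  "Mproc W \<mu> \<sigma> U z t \<omega> = max z (Sup ((\<lambda>s. Xproc W \<mu> \<sigma> U s \<omega>) ` {0..t}))"

definition Dproc :: "(real \<Rightarrow> 'a \<Rightarrow> real) \<Rightarrow> real \<Rightarrow> real \<Rightarrow> (real \<Rightarrow> 'a \<Rightarrow> real) \<Rightarrow> real \<Rightarrow> real \<Rightarrow> 'a \<Rightarrow> real" where
  "Dproc W \<mu> \<sigma> U z t \<omega> = Mproc W \<mu> \<sigma> U z t \<omega> - Xproc W \<mu> \<sigma> U t \<omega>"

definition vU :: "'a measure \<Rightarrow> (real \<Rightarrow> 'a \<Rightarrow> real) \<Rightarrow> real \<Rightarrow> real \<Rightarrow> real \<Rightarrow> real \<Rightarrow> real
                   \<Rightarrow> (real \<Rightarrow> 'a \<Rightarrow> real) \<Rightarrow> real \<Rightarrow> real" where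
  "vU M W \<mu> \<sigma> r \<beta> d U z =
     (\<integral>\<omega>. \<beta> * (LBINT t:{0..}. exp (- r * t) * U t \<omega>)
          - (LBINT t:{0..}. exp (- r * t) * indicator {s. Dproc W \<mu> \<sigma> U z s \<omega> > d} t) \<partial>M)"

definition vfun :: "'a measure \<Rightarrow> (real \<Rightarrow> 'a \<Rightarrow> real) \<Rightarrow> real \<Rightarrow> real \<Rightarrow> real \<Rightarrow> real \<Rightarrow> real \<Rightarrow> real \<Rightarrow> real \<Rightarrow> real" where
  "vfun M W \<mu> \<sigma> u0 r \<beta> d z = (SUP U\<in>admissible M W u0. vU M W \<mu> \<sigma> r \<beta> d U z)"

definition theta1 :: "real \<Rightarrow> real \<Rightarrow> real \<Rightarrow> real \<Rightarrow> real" where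
  "theta1 \<mu> \<sigma> r u = (sqrt ((\<mu> - u)\<^sup>2 + 2 * r * \<sigma>\<^sup>2) + (\<mu> - u)) / \<sigma>\<^sup>2"

definition theta2 :: "real \<Rightarrow> real \<Rightarrow> real \<Rightarrow> real \<Rightarrow> real" where
  "theta2 \<mu> \<sigma> r u = (sqrt ((\<mu> - u)\<^sup>2 + 2 * r * \<sigma>\<^sup>2) - (\<mu> - u)) / \<sigma>\<^sup>2"

end

(*
  No stochastic integral is needed. On a grid of mesh delta the drawdown follows the Lindley recursion
  D' = max 0 (D - xi), where xi is the increment of X. For a C^2 function H with Lipschitz second derivative and H'(0) = 0,
  a Taylor expansion of H(D') - H(D) and the independence of the Brownian increments give Ito's formula
  for the drawdown as delta tends to 0; the reflection contributes no term because it acts only where D <= |xi|,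
  where H' is small. The C^1 candidate h (fbar glued to gbar) is reached by approximations whose second derivatives
  converge everywhere. Since h solves the equation of the constant control u0, this yields for every admissible U
    v^U(z) = h(z) + E int_0^oo e^(-rt) (h'(Delta_t) + beta) (U_t - u0) dt.
  The slope h' attains its minimum -zeta at d. Hence beta >= zeta makes the integral nonpositive, with value 0 for U = u0,
  while for beta < zeta and z = d the control that stays at 0 for a short time and at u0 afterwards
  makes it positive.
*)

theory Submission
  imports Defs
begin

section \<open>One reflected step\<close>

text \<open>Two obstacles shape the estimates. The reflection error of a step is only of order
  \<open>\<bar>\<xi>\<bar>\<close> times the push at 0, and there are T/delta steps. It is split at
  a threshold a into a times the push, and \<open>\<bar>\<xi>\<bar> ^ 3 / a\<close>, whose mean has
  order delta^(3/2) / a; with a = delta^(1/4) both sums vanish, provided the expected total push is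
  bounded independently of the mesh. That push is, in the mean, the final drawdown minus its start
  plus the drift, and the drawdown is bounded through sqrt(1 + x^2): above |x|, of slope at most 1
  and with derivative 0 at 0. The control is only progressively measurable and may react to the
  noise inside a step. It is therefore never discretised: its exact integral over each step is kept
  and only the drawdown is sampled, so dominated convergence asks no regularity of it. The limits
  are taken in the order mesh, smoothing, horizon; the Lipschitz constant of the second derivative
  blows up with the smoothing but is gone by then. Completeness gives the measurability of limits
  that exist only almost surely.\<close>

lemma taylor2_lipschitz:
  fixes H H1 H2 :: "real \<Rightarrow> real"
  assumes H: "\<And>x. (H has_real_derivative H1 x) (at x)"
    and H1: "\<And>x. (H1 has_real_derivative H2 x) (at x)"
    and Lip: "\<And>x y. 0 \<le> x \<Longrightarrow> 0 \<le> y \<Longrightarrow> \<bar>H2 x - H2 y\<bar> \<le> L * \<bar>x - y\<bar>"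
    and L: "0 \<le> L" and x: "0 \<le> x" and y: "0 \<le> y"
  shows "\<bar>H y - H x - H1 x * (y - x) - H2 x / 2 * (y - x)\<^sup>2\<bar> \<le> L * \<bar>y - x\<bar> ^ 3"
proof -
  let ?S = "closed_segment x y"
  have seg: "0 \<le> t \<and> \<bar>t - x\<bar> \<le> \<bar>y - x\<bar>" if "t \<in> ?S" for t
    using that x y by (auto simp: closed_segment_eq_real_ivl split: if_splits)
  \<comment> \<open>This is the derivative of the second-order remainder of \<open>H\<close>, so the
    mean value inequality is applied twice. The factor 1/6 of the sharp bound is given away.\<close>
  have 1: "\<bar>(H1 t - H1 x) - H2 x * (t - x)\<bar> \<le> L * \<bar>y - x\<bar> ^ 2" if t: "t \<in> ?S" for t
  proof -
    have "norm ((H1 t - H2 x * t) - (H1 x - H2 x * x)) \<le> (L * \<bar>y - x\<bar>) * norm (t - x)"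
    proof (rule field_differentiable_bound[where S = ?S and f' = "\<lambda>s. H2 s - H2 x"])
      fix s assume s: "s \<in> ?S"
      show "((\<lambda>s. H1 s - H2 x * s) has_field_derivative H2 s - H2 x) (at s within ?S)"
        by (auto intro!: derivative_eq_intros has_field_derivative_at_within[OF H1])
      have "\<bar>H2 s - H2 x\<bar> \<le> L * \<bar>s - x\<bar>" using Lip seg[OF s] x by auto
      also have "\<dots> \<le> L * \<bar>y - x\<bar>" using seg[OF s] L by (intro mult_left_mono) auto
      finally show "norm (H2 s - H2 x) \<le> L * \<bar>y - x\<bar>" by simp
    qed (use t in auto)
    also have "\<dots> \<le> (L * \<bar>y - x\<bar>) * \<bar>y - x\<bar>"
      using seg[OF t] L by (intro mult_left_mono) auto
    finally show ?thesis by (simp add: algebra_simps power2_eq_square)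
  qed
  have "norm ((H y - H x - H1 x * (y - x) - H2 x / 2 * (y - x)\<^sup>2) - (H x - H x - H1 x * (x - x) - H2 x / 2 * (x - x)\<^sup>2))
      \<le> (L * \<bar>y - x\<bar> ^ 2) * norm (y - x)"
  proof (rule field_differentiable_bound[where S = ?S and f' = "\<lambda>t. (H1 t - H1 x) - H2 x * (t - x)"])
    fix t assume t: "t \<in> ?S"
    show "((\<lambda>t. H t - H x - H1 x * (t - x) - H2 x / 2 * (t - x)\<^sup>2) has_field_derivative
        (H1 t - H1 x) - H2 x * (t - x)) (at t within ?S)"
      by (auto intro!: derivative_eq_intros has_field_derivative_at_within[OF H])
    show "norm ((H1 t - H1 x) - H2 x * (t - x)) \<le> L * \<bar>y - x\<bar> ^ 2" using 1[OF t] by simp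
  qed auto
  then show ?thesis by (simp add: power3_eq_cube power2_eq_square mult_ac)
qed

text \<open>Here \<open>m\<close> is the push of the reflection. Four errors add up: the Taylor
  remainder, the push against the slope, the push inside the square, and the drift inside the
  square. Only \<open>s\<close> is kept in the quadratic term, because \<open>b\<close> will be of
  order delta. The threshold \<open>a\<close> stays free until it is balanced against the
  mesh.\<close>

lemma reflected_step_taylor:
  fixes D b s :: real
  assumes D: "0 \<le> D" and a: "0 < a" and C: "0 \<le> C" and L: "0 \<le> L"
    and taylor: "\<And>x y. 0 \<le> x \<Longrightarrow> 0 \<le> y \<Longrightarrow>
        \<bar>H y - H x - H1 x * (y - x) - H2 x / 2 * (y - x)\<^sup>2\<bar> \<le> L * \<bar>y - x\<bar> ^ 3"
    and H1: "\<And>x. 0 \<le> x \<Longrightarrow> \<bar>H1 x\<bar> \<le> C * x"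
    and H2: "\<And>x. 0 \<le> x \<Longrightarrow> \<bar>H2 x\<bar> \<le> C"
  defines "D' \<equiv> max 0 (D - (b + s))"
  defines "m \<equiv> D' - D + (b + s)"
  shows "\<bar>H D' - H D + H1 D * (b + s) - H2 D / 2 * s\<^sup>2\<bar>
     \<le> 2 * C * a * m + (2 * C / a + L) * \<bar>b + s\<bar> ^ 3 + C / 2 * (b\<^sup>2 + 2 * \<bar>b\<bar> * \<bar>s\<bar>)"
proof -
  define \<xi> where "\<xi> = b + s"
  have m: "m = D' - D + \<xi>" by (simp add: m_def \<xi>_def)
  have D'_eq: "D' = max 0 (D - \<xi>)" by (simp add: D'_def \<xi>_def)
  have m0: "0 \<le> m" "m \<le> \<bar>\<xi>\<bar>" "\<bar>D' - D\<bar> \<le> \<bar>\<xi>\<bar>" "0 < m \<Longrightarrow> D < \<xi>"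
    using D by (auto simp: m D'_eq)
  have "\<bar>H D' - H D - H1 D * (D' - D) - H2 D / 2 * (D' - D)\<^sup>2\<bar> \<le> L * \<bar>D' - D\<bar> ^ 3"
    by (rule taylor) (auto simp: D D'_eq)
  also have "\<dots> \<le> L * \<bar>\<xi>\<bar> ^ 3" using L m0 by (intro mult_left_mono power_mono) auto
  finally have 1: "\<bar>H D' - H D - H1 D * (D' - D) - H2 D / 2 * (D' - D)\<^sup>2\<bar> \<le> L * \<bar>\<xi>\<bar> ^ 3" .
  \<comment> \<open>A positive push forces \<open>D < \<xi>\<close>, hence a slope of at most
    \<open>C * \<bar>\<xi>\<bar>\<close>.\<close>
  have 2: "\<bar>H1 D * m\<bar> \<le> C * (\<bar>\<xi>\<bar> * m)"
  proof (cases "m = 0")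
    case False
    then have "D \<le> \<bar>\<xi>\<bar>" using m0 by auto
    then have "\<bar>H1 D\<bar> * m \<le> (C * \<bar>\<xi>\<bar>) * m"
      using H1[OF D] C m0 by (intro mult_right_mono) (auto intro: order_trans mult_left_mono)
    then show ?thesis using m0 by (simp add: abs_mult)
  qed simp
  \<comment> \<open>Since \<open>D' - D = m - \<xi>\<close>, the term
    \<open>m * (m - 2 * \<xi>)\<close> is the excess of the square of \<open>D' - D\<close> over
    that of \<open>\<xi>\<close>.\<close>
  have 3: "\<bar>H2 D / 2 * (m * (m - 2 * \<xi>))\<bar> \<le> C * (\<bar>\<xi>\<bar> * m)"
  proof -
    have "m * \<bar>m - 2 * \<xi>\<bar> \<le> m * (2 * \<bar>\<xi>\<bar>)"
    proof (cases "m = 0")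
      case False
      then have "0 < \<xi>" using m0 D by auto
      then show ?thesis using m0 by (intro mult_left_mono) auto
    qed simp
    then have "\<bar>H2 D\<bar> * (m * \<bar>m - 2 * \<xi>\<bar>) \<le> C * (m * (2 * \<bar>\<xi>\<bar>))"
      using C m0 by (intro mult_mono[OF H2[OF D]] mult_nonneg_nonneg) simp_all
    then show ?thesis using m0 by (simp add: abs_mult mult_ac)
  qed
  have 4: "\<bar>H2 D / 2 * (b\<^sup>2 + 2 * b * s)\<bar> \<le> C / 2 * (b\<^sup>2 + 2 * \<bar>b\<bar> * \<bar>s\<bar>)"
  proof -
    have "\<bar>b\<^sup>2 + 2 * b * s\<bar> \<le> b\<^sup>2 + 2 * \<bar>b\<bar> * \<bar>s\<bar>"
      by (rule order_trans[OF abs_triangle_ineq]) (simp add: abs_mult)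
    then have "\<bar>H2 D\<bar> * \<bar>b\<^sup>2 + 2 * b * s\<bar> \<le> C * (b\<^sup>2 + 2 * \<bar>b\<bar> * \<bar>s\<bar>)"
      using H2[OF D] C by (intro mult_mono) auto
    then show ?thesis by (simp add: abs_mult)
  qed
  \<comment> \<open>Below the threshold one factor is at most \<open>a\<close>; above it
    \<open>m \<le> \<bar>\<xi>\<bar>\<close> and \<open>1 < \<bar>\<xi>\<bar> / a\<close>.\<close>
  have "\<bar>\<xi>\<bar> * m \<le> a * m + \<bar>\<xi>\<bar> ^ 3 / a"
  proof (cases "\<bar>\<xi>\<bar> \<le> a")
    case True
    then have "\<bar>\<xi>\<bar> * m \<le> a * m" using m0 by (intro mult_right_mono)
    moreover have "0 \<le> \<bar>\<xi>\<bar> ^ 3 / a" using a by simp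
    ultimately show ?thesis by simp
  next
    case False
    have "a * (\<bar>\<xi>\<bar> * m) \<le> \<bar>\<xi>\<bar> * (\<bar>\<xi>\<bar> * \<bar>\<xi>\<bar>)"
      using False m0 a by (intro mult_mono) auto
    then have "\<bar>\<xi>\<bar> * m \<le> \<bar>\<xi>\<bar> ^ 3 / a" using a by (simp add: field_simps power3_eq_cube)
    moreover have "0 \<le> a * m" using a m0 by simp
    ultimately show ?thesis by simp
  qed
  then have 5: "2 * C * (\<bar>\<xi>\<bar> * m) \<le> 2 * C * (a * m + \<bar>\<xi>\<bar> ^ 3 / a)"
    using C by (intro mult_left_mono) auto
  have tri: "\<bar>p + q + u + v\<bar> \<le> P + Z + V"
    if "\<bar>p\<bar> \<le> P" "\<bar>q\<bar> \<le> Q" "\<bar>u\<bar> \<le> R" "\<bar>v\<bar> \<le> V" "Q + R \<le> Z" for p q u v P Q R V Z :: real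
    using that by linarith
  have 6: "H D' - H D + H1 D * (b + s) - H2 D / 2 * s\<^sup>2
      = (H D' - H D - H1 D * (D' - D) - H2 D / 2 * (D' - D)\<^sup>2) + H1 D * m
        + H2 D / 2 * (m * (m - 2 * \<xi>)) + H2 D / 2 * (b\<^sup>2 + 2 * b * s)"
    by (simp add: m \<xi>_def power2_eq_square algebra_simps)
  have "\<bar>H D' - H D + H1 D * (b + s) - H2 D / 2 * s\<^sup>2\<bar>
     \<le> L * \<bar>\<xi>\<bar> ^ 3 + 2 * C * (a * m + \<bar>\<xi>\<bar> ^ 3 / a) + C / 2 * (b\<^sup>2 + 2 * \<bar>b\<bar> * \<bar>s\<bar>)"
    unfolding 6 by (rule tri[OF 1 2 3 4]) (use 5 in \<open>simp add: algebra_simps\<close>)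
  then show ?thesis by (simp add: \<xi>_def algebra_simps add_divide_distrib)
qed

text \<open>The function sqrt(1 + x^2) grows with |x|, and cutting a negative value off to 0 can
  only lower it. Reflection thus needs no error term, and the noise keeps a bounded coefficient that
  depends on \<open>D\<close> alone, so it averages out.\<close>

lemma sqrt_one_plus_square_step:
  fixes D b s :: real
  assumes "0 \<le> D"
  shows "sqrt (1 + (max 0 (D - (b + s)))\<^sup>2)
    \<le> sqrt (1 + D\<^sup>2) + \<bar>b\<bar> - D / sqrt (1 + D\<^sup>2) * s + (b + s)\<^sup>2 / 2"
proof -
  define \<xi> where "\<xi> = b + s"
  define p where "p = sqrt (1 + D\<^sup>2)"
  have p1: "1 \<le> p" by (simp add: p_def)
  have p2: "p\<^sup>2 = 1 + D\<^sup>2" by (simp add: p_def add_nonneg_nonneg)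
  have "D \<le> p" using assms by (auto simp: p_def intro: real_le_rsqrt)
  then have Dp: "0 \<le> D / p" "D / p \<le> 1" using assms p1 by auto
  have "sqrt (1 + (max 0 (D - \<xi>))\<^sup>2) \<le> sqrt (1 + (D - \<xi>)\<^sup>2)"
    by (auto simp: max_def)
  also have "\<dots> \<le> p - D / p * \<xi> + \<xi>\<^sup>2 / (2 * p)"
  proof (rule real_le_lsqrt)
    \<comment> \<open>With \<open>v = 1 + (D - \<xi>)\<^sup>2\<close> the right-hand side is
      \<open>(v + p\<^sup>2) / (2 * p)\<close>, the arithmetic-geometric mean bound for
      \<open>sqrt v\<close>.\<close>
    have e: "p - D / p * \<xi> + \<xi>\<^sup>2 / (2 * p) = p + ((D - \<xi>)\<^sup>2 - D\<^sup>2) / (2 * p)"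
      using p1 by (simp add: field_simps power2_eq_square)
    have e2: "\<dots> = (1 + (D - \<xi>)\<^sup>2 + p\<^sup>2) / (2 * p)"
      using p1 p2 by (simp add: field_simps power2_eq_square)
    show "0 \<le> p - D / p * \<xi> + \<xi>\<^sup>2 / (2 * p)"
      unfolding e e2 using p1 by (intro divide_nonneg_nonneg add_nonneg_nonneg) auto
    have "(1 + (D - \<xi>)\<^sup>2) * (2 * p)\<^sup>2 \<le> (1 + (D - \<xi>)\<^sup>2 + p\<^sup>2)\<^sup>2"
      using zero_le_power2[of "1 + (D - \<xi>)\<^sup>2 - p\<^sup>2"] by (simp add: power2_eq_square algebra_simps)
    then show "1 + (D - \<xi>)\<^sup>2 \<le> (p - D / p * \<xi> + \<xi>\<^sup>2 / (2 * p))\<^sup>2"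
      unfolding e e2 power_divide using p1 by (subst le_divide_eq) auto
  qed
  also have "\<xi>\<^sup>2 / (2 * p) \<le> \<xi>\<^sup>2 / 2"
    using p1 by (intro divide_left_mono) auto
  also have "p - D / p * \<xi> + \<xi>\<^sup>2 / 2 \<le> p + \<bar>b\<bar> - D / p * s + \<xi>\<^sup>2 / 2"
  proof -
    have "D / p * (-b) \<le> \<bar>b\<bar>"
      using mult_mono[OF Dp(2), of "\<bar>b\<bar>" "\<bar>b\<bar>"] Dp(1)
      by (smt (verit) mult_left_mono abs_ge_minus_self abs_ge_zero mult_1)
    then show ?thesis by (simp add: \<xi>_def algebra_simps add_divide_distrib)
  qed
  finally show ?thesis by (simp add: \<xi>_def p_def)
qed

lemmas integrable_linear = Bochner_Integration.integrable_add Bochner_Integration.integrable_diff integrable_mult_right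

lemma cube_sum_le:
  fixes p q :: real
  shows "\<bar>p + q\<bar> ^ 3 \<le> 4 * (\<bar>p\<bar> ^ 3 + \<bar>q\<bar> ^ 3)"
proof -
  have *: "(x + y) ^ 3 \<le> 4 * (x ^ 3 + y ^ 3)" if "0 \<le> x" "0 \<le> y" for x y :: real
  proof -
    have "4 * (x ^ 3 + y ^ 3) - (x + y) ^ 3 = 3 * (x + y) * (x - y)\<^sup>2"
      by (simp add: power3_eq_cube power2_eq_square algebra_simps)
    also have "\<dots> \<ge> 0" using that by simp
    finally show ?thesis by simp
  qed
  have "\<bar>p + q\<bar> ^ 3 \<le> (\<bar>p\<bar> + \<bar>q\<bar>) ^ 3" by (intro power_mono) auto
  also have "\<dots> \<le> 4 * (\<bar>p\<bar> ^ 3 + \<bar>q\<bar> ^ 3)" by (rule *) auto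
  finally show ?thesis .
qed

section \<open>Moments and independence\<close>

context prob_space
begin

lemma integrable_boundedI:
  fixes f :: "'a \<Rightarrow> real"
  assumes "f \<in> borel_measurable M" "\<And>\<omega>. \<omega> \<in> space M \<Longrightarrow> \<bar>f \<omega>\<bar> \<le> B"
  shows "integrable M f"
  using assms by (intro integrable_const_bound[where B = B] AE_I2) auto

lemma indep_var_expectation_mult:
  fixes \<phi> g :: "real \<Rightarrow> real" and X w :: "'a \<Rightarrow> real"
  assumes indep: "indep_var borel X borel w"
    and [measurable]: "\<phi> \<in> borel_measurable borel" "g \<in> borel_measurable borel"
    and "integrable M (\<lambda>\<omega>. \<phi> (X \<omega>))" "integrable M (\<lambda>\<omega>. g (w \<omega>))"
  shows "integrable M (\<lambda>\<omega>. \<phi> (X \<omega>) * g (w \<omega>))"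
    and "expectation (\<lambda>\<omega>. \<phi> (X \<omega>) * g (w \<omega>)) = expectation (\<lambda>\<omega>. \<phi> (X \<omega>)) * expectation (\<lambda>\<omega>. g (w \<omega>))"
proof -
  have "indep_var borel (\<phi> \<circ> X) borel (g \<circ> w)"
    by (rule indep_var_compose[OF indep]) auto
  then have *: "indep_var borel (\<lambda>\<omega>. \<phi> (X \<omega>)) borel (\<lambda>\<omega>. g (w \<omega>))" by (simp add: comp_def)
  show "integrable M (\<lambda>\<omega>. \<phi> (X \<omega>) * g (w \<omega>))"
    by (rule indep_var_integrable[OF * assms(4,5)])
  show "expectation (\<lambda>\<omega>. \<phi> (X \<omega>) * g (w \<omega>)) = expectation (\<lambda>\<omega>. \<phi> (X \<omega>)) * expectation (\<lambda>\<omega>. g (w \<omega>))"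
    by (rule indep_var_lebesgue_integral[OF * assms(4,5)])
qed

text \<open>The arithmetic-geometric mean inequality with weight \<open>sqrt \<delta>\<close>
  interpolates the odd absolute moments between the even ones. The resulting constants are (1 + 1)/2
  and (1 + 3)/2, the 3 being the Gaussian fourth moment.\<close>

lemma abs_moments_from_even:
  fixes w :: "'a \<Rightarrow> real"
  assumes [measurable]: "w \<in> borel_measurable M" and \<delta>: "0 < \<delta>"
    and w2: "has_bochner_integral M (\<lambda>\<omega>. w \<omega> ^ 2) \<delta>"
    and w4: "has_bochner_integral M (\<lambda>\<omega>. w \<omega> ^ 4) (3 * \<delta>\<^sup>2)"
  shows "integrable M (\<lambda>\<omega>. \<bar>w \<omega>\<bar>)" "expectation (\<lambda>\<omega>. \<bar>w \<omega>\<bar>) \<le> sqrt \<delta>"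
    and "integrable M (\<lambda>\<omega>. \<bar>w \<omega>\<bar> ^ 3)" "expectation (\<lambda>\<omega>. \<bar>w \<omega>\<bar> ^ 3) \<le> 2 * \<delta> * sqrt \<delta>"
proof -
  define e where "e = sqrt \<delta>"
  have e: "0 < e" "e\<^sup>2 = \<delta>" using \<delta> by (auto simp: e_def)
  have i2: "integrable M (\<lambda>\<omega>. w \<omega> ^ 2)" "expectation (\<lambda>\<omega>. w \<omega> ^ 2) = \<delta>"
    and i4: "integrable M (\<lambda>\<omega>. w \<omega> ^ 4)" "expectation (\<lambda>\<omega>. w \<omega> ^ 4) = 3 * \<delta>\<^sup>2"
    using w2 w4 by (auto simp: has_bochner_integral_iff)
  have 1: "\<bar>x\<bar> \<le> (e + x\<^sup>2 / e) / 2" for x :: real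
    using zero_le_power2[of "\<bar>x\<bar> - e"] e(1) by (simp add: field_simps power2_eq_square)
  have 3: "\<bar>x\<bar> ^ 3 \<le> (e * x\<^sup>2 + x ^ 4 / e) / 2" for x :: real
  proof -
    have "\<bar>x\<bar> ^ 3 = x\<^sup>2 * \<bar>x\<bar>" by (simp add: power3_eq_cube power2_eq_square)
    also have "\<dots> \<le> x\<^sup>2 * ((e + x\<^sup>2 / e) / 2)" by (intro mult_left_mono 1) auto
    also have "\<dots> = (e * x\<^sup>2 + x ^ 4 / e) / 2"
      by (simp add: field_simps power2_eq_square power4_eq_xxxx)
    finally show ?thesis .
  qed
  have I1: "integrable M (\<lambda>\<omega>. (e + (w \<omega>)\<^sup>2 / e) / 2)" using i2 by auto
  have I3: "integrable M (\<lambda>\<omega>. (e * (w \<omega>)\<^sup>2 + w \<omega> ^ 4 / e) / 2)" using i2 i4 by auto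
  show J1: "integrable M (\<lambda>\<omega>. \<bar>w \<omega>\<bar>)"
    by (rule Bochner_Integration.integrable_bound[OF I1]) (auto intro!: AE_I2 order_trans[OF 1 abs_ge_self] simp del: abs_divide)
  show J3: "integrable M (\<lambda>\<omega>. \<bar>w \<omega>\<bar> ^ 3)"
  proof (rule Bochner_Integration.integrable_bound[OF I3])
    show "AE \<omega> in M. norm (\<bar>w \<omega>\<bar> ^ 3) \<le> norm ((e * (w \<omega>)\<^sup>2 + w \<omega> ^ 4 / e) / 2)"
    proof (intro AE_I2)
      fix \<omega>
      show "norm (\<bar>w \<omega>\<bar> ^ 3) \<le> norm ((e * (w \<omega>)\<^sup>2 + w \<omega> ^ 4 / e) / 2)"
        using 3[of "w \<omega>"] by (simp only: real_norm_def power_abs abs_abs)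
    qed
  qed simp
  have "expectation (\<lambda>\<omega>. \<bar>w \<omega>\<bar>) \<le> expectation (\<lambda>\<omega>. (e + (w \<omega>)\<^sup>2 / e) / 2)"
    by (intro integral_mono J1 I1 1)
  also have "\<dots> = (e + \<delta> / e) / 2" using i2 by (simp add: prob_space)
  also have "\<delta> / e = e" using e by (simp add: power2_eq_square nonzero_divide_eq_eq)
  also have "(e + e) / 2 = e" by simp
  finally show "expectation (\<lambda>\<omega>. \<bar>w \<omega>\<bar>) \<le> sqrt \<delta>" by (simp add: e_def)
  have "expectation (\<lambda>\<omega>. \<bar>w \<omega>\<bar> ^ 3) \<le> expectation (\<lambda>\<omega>. (e * (w \<omega>)\<^sup>2 + w \<omega> ^ 4 / e) / 2)"
    by (intro integral_mono J3 I3 3)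
  also have "\<dots> = 2 * \<delta> * e"
    using i2 i4 e by (simp add: field_simps power2_eq_square)
  finally show "expectation (\<lambda>\<omega>. \<bar>w \<omega>\<bar> ^ 3) \<le> 2 * \<delta> * sqrt \<delta>" by (simp add: e_def)
qed

end

text \<open>Here \<open>b\<close> is the drift of the step and \<open>w\<close> its noise.
  Independence is asked of \<open>D\<close> and \<open>w\<close> only: an adapted control may react
  to the noise within the step, so \<open>b\<close> is merely bounded, by a multiple of the step
  length.\<close>

locale reflected_step = prob_space M for M :: "'a measure" +
  fixes D b w :: "'a \<Rightarrow> real" and c \<delta> \<sigma> :: real
  assumes D_meas [measurable]: "D \<in> borel_measurable M"
    and b_meas [measurable]: "b \<in> borel_measurable M"
    and w_meas [measurable]: "w \<in> borel_measurable M"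
    and D_nonneg: "\<And>\<omega>. \<omega> \<in> space M \<Longrightarrow> 0 \<le> D \<omega>"
    and D_int: "integrable M D"
    and b_le: "\<And>\<omega>. \<omega> \<in> space M \<Longrightarrow> \<bar>b \<omega>\<bar> \<le> c * \<delta>"
    and indep: "indep_var borel D borel w"
    and w1: "has_bochner_integral M w 0"
    and w2: "has_bochner_integral M (\<lambda>\<omega>. w \<omega> ^ 2) \<delta>"
    and w4: "has_bochner_integral M (\<lambda>\<omega>. w \<omega> ^ 4) (3 * \<delta>\<^sup>2)"
    and \<delta>: "0 < \<delta>" "\<delta> \<le> 1" and c: "0 \<le> c" and \<sigma>: "0 \<le> \<sigma>"
begin

definition "D' \<omega> = max 0 (D \<omega> - (b \<omega> + \<sigma> * w \<omega>))"
text \<open>The push of the reflection; for a drawdown it is the increment of the running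
  maximum.\<close>

definition "m \<omega> = D' \<omega> - D \<omega> + (b \<omega> + \<sigma> * w \<omega>)"

lemma D'_meas [measurable]: "D' \<in> borel_measurable M"
  unfolding D'_def[abs_def] by measurable

lemma m_meas [measurable]: "m \<in> borel_measurable M"
  unfolding m_def[abs_def] by measurable

lemmas abs_w = abs_moments_from_even[OF w_meas \<delta>(1) w2 w4]

lemma w_int [simp]: "integrable M w" "expectation w = 0"
    "integrable M (\<lambda>\<omega>. (w \<omega>)\<^sup>2)" "expectation (\<lambda>\<omega>. (w \<omega>)\<^sup>2) = \<delta>"
  using w1 w2 by (auto simp: has_bochner_integral_iff)

lemma b_int [simp]: "integrable M b"
  by (rule integrable_boundedI[OF b_meas b_le])

lemma m_nonneg: "\<omega> \<in> space M \<Longrightarrow> 0 \<le> m \<omega>"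
  and m_le: "\<omega> \<in> space M \<Longrightarrow> m \<omega> \<le> \<bar>b \<omega> + \<sigma> * w \<omega>\<bar>"
  using D_nonneg[of \<omega>] by (auto simp: m_def D'_def)

lemma m_int [simp]: "integrable M m"
proof (rule Bochner_Integration.integrable_bound)
  show "integrable M (\<lambda>\<omega>. \<bar>b \<omega> + \<sigma> * w \<omega>\<bar>)"
    by (intro integrable_abs integrable_linear) auto
  show "AE \<omega> in M. norm (m \<omega>) \<le> norm \<bar>b \<omega> + \<sigma> * w \<omega>\<bar>"
    using m_nonneg m_le by (intro AE_I2) auto
qed simp

lemma D'_eq: "D' \<omega> = m \<omega> + D \<omega> - (b \<omega> + \<sigma> * w \<omega>)"
  by (simp add: m_def)

lemma D'_int: "integrable M D'"
  unfolding D'_eq[abs_def] using D_int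
  by (intro integrable_linear) auto

text \<open>Solving the recursion for the push and averaging removes the centred noise, so the mean
  push is controlled by the growth of the mean drawdown.\<close>

lemma expectation_m: "expectation m \<le> expectation D' - expectation D + c * \<delta>"
proof -
  have "expectation D' = expectation m + expectation D - (expectation b + \<sigma> * expectation w)"
    unfolding D'_eq[abs_def] using D_int
    by (subst Bochner_Integration.integral_diff Bochner_Integration.integral_add;
        (intro integrable_linear)?; simp)+
  moreover have "expectation b \<le> c * \<delta>"
    using b_le by (intro integral_le_const AE_I2) (auto intro: order_trans[OF abs_ge_self])
  ultimately show ?thesis by simp
qed

lemma expectation_mult_w:
  assumes "\<phi> \<in> borel_measurable borel" "integrable M (\<lambda>\<omega>. \<phi> (D \<omega>))"
  shows "integrable M (\<lambda>\<omega>. \<phi> (D \<omega>) * w \<omega>)" "expectation (\<lambda>\<omega>. \<phi> (D \<omega>) * w \<omega>) = 0"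
  using indep_var_expectation_mult[OF indep assms(1), of "\<lambda>x. x"] assms(2) by auto

lemma expectation_mult_w2:
  assumes "\<phi> \<in> borel_measurable borel" "integrable M (\<lambda>\<omega>. \<phi> (D \<omega>))"
  shows "integrable M (\<lambda>\<omega>. \<phi> (D \<omega>) * (w \<omega>)\<^sup>2)"
    and "expectation (\<lambda>\<omega>. \<phi> (D \<omega>) * (w \<omega>)\<^sup>2) = expectation (\<lambda>\<omega>. \<phi> (D \<omega>)) * \<delta>"
  using indep_var_expectation_mult[OF indep assms(1), of "\<lambda>x. x\<^sup>2"] assms(2) by auto

lemma delta_powers: "\<delta> ^ 2 \<le> \<delta> * sqrt \<delta>" "\<delta> ^ 3 \<le> \<delta> * sqrt \<delta>" "\<delta> * sqrt \<delta> \<le> \<delta>"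
proof -
  have s: "\<delta> \<le> sqrt \<delta>" "sqrt \<delta> \<le> 1"
    using \<delta> mult_left_mono[of \<delta> 1 \<delta>] by (auto intro!: real_le_rsqrt simp: power2_eq_square)
  show 1: "\<delta> ^ 2 \<le> \<delta> * sqrt \<delta>" using s \<delta> by (simp add: power2_eq_square)
  have "\<delta> ^ 3 \<le> \<delta> ^ 2" using \<delta> by (intro power_decreasing) auto
  with 1 show "\<delta> ^ 3 \<le> \<delta> * sqrt \<delta>" by simp
  show "\<delta> * sqrt \<delta> \<le> \<delta>" using s \<delta> mult_left_mono[of "sqrt \<delta>" 1 \<delta>] by simp
qed

lemma sqrt_int: "integrable M (\<lambda>\<omega>. sqrt (1 + (D \<omega>)\<^sup>2))" "integrable M (\<lambda>\<omega>. sqrt (1 + (D' \<omega>)\<^sup>2))"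
proof -
  have *: "sqrt (1 + x\<^sup>2) \<le> 1 + \<bar>x\<bar>" for x :: real
    by (rule real_le_lsqrt) (auto simp: power2_eq_square algebra_simps)
  have "integrable M (\<lambda>\<omega>. sqrt (1 + (Y \<omega>)\<^sup>2))" if "integrable M Y" for Y
  proof (rule Bochner_Integration.integrable_bound)
    show "integrable M (\<lambda>\<omega>. 1 + \<bar>Y \<omega>\<bar>)" using that by auto
    show "AE \<omega> in M. norm (sqrt (1 + (Y \<omega>)\<^sup>2)) \<le> norm (1 + \<bar>Y \<omega>\<bar>)"
      using * by (auto simp: abs_of_nonneg add_nonneg_nonneg)
  qed (use that in measurable)
  then show "integrable M (\<lambda>\<omega>. sqrt (1 + (D \<omega>)\<^sup>2))" "integrable M (\<lambda>\<omega>. sqrt (1 + (D' \<omega>)\<^sup>2))"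
    using D_int D'_int by auto
qed

text \<open>The noise enters linearly with the bounded coefficient \<open>p (D \<omega>)\<close> and
  has mean 0 by independence; everything else is of order \<open>\<delta>\<close>. The constant is
  generous: it only must not depend on \<open>\<delta>\<close>.\<close>

lemma expectation_sqrt_step:
  "expectation (\<lambda>\<omega>. sqrt (1 + (D' \<omega>)\<^sup>2)) \<le> expectation (\<lambda>\<omega>. sqrt (1 + (D \<omega>)\<^sup>2)) + (c + (c + \<sigma>)\<^sup>2) * \<delta>"
proof -
  define p where "p x = x / sqrt (1 + x\<^sup>2)" for x :: real
  let ?R = "\<lambda>\<omega>. sqrt (1 + (D \<omega>)\<^sup>2) + c * \<delta> - \<sigma> * (p (D \<omega>) * w \<omega>)
      + ((c * \<delta>)\<^sup>2 + 2 * (c * \<delta>) * (\<sigma> * \<bar>w \<omega>\<bar>) + \<sigma>\<^sup>2 * (w \<omega>)\<^sup>2) / 2"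
  have [measurable]: "p \<in> borel_measurable borel" unfolding p_def[abs_def] by measurable
  have pb: "\<bar>p x\<bar> \<le> 1" for x
  proof -
    have "\<bar>x\<bar> \<le> sqrt (1 + x\<^sup>2)" by (rule real_le_rsqrt) simp
    moreover have "0 < sqrt (1 + x\<^sup>2)" by (simp add: add_pos_nonneg)
    ultimately show ?thesis by (simp add: p_def abs_divide abs_of_pos divide_le_eq)
  qed
  have pi: "integrable M (\<lambda>\<omega>. p (D \<omega>))"
    by (rule integrable_boundedI[where B = 1]) (auto simp: pb)
  have pw: "integrable M (\<lambda>\<omega>. p (D \<omega>) * w \<omega>)" "expectation (\<lambda>\<omega>. p (D \<omega>) * w \<omega>) = 0"
    by (rule expectation_mult_w; use pi in simp)+
  have "expectation (\<lambda>\<omega>. sqrt (1 + (D' \<omega>)\<^sup>2))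
     \<le> expectation ?R"
  proof (rule integral_mono)
    show "integrable M (\<lambda>\<omega>. sqrt (1 + (D' \<omega>)\<^sup>2))" by (rule sqrt_int)
    show "integrable M ?R"
      using pw abs_w sqrt_int
      by (intro integrable_linear integrable_divide) auto
    fix \<omega> assume \<omega>: "\<omega> \<in> space M"
    have "(b \<omega> + \<sigma> * w \<omega>)\<^sup>2 \<le> (\<bar>b \<omega>\<bar> + \<sigma> * \<bar>w \<omega>\<bar>)\<^sup>2"
      using \<sigma> abs_triangle_ineq[of "b \<omega>" "\<sigma> * w \<omega>"]
      by (subst abs_le_square_iff[symmetric]) (simp add: abs_mult)
    also have "\<dots> \<le> (c * \<delta> + \<sigma> * \<bar>w \<omega>\<bar>)\<^sup>2"
      using b_le[OF \<omega>] \<sigma> by (intro power_mono) auto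
    also have "\<dots> = (c * \<delta>)\<^sup>2 + 2 * (c * \<delta>) * (\<sigma> * \<bar>w \<omega>\<bar>) + \<sigma>\<^sup>2 * (w \<omega>)\<^sup>2"
      by (simp add: power2_sum power_mult_distrib)
    finally have sq: "(b \<omega> + \<sigma> * w \<omega>)\<^sup>2 \<le> (c * \<delta>)\<^sup>2 + 2 * (c * \<delta>) * (\<sigma> * \<bar>w \<omega>\<bar>) + \<sigma>\<^sup>2 * (w \<omega>)\<^sup>2" .
    have "sqrt (1 + (D' \<omega>)\<^sup>2) \<le> sqrt (1 + (D \<omega>)\<^sup>2) + \<bar>b \<omega>\<bar> - \<sigma> * (p (D \<omega>) * w \<omega>)
        + (b \<omega> + \<sigma> * w \<omega>)\<^sup>2 / 2"
      using sqrt_one_plus_square_step[OF D_nonneg[OF \<omega>], of "b \<omega>" "\<sigma> * w \<omega>"]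
      by (simp add: D'_def p_def mult_ac)
    also have "\<dots> \<le> ?R \<omega>"
      by (intro add_mono diff_mono divide_right_mono sq b_le[OF \<omega>] order_refl) simp
    finally show "sqrt (1 + (D' \<omega>)\<^sup>2) \<le> ?R \<omega>"
.
  qed
  also have "\<dots> = expectation (\<lambda>\<omega>. sqrt (1 + (D \<omega>)\<^sup>2)) + c * \<delta>
          + ((c * \<delta>)\<^sup>2 + 2 * (c * \<delta>) * (\<sigma> * expectation (\<lambda>\<omega>. \<bar>w \<omega>\<bar>)) + \<sigma>\<^sup>2 * \<delta>) / 2"
    using pw abs_w sqrt_int by (simp add: prob_space)
  also have "\<dots> \<le> expectation (\<lambda>\<omega>. sqrt (1 + (D \<omega>)\<^sup>2)) + c * \<delta>
          + (c\<^sup>2 * \<delta> + 2 * c * \<sigma> * \<delta> + \<sigma>\<^sup>2 * \<delta>) / 2"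
  proof -
    have "(c * \<delta>)\<^sup>2 \<le> c\<^sup>2 * \<delta>"
      using delta_powers by (simp add: power_mult_distrib mult_left_mono)
    moreover have "(c * \<delta>) * (\<sigma> * expectation (\<lambda>\<omega>. \<bar>w \<omega>\<bar>)) \<le> c * \<sigma> * \<delta>"
    proof -
      have "(c * \<delta>) * (\<sigma> * expectation (\<lambda>\<omega>. \<bar>w \<omega>\<bar>)) \<le> (c * \<delta>) * (\<sigma> * sqrt \<delta>)"
        using abs_w c \<sigma> \<delta> by (intro mult_left_mono) auto
      also have "\<dots> = c * \<sigma> * (\<delta> * sqrt \<delta>)" by simp
      also have "\<dots> \<le> c * \<sigma> * \<delta>" using delta_powers c \<sigma> by (intro mult_left_mono) auto
      finally show ?thesis .
    qed
    ultimately show ?thesis by simp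
  qed
  also have "\<dots> \<le> expectation (\<lambda>\<omega>. sqrt (1 + (D \<omega>)\<^sup>2)) + (c + (c + \<sigma>)\<^sup>2) * \<delta>"
    using c \<sigma> \<delta> by (simp add: power2_eq_square algebra_simps add_nonneg_nonneg)
  finally show ?thesis .
qed

text \<open>The pathwise expansion is averaged. The first error term can be summed because the total
  push is bounded. The second is of order \<open>\<delta> * sqrt \<delta> / a\<close>, so that it
  remains small after summation over a number of steps of order \<open>1 / \<delta>\<close>.\<close>

lemma one_step_error:
  fixes H H1 H2 :: "real \<Rightarrow> real"
  assumes [measurable]: "H \<in> borel_measurable borel" "H1 \<in> borel_measurable borel" "H2 \<in> borel_measurable borel"
    and taylor: "\<And>x y. 0 \<le> x \<Longrightarrow> 0 \<le> y \<Longrightarrow>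
        \<bar>H y - H x - H1 x * (y - x) - H2 x / 2 * (y - x)\<^sup>2\<bar> \<le> L * \<bar>y - x\<bar> ^ 3"
    and H_le: "\<And>x. 0 \<le> x \<Longrightarrow> \<bar>H x\<bar> \<le> C"
    and H1_le: "\<And>x. 0 \<le> x \<Longrightarrow> \<bar>H1 x\<bar> \<le> C"
    and H1_lin: "\<And>x. 0 \<le> x \<Longrightarrow> \<bar>H1 x\<bar> \<le> C * x"
    and H2_le: "\<And>x. 0 \<le> x \<Longrightarrow> \<bar>H2 x\<bar> \<le> C"
    and C: "0 \<le> C" and L: "0 \<le> L" and a: "0 < a" "a \<le> 1"
  shows "\<bar>expectation (\<lambda>\<omega>. H (D' \<omega>) - H (D \<omega>) + H1 (D \<omega>) * b \<omega> - \<sigma>\<^sup>2 / 2 * \<delta> * H2 (D \<omega>))\<bar>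
    \<le> 2 * C * a * expectation m
       + ((2 * C + L) * (4 * (c ^ 3 + 2 * \<sigma> ^ 3)) + C / 2 * (c\<^sup>2 + 2 * c * \<sigma>)) * (\<delta> * sqrt \<delta> / a)"
    (is "?lhs \<le> _ + ?K * _")
proof -
  let ?R = "\<lambda>\<omega>. 2 * C * a * m \<omega>
      + (2 * C / a + L) * (4 * ((c * \<delta>) ^ 3 + \<sigma> ^ 3 * \<bar>w \<omega>\<bar> ^ 3))
      + C / 2 * ((c * \<delta>)\<^sup>2 + 2 * (c * \<delta>) * (\<sigma> * \<bar>w \<omega>\<bar>))"
  have D'_nonneg: "0 \<le> D' \<omega>" for \<omega> by (simp add: D'_def)
  have i [simp]: "integrable M (\<lambda>\<omega>. H (D' \<omega>))" "integrable M (\<lambda>\<omega>. H (D \<omega>))"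
      "integrable M (\<lambda>\<omega>. H1 (D \<omega>))" "integrable M (\<lambda>\<omega>. H2 (D \<omega>))"
    using D_nonneg D'_nonneg by (auto intro!: integrable_boundedI[where B = C] H_le H1_le H2_le)
  have i' [simp]: "integrable M (\<lambda>\<omega>. H1 (D \<omega>) * b \<omega>)"
  proof (rule integrable_boundedI)
    fix \<omega> assume "\<omega> \<in> space M"
    then show "\<bar>H1 (D \<omega>) * b \<omega>\<bar> \<le> C * (c * \<delta>)"
      unfolding abs_mult using D_nonneg C by (intro mult_mono H1_le b_le) auto
  qed simp
  have p1: "integrable M (\<lambda>\<omega>. H1 (D \<omega>) * w \<omega>)" "expectation (\<lambda>\<omega>. H1 (D \<omega>) * w \<omega>) = 0"
    by (rule expectation_mult_w; simp)+
  have p2: "integrable M (\<lambda>\<omega>. H2 (D \<omega>) * (w \<omega>)\<^sup>2)"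
      "expectation (\<lambda>\<omega>. H2 (D \<omega>) * (w \<omega>)\<^sup>2) = expectation (\<lambda>\<omega>. H2 (D \<omega>)) * \<delta>"
    by (rule expectation_mult_w2; simp)+
  \<comment> \<open>\<open>Z\<close> still contains the noise. By independence of \<open>D\<close>,
    the linear noise term has mean 0 and the squared noise may be replaced by
    \<open>\<delta>\<close>, which turns its mean into that of the claim.\<close>
  define Z where "Z \<omega> = H (D' \<omega>) - H (D \<omega>) + H1 (D \<omega>) * (b \<omega> + \<sigma> * w \<omega>) - H2 (D \<omega>) / 2 * (\<sigma> * w \<omega>)\<^sup>2" for \<omega>
  have Z_eq: "Z \<omega> = H (D' \<omega>) - H (D \<omega>) + H1 (D \<omega>) * b \<omega> + \<sigma> * (H1 (D \<omega>) * w \<omega>)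
      - \<sigma>\<^sup>2 / 2 * (H2 (D \<omega>) * (w \<omega>)\<^sup>2)" for \<omega>
    by (simp add: Z_def power_mult_distrib algebra_simps)
  have Z_int: "integrable M Z"
    unfolding Z_eq[abs_def] using p1 p2
    by (intro integrable_linear) auto
  have "expectation (\<lambda>\<omega>. H (D' \<omega>) - H (D \<omega>) + H1 (D \<omega>) * b \<omega> - \<sigma>\<^sup>2 / 2 * \<delta> * H2 (D \<omega>)) = expectation Z"
    unfolding Z_eq[abs_def] using p1 p2 by simp
  then have "?lhs = \<bar>expectation Z\<bar>" by simp
  also have "\<dots> \<le> expectation (\<lambda>\<omega>. \<bar>Z \<omega>\<bar>)" by (rule integral_abs_bound)
  also have "\<dots> \<le> expectation ?R"
  proof (rule integral_mono)
    show "integrable M (\<lambda>\<omega>. \<bar>Z \<omega>\<bar>)" using Z_int by simp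
    show "integrable M ?R"
      using abs_w by (intro integrable_linear) auto
    fix \<omega> assume \<omega>: "\<omega> \<in> space M"
    have "\<bar>Z \<omega>\<bar> \<le> 2 * C * a * m \<omega> + (2 * C / a + L) * \<bar>b \<omega> + \<sigma> * w \<omega>\<bar> ^ 3
        + C / 2 * ((b \<omega>)\<^sup>2 + 2 * \<bar>b \<omega>\<bar> * \<bar>\<sigma> * w \<omega>\<bar>)"
      unfolding Z_def m_def D'_def
      by (rule reflected_step_taylor[OF D_nonneg[OF \<omega>] a(1) C L taylor H1_lin H2_le])
    also have "\<dots> \<le> ?R \<omega>"
    proof -
      have b3: "\<bar>b \<omega>\<bar> ^ 3 \<le> (c * \<delta>) ^ 3" and b2: "(b \<omega>)\<^sup>2 \<le> (c * \<delta>)\<^sup>2"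
        using power_mono[OF b_le[OF \<omega>], of 3] power_mono[OF b_le[OF \<omega>], of 2] by auto
      have "\<bar>b \<omega> + \<sigma> * w \<omega>\<bar> ^ 3 \<le> 4 * (\<bar>b \<omega>\<bar> ^ 3 + \<bar>\<sigma> * w \<omega>\<bar> ^ 3)" by (rule cube_sum_le)
      also have "\<dots> \<le> 4 * ((c * \<delta>) ^ 3 + \<sigma> ^ 3 * \<bar>w \<omega>\<bar> ^ 3)"
        using b3 \<sigma> by (simp add: abs_mult power_mult_distrib)
      finally have 1: "\<bar>b \<omega> + \<sigma> * w \<omega>\<bar> ^ 3 \<le> 4 * ((c * \<delta>) ^ 3 + \<sigma> ^ 3 * \<bar>w \<omega>\<bar> ^ 3)" .
      have 2: "2 * \<bar>b \<omega>\<bar> * \<bar>\<sigma> * w \<omega>\<bar> \<le> 2 * (c * \<delta>) * (\<sigma> * \<bar>w \<omega>\<bar>)"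
        using b_le[OF \<omega>] \<sigma> by (simp add: abs_mult mult_right_mono)
      show ?thesis
        using C L a by (intro add_mono mult_left_mono 1 2 b2 order_refl) auto
    qed
    finally show "\<bar>Z \<omega>\<bar> \<le> ?R \<omega>" .
  qed
  also have "\<dots> = 2 * C * a * expectation m
      + (2 * C / a + L) * (4 * ((c * \<delta>) ^ 3 + \<sigma> ^ 3 * expectation (\<lambda>\<omega>. \<bar>w \<omega>\<bar> ^ 3)))
      + C / 2 * ((c * \<delta>)\<^sup>2 + 2 * (c * \<delta>) * (\<sigma> * expectation (\<lambda>\<omega>. \<bar>w \<omega>\<bar>)))"
    using abs_w by (simp add: prob_space)
  also have "\<dots> \<le> 2 * C * a * expectation m
      + ((2 * C + L) / a) * ((4 * (c ^ 3 + 2 * \<sigma> ^ 3)) * (\<delta> * sqrt \<delta>))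
      + (C / 2 / a) * ((c\<^sup>2 + 2 * c * \<sigma>) * (\<delta> * sqrt \<delta>))"
  proof -
    \<comment> \<open>As \<open>a \<le> 1\<close>, every term can be given the denominator
      \<open>a\<close>.\<close>
    have L_le: "2 * C / a + L \<le> (2 * C + L) / a"
      using a L by (simp add: add_divide_distrib le_divide_eq mult_left_le)
    have C_le: "C / 2 \<le> C / 2 / a"
      using a C by (simp add: le_divide_eq mult_left_le)
    have c3: "(c * \<delta>) ^ 3 \<le> c ^ 3 * (\<delta> * sqrt \<delta>)" and c2: "(c * \<delta>)\<^sup>2 \<le> c\<^sup>2 * (\<delta> * sqrt \<delta>)"
      unfolding power_mult_distrib using c delta_powers by (auto intro!: mult_left_mono)
    have s3: "\<sigma> ^ 3 * expectation (\<lambda>\<omega>. \<bar>w \<omega>\<bar> ^ 3) \<le> \<sigma> ^ 3 * (2 * \<delta> * sqrt \<delta>)"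
      using abs_w \<sigma> by (intro mult_left_mono) auto
    have s1: "2 * (c * \<delta>) * (\<sigma> * expectation (\<lambda>\<omega>. \<bar>w \<omega>\<bar>)) \<le> 2 * (c * \<delta>) * (\<sigma> * sqrt \<delta>)"
      using abs_w \<sigma> c \<delta> by (intro mult_left_mono) auto
    have nn: "0 \<le> expectation (\<lambda>\<omega>. \<bar>w \<omega>\<bar> ^ 3)" "0 \<le> expectation (\<lambda>\<omega>. \<bar>w \<omega>\<bar>)"
      by (auto intro!: integral_nonneg_AE)
    have 1: "4 * ((c * \<delta>) ^ 3 + \<sigma> ^ 3 * expectation (\<lambda>\<omega>. \<bar>w \<omega>\<bar> ^ 3)) \<le> (4 * (c ^ 3 + 2 * \<sigma> ^ 3)) * (\<delta> * sqrt \<delta>)"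
      using c3 s3 by (simp add: algebra_simps)
    have 2: "(c * \<delta>)\<^sup>2 + 2 * (c * \<delta>) * (\<sigma> * expectation (\<lambda>\<omega>. \<bar>w \<omega>\<bar>)) \<le> (c\<^sup>2 + 2 * c * \<sigma>) * (\<delta> * sqrt \<delta>)"
      using c2 s1 by (simp add: algebra_simps)
    show ?thesis
      using nn C L a c \<sigma> \<delta> by (intro add_mono order_refl mult_mono 1 2 L_le C_le) auto
  qed
  also have "\<dots> = 2 * C * a * expectation m + ?K * (\<delta> * sqrt \<delta> / a)"
  proof -
    have "X / a * (P * s) + Y / a * (Q * s) = (X * P + Y * Q) * (s / a)" for X P Y Q s :: real
      by (simp add: add_divide_distrib distrib_right)
    then show ?thesis by (simp only: add.assoc)
  qed
  finally show ?thesis .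
qed

end

section \<open>The controlled process\<close>

context complete_measure
begin

text \<open>The preimages under the two functions differ within a null set, and completeness makes
  all subsets of null sets measurable.\<close>

lemma measurable_AE_eq:
  assumes f: "f \<in> measurable M N" and eq: "AE x in M. f x = g x" and g: "\<And>x. x \<in> space M \<Longrightarrow> g x \<in> space N"
  shows "g \<in> measurable M N"
proof (rule measurableI)
  fix A assume A: "A \<in> sets N"
  show "g -` A \<inter> space M \<in> sets M"
  proof (rule in_sets_AE)
    show "f -` A \<inter> space M \<in> sets M" using f A by (rule measurable_sets)
    show "AE x in M. x \<in> f -` A \<inter> space M \<longleftrightarrow> x \<in> g -` A \<inter> space M"
      using eq by eventually_elim auto
  qed auto
qed (rule g)

text \<open>Functionals of the drawdown obtain their measurability from here, as limits along grids
  that converge on almost every path only. The total function \<open>lim\<close> is measurable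
  whatever value it takes where there is no convergence.\<close>

lemma borel_measurable_AE_LIMSEQ:
  fixes f :: "nat \<Rightarrow> 'a \<Rightarrow> real"
  assumes [measurable]: "\<And>n. f n \<in> borel_measurable M" and lim: "AE x in M. (\<lambda>n. f n x) \<longlonglongrightarrow> g x"
  shows "g \<in> borel_measurable M"
proof (rule measurable_AE_eq)
  show "(\<lambda>x. lim (\<lambda>n. f n x)) \<in> borel_measurable M" by measurable
  show "AE x in M. lim (\<lambda>n. f n x) = g x" using lim by eventually_elim (rule limI)
qed simp

end

lemma set_integrable_const_bounded:
  fixes a b c :: real
  assumes "A \<in> sets borel" "A \<subseteq> {a..b}"
  shows "set_integrable lborel A (\<lambda>_. c)"
proof (rule set_integrable_subset)
  show "set_integrable lborel {a..b} (\<lambda>_. c)"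
    by (rule borel_integrable_atLeastAtMost') (rule continuous_on_const)
qed (use assms in auto)

locale controlled_drawdown = prob_space M for M :: "'a measure" +
  fixes W U :: "real \<Rightarrow> 'a \<Rightarrow> real" and \<mu> \<sigma> u0 z :: real
  assumes complete: "complete_measure M" and BM: "std_BM M W"
    and \<sigma>: "0 < \<sigma>" and u0: "0 < u0" and z: "0 \<le> z" and U: "U \<in> admissible M W u0"
begin

sublocale complete_measure M by (rule complete)

lemma W_measurable [measurable]: "0 \<le> t \<Longrightarrow> W t \<in> borel_measurable M"
  using BM by (auto simp: std_BM_def)

lemma nat_sets_events: "nat_sets M W t \<subseteq> events"
  unfolding nat_sets_def by (intro sets.sigma_sets_subset) (auto intro!: measurable_sets[OF W_measurable])

lemma nat_sets_mono: "s \<le> t \<Longrightarrow> nat_sets M W s \<subseteq> nat_sets M W t"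
  unfolding nat_sets_def by (intro sigma_sets_mono' UN_mono) auto

lemma space_filt [simp]: "space (filt M W t) = space M"
  by (simp add: filt_def space_measure_of_conv)

lemma sets_filt: "sets (filt M W t) = sigma_sets (space M) (nat_sets M W t \<union> null_sets M)"
proof -
  have "nat_sets M W t \<union> null_sets M \<subseteq> Pow (space M)"
    using nat_sets_events[of t] sets.sets_into_space by auto
  then show ?thesis by (simp add: filt_def)
qed

lemma subalgebra_filt: "subalgebra M (filt M W t)"
  unfolding subalgebra_def sets_filt using nat_sets_events[of t]
  by (auto intro!: sets.sigma_sets_subset)

lemma measurable_filt_M: "f \<in> measurable (filt M W t) N \<Longrightarrow> f \<in> measurable M N"
  using measurable_from_subalg[OF subalgebra_filt] .

lemma measurable_filt_mono:
  assumes "f \<in> measurable (filt M W s) N" "s \<le> t"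
  shows "f \<in> measurable (filt M W t) N"
proof (rule measurable_from_subalg[OF _ assms(1)])
  show "subalgebra (filt M W t) (filt M W s)"
    unfolding subalgebra_def sets_filt using nat_sets_mono[OF assms(2)]
    by (auto intro!: sigma_sets_mono')
qed

lemma W_filt: "0 \<le> s \<Longrightarrow> s \<le> t \<Longrightarrow> W s \<in> borel_measurable (filt M W t)"
  by (rule measurableI) (auto simp: sets_filt nat_sets_def intro!: sigma_sets.Basic)

text \<open>The events with this property contain the generators and are closed under complements
  and countable unions. It carries the independence of increments from the natural filtration over
  to its completion.\<close>

lemma filt_AE_eq_nat_sets:
  assumes "A \<in> sets (filt M W t)"
  shows "\<exists>B \<in> nat_sets M W t. AE \<omega> in M. \<omega> \<in> A \<longleftrightarrow> \<omega> \<in> B"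
proof -
  let ?G = "\<Union>u\<in>{0..t}. {W u -` B \<inter> space M | B. B \<in> sets (borel :: real measure)}"
  have sp: "sigma_algebra (space M) (nat_sets M W t)"
    unfolding nat_sets_def by (rule sigma_algebra_sigma_sets) auto
  interpret S: sigma_algebra "space M" "nat_sets M W t" by (rule sp)
  from assms show ?thesis unfolding sets_filt
  proof (induction rule: sigma_sets.induct)
    case (Basic a)
    then show ?case
    proof
      assume "a \<in> null_sets M"
      then have "AE \<omega> in M. \<omega> \<in> a \<longleftrightarrow> \<omega> \<in> {}" using AE_not_in by fastforce
      then show ?case by blast
    qed auto
  next
    case Empty
    show ?case by (rule bexI[of _ "{}"]) auto
  next
    case (Compl a)
    then obtain B where B: "B \<in> nat_sets M W t" "AE \<omega> in M. \<omega> \<in> a \<longleftrightarrow> \<omega> \<in> B" by auto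
    then have "AE \<omega> in M. \<omega> \<in> space M - a \<longleftrightarrow> \<omega> \<in> space M - B" by auto
    with B(1) show ?case by blast
  next
    case (Union a)
    then obtain B where B: "\<And>i. B i \<in> nat_sets M W t" "\<And>i. AE \<omega> in M. \<omega> \<in> a i \<longleftrightarrow> \<omega> \<in> B i" by metis
    then have "AE \<omega> in M. \<forall>i. \<omega> \<in> a i \<longleftrightarrow> \<omega> \<in> B i" by (simp add: AE_all_countable)
    then have "AE \<omega> in M. \<omega> \<in> (\<Union>i. a i) \<longleftrightarrow> \<omega> \<in> (\<Union>i. B i)" by eventually_elim auto
    moreover have "(\<Union>i. B i) \<in> nat_sets M W t" using B(1) by auto
    ultimately show ?case by blast
  qed
qed

text \<open>\<open>std_BM\<close> grants independence from the natural filtration only, but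
  probabilities do not change when an event is replaced by its natural version up to a null
  set.\<close>

lemma indep_increment:
  assumes s: "0 \<le> s" "s < t" and Y: "Y \<in> borel_measurable (filt M W s)"
  shows "indep_var borel Y borel (\<lambda>\<omega>. W t \<omega> - W s \<omega>)"
proof -
  let ?I = "sigma_sets (space M) {(\<lambda>\<omega>. W t \<omega> - W s \<omega>) -` B \<inter> space M | B. B \<in> sets (borel :: real measure)}"
  have ind: "indep_set (nat_sets M W s) ?I"
    using BM s by (auto simp: std_BM_def)
  have "indep_set (sets (filt M W s)) ?I"
    unfolding indep_sets2_eq
  proof (intro conjI ballI)
    show "sets (filt M W s) \<subseteq> events" using subalgebra_filt by (simp add: subalgebra_def)
    show "?I \<subseteq> events" using ind by (rule indep_setD_ev2)
    fix A B assume A: "A \<in> sets (filt M W s)" and B: "B \<in> ?I"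
    obtain A' where A': "A' \<in> nat_sets M W s" "AE \<omega> in M. \<omega> \<in> A \<longleftrightarrow> \<omega> \<in> A'"
      using filt_AE_eq_nat_sets[OF A] by auto
    have ev: "A \<in> events" "A' \<in> events" "B \<in> events"
      using A B A'(1) subalgebra_filt[of s] indep_setD_ev2[OF ind] nat_sets_events[of s]
      by (auto simp: subalgebra_def)
    have "prob (A \<inter> B) = prob (A' \<inter> B)" "prob A = prob A'"
      using A'(2) ev by (auto intro!: finite_measure_eq_AE)
    then show "prob (A \<inter> B) = prob A * prob B" using indep_setD[OF ind A'(1) B] by simp
  qed
  then have *: "indep_set (sigma_sets (space M) {Y -` B \<inter> space M | B. B \<in> sets borel}) ?I"
    unfolding indep_set_def
  proof (rule indep_sets_mono_sets)
    have "sigma_sets (space M) {Y -` B \<inter> space M | B. B \<in> sets borel} \<subseteq> sets (filt M W s)"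
      using measurable_sets[OF Y] sets.sigma_sets_subset[of "{Y -` B \<inter> space M | B. B \<in> sets borel}" "filt M W s"]
      by auto
    then show "case_bool (sigma_sets (space M) {Y -` B \<inter> space M | B. B \<in> sets borel}) ?I i
       \<subseteq> case_bool (sets (filt M W s)) ?I i" for i
      by (auto split: bool.splits)
  qed
  then show ?thesis
    unfolding indep_var_eq using measurable_filt_M[OF Y] s by auto
qed

lemma increment_moments:
  assumes s: "0 \<le> s" "s < t"
  defines "w \<equiv> \<lambda>\<omega>. W t \<omega> - W s \<omega>"
  shows "has_bochner_integral M w 0" "has_bochner_integral M (\<lambda>\<omega>. w \<omega> ^ 2) (t - s)"
    and "has_bochner_integral M (\<lambda>\<omega>. w \<omega> ^ 4) (3 * (t - s)\<^sup>2)"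
proof -
  let ?n = "\<lambda>x. normal_density 0 (sqrt (t - s)) x"
  have pos: "0 < sqrt (t - s)" using s by simp
  have D: "distributed M lborel w ?n"
    using BM s by (auto simp: std_BM_def w_def)
  have tr: "has_bochner_integral M (\<lambda>\<omega>. g (w \<omega>)) x"
    if "has_bochner_integral lborel (\<lambda>y. ?n y * g y) x" "g \<in> borel_measurable borel"
    for g :: "real \<Rightarrow> real" and x
    using that distributed_integrable[OF D, of g] distributed_integral[OF D, of g]
    by (auto simp: has_bochner_integral_iff)
  show "has_bochner_integral M w 0"
    using normal_moment_odd[OF pos, of 0 0] by (intro tr) auto
  show "has_bochner_integral M (\<lambda>\<omega>. w \<omega> ^ 2) (t - s)"
    using normal_moment_even[OF pos, of 0 1] s
    by (intro tr[of "\<lambda>x. x ^ 2"]) (auto simp: diff_divide_distrib)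
  have "fact 4 / ((2 / (sqrt (t - s))\<^sup>2)\<^sup>2 * fact 2) = (3 * (t - s)\<^sup>2 :: real)"
    using s by (simp add: fact_numeral power_divide)
  then show "has_bochner_integral M (\<lambda>\<omega>. w \<omega> ^ 4) (3 * (t - s)\<^sup>2)"
    using normal_moment_even[OF pos, of 0 2] by (intro tr[of "\<lambda>x. x ^ 4"]) auto
qed

section \<open>The cumulative control and the controlled path\<close>

lemma U_bounds: "0 \<le> t \<Longrightarrow> \<omega> \<in> space M \<Longrightarrow> 0 \<le> U t \<omega> \<and> U t \<omega> \<le> u0"
  using U by (auto simp: admissible_def)

lemma U_abs_le: "0 \<le> t \<Longrightarrow> \<omega> \<in> space M \<Longrightarrow> \<bar>U t \<omega>\<bar> \<le> u0"
  using U_bounds[of t \<omega>] by auto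

text \<open>Progressive measurability gives measurable sections on each bounded interval; the
  half-line is their limit. The indicator is there because nothing is known about \<open>U\<close>
  at negative times.\<close>

lemma U_borel:
  assumes \<omega>: "\<omega> \<in> space M"
  shows "(\<lambda>t. indicator {0..} t * U t \<omega>) \<in> borel_measurable lborel"
proof -
  have 1: "(\<lambda>t. indicator {0..real n} t * U t \<omega>) \<in> borel_measurable lborel" for n :: nat
  proof -
    have m: "(\<lambda>(s, \<omega>). U s \<omega>) \<in> borel_measurable (restrict_space lborel {0..real n} \<Otimes>\<^sub>M filt M W (real n))"
      using U by (simp add: admissible_def)
    have p: "(\<lambda>s. (s, \<omega>)) \<in> measurable (restrict_space lborel {0..real n}) (restrict_space lborel {0..real n} \<Otimes>\<^sub>M filt M W (real n))"
      using \<omega> by (intro measurable_Pair2') simp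
    have "(\<lambda>s. U s \<omega>) \<in> borel_measurable (restrict_space lborel {0..real n})"
      using measurable_compose[OF p m] by simp
    then show ?thesis by (subst (asm) borel_measurable_restrict_space_iff) auto
  qed
  show ?thesis
  proof (rule borel_measurable_LIMSEQ_real[OF _ 1])
    fix t :: real
    have "eventually (\<lambda>n. indicator {0..real n} t * U t \<omega> = indicator {0..} t * U t \<omega>) sequentially"
      using eventually_ge_at_top[of "nat \<lceil>t\<rceil>"]
      by eventually_elim (auto simp: indicator_def; linarith)
    then show "(\<lambda>n. indicator {0..real n} t * U t \<omega>) \<longlonglongrightarrow> indicator {0..} t * U t \<omega>"
      by (rule tendsto_eventually)
  qed
qed

lemma U_set_borel:
  assumes \<omega>: "\<omega> \<in> space M" and [measurable]: "A \<in> sets borel" and A: "A \<subseteq> {0..}"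
  shows "set_borel_measurable lborel A (\<lambda>t. U t \<omega>)"
proof -
  have "(\<lambda>t. indicator A t * (indicator {0..} t * U t \<omega>)) \<in> borel_measurable lborel"
    using U_borel[OF \<omega>] by measurable
  also have "(\<lambda>t. indicator A t * (indicator {0..} t * U t \<omega>)) = (\<lambda>t. indicator A t *\<^sub>R U t \<omega>)"
    using A by (auto simp: indicator_def fun_eq_iff)
  finally show ?thesis by (simp add: set_borel_measurable_def)
qed

definition U_int :: "real set \<Rightarrow> 'a \<Rightarrow> real" where
  "U_int A \<omega> = (LBINT t:A. U t \<omega>)"

lemma U_integrable:
  assumes \<omega>: "\<omega> \<in> space M" and A: "A \<in> sets borel" "A \<subseteq> {0..t}"
  shows "set_integrable lborel A (\<lambda>s. U s \<omega>)"
proof (rule set_integrable_bound)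
  show "set_integrable lborel A (\<lambda>_. u0)" by (rule set_integrable_const_bounded) fact+
  show "set_borel_measurable lborel A (\<lambda>s. U s \<omega>)"
    using A by (intro U_set_borel \<omega>) auto
  show "AE s in lborel. s \<in> A \<longrightarrow> norm (U s \<omega>) \<le> norm u0"
    using A \<omega> U_abs_le u0 by (intro AE_I2) force
qed

text \<open>This is where progressive rather than plain adaptedness pays off: joint measurability up
  to time \<open>t\<close> lets the time variable be integrated out inside the filtration.\<close>

lemma U_int_filt:
  assumes t: "0 \<le> t" and A: "A \<in> sets borel" "A \<subseteq> {0..t}"
  shows "U_int A \<in> borel_measurable (filt M W t)"
proof -
  let ?R = "restrict_space lborel {0..t}"
  have "sigma_finite_measure ?R"
    by (rule sigma_finite_measure_restrict_space) (auto intro: lborel.sigma_finite_measure_axioms)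
  then interpret R: sigma_finite_measure ?R .
  have m: "(\<lambda>(s, \<omega>). U s \<omega>) \<in> borel_measurable (?R \<Otimes>\<^sub>M filt M W t)"
    using U t by (simp add: admissible_def)
  have [measurable]: "A \<in> sets ?R"
    using A by (auto simp: sets_restrict_space)
  have "(\<lambda>(\<omega>, s). U s \<omega>) \<in> borel_measurable (filt M W t \<Otimes>\<^sub>M ?R)"
    using m by (subst (asm) measurable_pair_swap_iff) simp
  then have [measurable]: "(\<lambda>(\<omega>, s). indicator A s * U s \<omega>) \<in> borel_measurable (filt M W t \<Otimes>\<^sub>M ?R)"
    by (auto simp: split_beta')
  have "(\<lambda>\<omega>. \<integral>s. indicator A s * U s \<omega> \<partial>?R) \<in> borel_measurable (filt M W t)"
    by (rule R.borel_measurable_lebesgue_integral) measurable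
  also have "(\<lambda>\<omega>. \<integral>s. indicator A s * U s \<omega> \<partial>?R) = U_int A"
  proof
    fix \<omega>
    have "(\<integral>s. indicator A s * U s \<omega> \<partial>?R) = (\<integral>s. indicator {0..t} s *\<^sub>R (indicator A s * U s \<omega>) \<partial>lborel)"
      by (subst integral_restrict_space) auto
    also have "\<dots> = U_int A \<omega>"
      unfolding U_int_def set_lebesgue_integral_def using A
      by (intro Bochner_Integration.integral_cong) (auto simp: indicator_def)
    finally show "(\<integral>s. indicator A s * U s \<omega> \<partial>?R) = U_int A \<omega>" .
  qed
  finally show ?thesis .
qed

definition X :: "real \<Rightarrow> 'a \<Rightarrow> real" where "X = Xproc W \<mu> \<sigma> U"

lemma X_eq: "0 \<le> t \<Longrightarrow> X t \<omega> = \<mu> * t + \<sigma> * W t \<omega> - U_int {0..t} \<omega>"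
  unfolding X_def Xproc_def U_int_def
  by (subst zero_ereal_def, subst interval_integral_Icc) auto

lemma X_filt: "0 \<le> s \<Longrightarrow> s \<le> t \<Longrightarrow> X s \<in> borel_measurable (filt M W t)"
proof -
  assume s: "0 \<le> s" "s \<le> t"
  have [measurable]: "W s \<in> borel_measurable (filt M W t)" using W_filt s by auto
  have [measurable]: "U_int {0..s} \<in> borel_measurable (filt M W t)" using U_int_filt s by auto
  have "X s = (\<lambda>\<omega>. \<mu> * s + \<sigma> * W s \<omega> - U_int {0..s} \<omega>)" using X_eq s by auto
  then show ?thesis by simp
qed

lemma U_int_bounds:
  assumes \<omega>: "\<omega> \<in> space M" and s: "0 \<le> s" "s \<le> t"
  shows "0 \<le> U_int {s..<t} \<omega>" "U_int {s..<t} \<omega> \<le> u0 * (t - s)"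
proof -
  show "0 \<le> U_int {s..<t} \<omega>"
    unfolding U_int_def set_lebesgue_integral_def
  proof (rule integral_nonneg_AE, rule AE_I2)
    show "0 \<le> indicator {s..<t} r *\<^sub>R U r \<omega>" for r
      using U_bounds[of r \<omega>] s \<omega> by (auto simp: indicator_def)
  qed
  have "U_int {s..<t} \<omega> \<le> (LBINT r:{s..<t}. u0)"
    unfolding U_int_def
  proof (rule set_integral_mono)
    show "set_integrable lborel {s..<t} (\<lambda>r. U r \<omega>)"
      by (rule U_integrable[OF \<omega>, where t = t]) (use s in auto)
    show "set_integrable lborel {s..<t} (\<lambda>r. u0)"
      by (rule set_integrable_const_bounded[where a = s and b = t]) auto
    show "U r \<omega> \<le> u0" if "r \<in> {s..<t}" for r
      using U_bounds[of r \<omega>] s \<omega> that by auto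
  qed
  then show "U_int {s..<t} \<omega> \<le> u0 * (t - s)" using s by (simp add: set_integral_const mult.commute)
qed

text \<open>Half-open intervals let consecutive grid cells partition the time axis; the closed
  intervals of \<open>Xproc\<close> differ from them by an endpoint of measure 0.\<close>

lemma U_int_diff:
  assumes \<omega>: "\<omega> \<in> space M" and s: "0 \<le> s" "s \<le> t"
  shows "U_int {0..t} \<omega> - U_int {0..s} \<omega> = U_int {s..<t} \<omega>"
proof -
  have a: "U_int {0..r} \<omega> = U_int {0..<r} \<omega>" for r
    unfolding U_int_def
    by (rule set_integral_discrete_difference[where X = "{r}"]) auto
  have "U_int ({0..<s} \<union> {s..<t}) \<omega> = U_int {0..<s} \<omega> + U_int {s..<t} \<omega>"
    unfolding U_int_def using s
    by (intro set_integral_Un U_integrable[OF \<omega>, where t = t]) auto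
  moreover have "{0..<s} \<union> {s..<t} = {0..<t}" using s by auto
  ultimately show ?thesis by (simp add: a)
qed

lemma X_increment:
  assumes \<omega>: "\<omega> \<in> space M" and s: "0 \<le> s" "s \<le> t"
  shows "X t \<omega> - X s \<omega> = (\<mu> * (t - s) - U_int {s..<t} \<omega>) + \<sigma> * (W t \<omega> - W s \<omega>)"
  using U_int_diff[OF assms] s by (simp add: X_eq algebra_simps)

text \<open>The paths on which all pathwise arguments run; they fill the space up to a null
  set.\<close>

definition good :: "'a \<Rightarrow> bool" where
  "good \<omega> \<longleftrightarrow> \<omega> \<in> space M \<and> W 0 \<omega> = 0 \<and> continuous_on {0..} (\<lambda>t. W t \<omega>)"

lemma AE_good: "AE \<omega> in M. good \<omega>"
proof -
  have "AE \<omega> in M. W 0 \<omega> = 0" "AE \<omega> in M. continuous_on {0..} (\<lambda>t. W t \<omega>)"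
    using BM by (auto simp: std_BM_def)
  with AE_space show ?thesis by eventually_elim (auto simp: good_def)
qed

lemma good_space: "good \<omega> \<Longrightarrow> \<omega> \<in> space M" by (simp add: good_def)

lemma X_0: "good \<omega> \<Longrightarrow> X 0 \<omega> = 0"
proof -
  assume g: "good \<omega>"
  have "U_int {0..0} \<omega> = 0"
    unfolding U_int_def using set_integral_discrete_difference[of "{0}" "{0..0}" "{}" lborel "\<lambda>t. U t \<omega>"]
    by (auto simp: set_lebesgue_integral_def)
  then show ?thesis using g by (simp add: X_eq good_def)
qed

text \<open>A control with values in [0, u0] has an integral that is Lipschitz in time with constant
  \<open>u0\<close>.\<close>

lemma continuous_X:
  assumes g: "good \<omega>"
  shows "continuous_on {0..} (\<lambda>t. X t \<omega>)"
proof -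
  have "u0-lipschitz_on {0..} (\<lambda>t. U_int {0..t} \<omega>)"
  proof (rule lipschitz_onI)
    have le: "dist (U_int {0..s} \<omega>) (U_int {0..t} \<omega>) \<le> u0 * dist s t" if "0 \<le> s" "s \<le> t" for s t
      using U_int_diff[OF good_space[OF g] that] U_int_bounds[OF good_space[OF g] that] that
      by (simp add: dist_real_def)
    fix s t :: real assume "s \<in> {0..}" "t \<in> {0..}"
    then show "dist (U_int {0..s} \<omega>) (U_int {0..t} \<omega>) \<le> u0 * dist s t"
      using le[of s t] le[of t s] by (cases "s \<le> t") (auto simp: dist_commute)
  qed (use u0 in auto)
  then have "continuous_on {0..} (\<lambda>t. U_int {0..t} \<omega>)" by (rule lipschitz_on_continuous_on)
  then have "continuous_on {0..} (\<lambda>t. \<mu> * t + \<sigma> * W t \<omega> - U_int {0..t} \<omega>)"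
    using g by (auto intro!: continuous_intros simp: good_def)
  then show ?thesis by (rule continuous_on_eq) (auto simp: X_eq)
qed

end

section \<open>Discrete Ito formula\<close>

text \<open>\<open>H1\<close> and \<open>H2\<close> stand for the first two derivatives.
  \<open>H1_lin\<close> is the Neumann condition at 0 in quantitative form, and the Taylor estimate
  is asked for on the half-line only, where the drawdown lives.\<close>

locale test_function =
  fixes H H1 H2 :: "real \<Rightarrow> real" and C L :: real
  assumes continuous: "continuous_on UNIV H" "continuous_on UNIV H1" "continuous_on UNIV H2"
    and taylor: "\<And>x y. 0 \<le> x \<Longrightarrow> 0 \<le> y \<Longrightarrow>
        \<bar>H y - H x - H1 x * (y - x) - H2 x / 2 * (y - x)\<^sup>2\<bar> \<le> L * \<bar>y - x\<bar> ^ 3"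
    and H_le: "\<And>x. 0 \<le> x \<Longrightarrow> \<bar>H x\<bar> \<le> C"
    and H1_le: "\<And>x. 0 \<le> x \<Longrightarrow> \<bar>H1 x\<bar> \<le> C"
    and H1_lin: "\<And>x. 0 \<le> x \<Longrightarrow> \<bar>H1 x\<bar> \<le> C * x"
    and H2_le: "\<And>x. 0 \<le> x \<Longrightarrow> \<bar>H2 x\<bar> \<le> C"
    and L_nonneg: "0 \<le> L"
begin

lemma C_nonneg: "0 \<le> C" using H_le[of 0] by simp

lemma generator_le:
  assumes "0 \<le> x" "0 \<le> s"
  shows "\<bar>- \<mu> * H1 x + s * H2 x\<bar> \<le> (\<bar>\<mu>\<bar> + s + 1) * C" "C \<le> (\<bar>\<mu>\<bar> + s + 1) * C"
proof -
  have "\<bar>- \<mu> * H1 x + s * H2 x\<bar> \<le> \<bar>\<mu>\<bar> * \<bar>H1 x\<bar> + s * \<bar>H2 x\<bar>"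
    using assms(2) by (intro order_trans[OF abs_triangle_ineq]) (simp add: abs_mult)
  also have "\<dots> \<le> \<bar>\<mu>\<bar> * C + s * C"
    using assms by (intro add_mono mult_left_mono H1_le H2_le) auto
  finally show "\<bar>- \<mu> * H1 x + s * H2 x\<bar> \<le> (\<bar>\<mu>\<bar> + s + 1) * C"
    using C_nonneg by (simp add: algebra_simps)
  show "C \<le> (\<bar>\<mu>\<bar> + s + 1) * C" using C_nonneg assms(2) by (simp add: distrib_right)
qed

lemma borel [measurable]: "H \<in> borel_measurable borel" "H1 \<in> borel_measurable borel" "H2 \<in> borel_measurable borel"
  using continuous by (auto intro: borel_measurable_continuous_onI)

end

section \<open>The Lindley recursion along a grid\<close>

context controlled_drawdown
begin

primrec grid :: "real \<Rightarrow> nat \<Rightarrow> 'a \<Rightarrow> real" where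
  "grid \<delta> 0 \<omega> = z"
| "grid \<delta> (Suc k) \<omega> = max 0 (grid \<delta> k \<omega> - (X (real (Suc k) * \<delta>) \<omega> - X (real k * \<delta>) \<omega>))"

text \<open>The exact integral of the control over a cell, not a sampled value: the increments of
  \<open>X\<close> along the grid are then exact as well.\<close>

definition step_U :: "real \<Rightarrow> nat \<Rightarrow> 'a \<Rightarrow> real" where
  "step_U \<delta> k = U_int {real k * \<delta>..<real (Suc k) * \<delta>}"

definition drift :: "real \<Rightarrow> nat \<Rightarrow> 'a \<Rightarrow> real" where
  "drift \<delta> k \<omega> = \<mu> * \<delta> - step_U \<delta> k \<omega>"

definition noise :: "real \<Rightarrow> nat \<Rightarrow> 'a \<Rightarrow> real" where
  "noise \<delta> k \<omega> = W (real (Suc k) * \<delta>) \<omega> - W (real k * \<delta>) \<omega>"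

definition speed :: real where "speed = \<bar>\<mu>\<bar> + u0"

lemma speed_nonneg: "0 \<le> speed" using u0 by (simp add: speed_def)

lemma grid_nonneg: "0 \<le> grid \<delta> k \<omega>"
  using z by (cases k) auto

lemma grid_filt:
  assumes "0 < \<delta>"
  shows "grid \<delta> k \<in> borel_measurable (filt M W (real k * \<delta>))"
proof (induction k)
  case (Suc k)
  have le: "real k * \<delta> \<le> real (Suc k) * \<delta>" using assms by simp
  have [measurable]: "X (real (Suc k) * \<delta>) \<in> borel_measurable (filt M W (real (Suc k) * \<delta>))"
      "X (real k * \<delta>) \<in> borel_measurable (filt M W (real (Suc k) * \<delta>))"
      "grid \<delta> k \<in> borel_measurable (filt M W (real (Suc k) * \<delta>))"
    using assms le by (auto intro!: X_filt measurable_filt_mono[OF Suc le] simp del: of_nat_Suc)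
  show ?case unfolding grid.simps[abs_def] by measurable
qed simp

lemma grid_measurable: "0 < \<delta> \<Longrightarrow> grid \<delta> k \<in> borel_measurable M"
  by (rule measurable_filt_M[OF grid_filt])

lemma step_U_measurable:
  assumes \<delta>: "0 < \<delta>"
  shows "step_U \<delta> k \<in> borel_measurable M"
proof -
  have 0: "0 \<le> real k * \<delta>" using \<delta> by simp
  have "0 \<le> x" if "real k * \<delta> \<le> x" for x using 0 that by linarith
  then show ?thesis
    unfolding step_U_def using \<delta>
    by (intro measurable_filt_M[OF U_int_filt[where t = "real (Suc k) * \<delta>"]]) auto
qed

lemma step_U_bounds:
  assumes "0 < \<delta>" "\<omega> \<in> space M"
  shows "0 \<le> step_U \<delta> k \<omega>" "step_U \<delta> k \<omega> \<le> u0 * \<delta>"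
  using U_int_bounds[OF assms(2), of "real k * \<delta>" "real (Suc k) * \<delta>"] assms(1)
  by (auto simp: step_U_def algebra_simps)

lemma drift_le:
  assumes "0 < \<delta>" "\<omega> \<in> space M"
  shows "\<bar>drift \<delta> k \<omega>\<bar> \<le> speed * \<delta>"
proof -
  have "\<bar>\<mu> * \<delta>\<bar> = \<bar>\<mu>\<bar> * \<delta>" using assms by (simp add: abs_mult)
  then show ?thesis
    using step_U_bounds[OF assms, of k] unfolding drift_def speed_def distrib_right by linarith
qed

lemma grid_Suc:
  assumes "0 < \<delta>" "\<omega> \<in> space M"
  shows "grid \<delta> (Suc k) \<omega> = max 0 (grid \<delta> k \<omega> - (drift \<delta> k \<omega> + \<sigma> * noise \<delta> k \<omega>))"
proof -
  have "X (real (Suc k) * \<delta>) \<omega> - X (real k * \<delta>) \<omega> = drift \<delta> k \<omega> + \<sigma> * noise \<delta> k \<omega>"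
    using X_increment[OF assms(2), of "real k * \<delta>" "real (Suc k) * \<delta>"] assms(1)
    by (simp add: drift_def noise_def step_U_def algebra_simps)
  then show ?thesis by simp
qed

lemma reflected_step_grid:
  assumes \<delta>: "0 < \<delta>" "\<delta> \<le> 1" and int: "integrable M (grid \<delta> k)"
  shows "reflected_step M (grid \<delta> k) (drift \<delta> k) (noise \<delta> k) speed \<delta> \<sigma>"
proof unfold_locales
  have lt: "0 \<le> real k * \<delta>" "real k * \<delta> < real (Suc k) * \<delta>" using \<delta> by auto
  have eq: "real (Suc k) * \<delta> - real k * \<delta> = \<delta>" by (simp add: algebra_simps)
  show "indep_var borel (grid \<delta> k) borel (noise \<delta> k)"
    unfolding noise_def[abs_def] by (rule indep_increment[OF lt grid_filt[OF \<delta>(1)]])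
  show "has_bochner_integral M (noise \<delta> k) 0" "has_bochner_integral M (\<lambda>\<omega>. noise \<delta> k \<omega> ^ 2) \<delta>"
     "has_bochner_integral M (\<lambda>\<omega>. noise \<delta> k \<omega> ^ 4) (3 * \<delta>\<^sup>2)"
    using increment_moments[OF lt] unfolding noise_def[abs_def] eq by auto
  show "grid \<delta> k \<in> borel_measurable M" by (rule grid_measurable[OF \<delta>(1)])
  show "drift \<delta> k \<in> borel_measurable M"
    unfolding drift_def[abs_def] using step_U_measurable[OF \<delta>(1)] by measurable
  show "noise \<delta> k \<in> borel_measurable M"
    unfolding noise_def[abs_def] using \<delta> by (auto simp del: of_nat_Suc)
qed (use int \<delta> \<sigma> speed_nonneg drift_le grid_nonneg in auto)

lemma reflected_step_D':
  assumes \<delta>: "0 < \<delta>" "\<delta> \<le> 1" and int: "integrable M (grid \<delta> k)" and "\<omega> \<in> space M"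
  shows "reflected_step.D' (grid \<delta> k) (drift \<delta> k) (noise \<delta> k) \<sigma> \<omega> = grid \<delta> (Suc k) \<omega>"
  using reflected_step.D'_def[OF reflected_step_grid[OF \<delta> int]] grid_Suc[OF \<delta>(1) assms(4)] by simp

lemma grid_integrable:
  assumes \<delta>: "0 < \<delta>" "\<delta> \<le> 1"
  shows "integrable M (grid \<delta> k)"
proof (induction k)
  case (Suc k)
  interpret step: reflected_step M "grid \<delta> k" "drift \<delta> k" "noise \<delta> k" speed \<delta> \<sigma>
    by (rule reflected_step_grid[OF \<delta> Suc])
  show ?case
    using step.D'_int reflected_step_D'[OF \<delta> Suc]
    by (subst Bochner_Integration.integrable_cong[OF refl, of _ _ step.D']) auto
qed simp

section \<open>The total push of the reflection\<close>

context
  fixes \<delta> :: real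
  assumes \<delta>: "0 < \<delta>" "\<delta> \<le> 1"
begin

interpretation step: reflected_step M "grid \<delta> k" "drift \<delta> k" "noise \<delta> k" speed \<delta> \<sigma> for k
  by (rule reflected_step_grid[OF \<delta> grid_integrable[OF \<delta>]])

lemma D'_eq_grid: "\<omega> \<in> space M \<Longrightarrow> step.D' k \<omega> = grid \<delta> (Suc k) \<omega>"
  by (rule reflected_step_D'[OF \<delta> grid_integrable[OF \<delta>]])

definition push :: "nat \<Rightarrow> real" where "push k = expectation (step.m k)"

lemma grid_sqrt_bound:
  "expectation (\<lambda>\<omega>. sqrt (1 + (grid \<delta> k \<omega>)\<^sup>2)) \<le> sqrt (1 + z\<^sup>2) + (speed + (speed + \<sigma>)\<^sup>2) * (real k * \<delta>)"
proof (induction k)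
  case (Suc k)
  have "expectation (\<lambda>\<omega>. sqrt (1 + (grid \<delta> (Suc k) \<omega>)\<^sup>2)) = expectation (\<lambda>\<omega>. sqrt (1 + (step.D' k \<omega>)\<^sup>2))"
    by (rule Bochner_Integration.integral_cong) (simp_all add: D'_eq_grid del: grid.simps)
  also have "\<dots> \<le> expectation (\<lambda>\<omega>. sqrt (1 + (grid \<delta> k \<omega>)\<^sup>2)) + (speed + (speed + \<sigma>)\<^sup>2) * \<delta>"
    by (rule step.expectation_sqrt_step)
  also note Suc
  finally show ?case by (simp add: algebra_simps)
qed (simp add: prob_space)

text \<open>Telescoping \<open>expectation_m\<close> leaves the mean of the last grid value, which
  sqrt(1 + x^2) dominates. The bound depends on the mesh only through the elapsed time
  \<open>real N * \<delta>\<close>.\<close>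

lemma sum_push_bound:
  "(\<Sum>k<N. push k) \<le> sqrt (1 + z\<^sup>2) + (2 * speed + (speed + \<sigma>)\<^sup>2) * (real N * \<delta>)"
proof -
  have "(\<Sum>k<N. push k) \<le> expectation (grid \<delta> N) - z + speed * (real N * \<delta>)"
  proof (induction N)
    case (Suc N)
    have "expectation (step.D' N) = expectation (grid \<delta> (Suc N))"
      by (rule Bochner_Integration.integral_cong) (simp_all add: D'_eq_grid del: grid.simps)
    then have "push N \<le> expectation (grid \<delta> (Suc N)) - expectation (grid \<delta> N) + speed * \<delta>"
      using step.expectation_m[of N] unfolding push_def by (simp del: grid.simps)
    then show ?case using Suc by (simp add: algebra_simps del: grid.simps)
  qed (simp add: prob_space)
  also have "\<dots> \<le> expectation (grid \<delta> N) + speed * (real N * \<delta>)" using z by simp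
  also have "expectation (grid \<delta> N) \<le> expectation (\<lambda>\<omega>. sqrt (1 + (grid \<delta> N \<omega>)\<^sup>2))"
    using step.sqrt_int(1)[of N] grid_integrable[OF \<delta>]
    by (intro integral_mono) (auto intro!: real_le_rsqrt)
  also note grid_sqrt_bound
  finally show ?thesis by (simp add: algebra_simps)
qed

end

text \<open>A Riemann-type sum for the discounted integral of \<open>\<phi>\<close> times the
  control plus \<open>\<psi>\<close>. The drawdown is taken at the left end of each cell, before the
  noise acts; the discount is taken at the right end, where the recursion delivers the new
  value.\<close>

definition JN :: "real \<Rightarrow> real \<Rightarrow> nat \<Rightarrow> (real \<Rightarrow> real) \<Rightarrow> (real \<Rightarrow> real) \<Rightarrow> 'a \<Rightarrow> real" where
  "JN r \<delta> N \<phi> \<psi> \<omega> = (\<Sum>k<N. exp (- r * (real (Suc k) * \<delta>)) *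
      (\<phi> (grid \<delta> k \<omega>) * step_U \<delta> k \<omega> + \<psi> (grid \<delta> k \<omega>) * \<delta>))"

lemma JN_measurable:
  assumes "0 < \<delta>" and [measurable]: "\<phi> \<in> borel_measurable borel" "\<psi> \<in> borel_measurable borel"
  shows "JN r \<delta> N \<phi> \<psi> \<in> borel_measurable M"
proof -
  have [measurable]: "grid \<delta> k \<in> borel_measurable M" "step_U \<delta> k \<in> borel_measurable M" for k
    using grid_measurable step_U_measurable assms by auto
  show ?thesis unfolding JN_def[abs_def] by measurable
qed

lemma JN_bound:
  assumes \<delta>: "0 < \<delta>" and r: "0 \<le> r" and \<omega>: "\<omega> \<in> space M"
    and \<phi>: "\<And>x. 0 \<le> x \<Longrightarrow> \<bar>\<phi> x\<bar> \<le> B" and \<psi>: "\<And>x. 0 \<le> x \<Longrightarrow> \<bar>\<psi> x\<bar> \<le> B"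
  shows "\<bar>JN r \<delta> N \<phi> \<psi> \<omega>\<bar> \<le> B * (u0 + 1) * (real N * \<delta>)"
proof -
  have B: "0 \<le> B" using \<phi>[of 0] by auto
  have "\<bar>JN r \<delta> N \<phi> \<psi> \<omega>\<bar> \<le> (\<Sum>k<N. B * (u0 + 1) * \<delta>)"
    unfolding JN_def
  proof (rule order_trans[OF sum_abs], rule sum_mono)
    fix k
    have "\<bar>\<phi> (grid \<delta> k \<omega>) * step_U \<delta> k \<omega>\<bar> \<le> B * (u0 * \<delta>)"
      unfolding abs_mult using step_U_bounds[OF \<delta> \<omega>, of k] B by (intro mult_mono \<phi> grid_nonneg) auto
    moreover have "\<bar>\<psi> (grid \<delta> k \<omega>) * \<delta>\<bar> \<le> B * \<delta>"
      unfolding abs_mult using \<delta> B by (intro mult_mono \<psi> grid_nonneg) auto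
    ultimately have 1: "\<bar>\<phi> (grid \<delta> k \<omega>) * step_U \<delta> k \<omega> + \<psi> (grid \<delta> k \<omega>) * \<delta>\<bar> \<le> B * (u0 + 1) * \<delta>"
      by (simp add: algebra_simps)
    have "exp (- r * (real (Suc k) * \<delta>)) \<le> 1" using \<delta> r by simp
    with 1 have "exp (- r * (real (Suc k) * \<delta>)) * \<bar>\<phi> (grid \<delta> k \<omega>) * step_U \<delta> k \<omega> + \<psi> (grid \<delta> k \<omega>) * \<delta>\<bar>
        \<le> 1 * (B * (u0 + 1) * \<delta>)"
      by (intro mult_mono) auto
    then show "\<bar>exp (- r * (real (Suc k) * \<delta>)) *
         (\<phi> (grid \<delta> k \<omega>) * step_U \<delta> k \<omega> + \<psi> (grid \<delta> k \<omega>) * \<delta>)\<bar> \<le> B * (u0 + 1) * \<delta>"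
      by (simp add: abs_mult)
  qed
  then show ?thesis by (simp add: algebra_simps)
qed

lemma JN_integrable:
  assumes "0 < \<delta>" "0 \<le> r" "\<phi> \<in> borel_measurable borel" "\<psi> \<in> borel_measurable borel"
    and "\<And>x. 0 \<le> x \<Longrightarrow> \<bar>\<phi> x\<bar> \<le> B" "\<And>x. 0 \<le> x \<Longrightarrow> \<bar>\<psi> x\<bar> \<le> B"
  shows "integrable M (JN r \<delta> N \<phi> \<psi>)"
  using assms by (intro integrable_boundedI[where B = "B * (u0 + 1) * (real N * \<delta>)"] JN_measurable JN_bound)

text \<open>The discounted values of \<open>H\<close> along the grid telescope into a discounted sum
  of one-step errors. The discount factors are at most 1, so the errors add up to at most the total
  push times \<open>a\<close> plus the number of steps times the remaining error.\<close>

lemma discrete_ito_error: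
  fixes N :: nat
  assumes "test_function H H1 H2 C L" and \<delta>: "0 < \<delta>" "\<delta> \<le> 1" and r: "0 \<le> r" and a: "0 < a" "a \<le> 1"
  defines "\<psi> \<equiv> \<lambda>x. - \<mu> * H1 x + \<sigma>\<^sup>2 / 2 * H2 x"
    and "K \<equiv> (2 * C + L) * (4 * (speed ^ 3 + 2 * \<sigma> ^ 3)) + C / 2 * (speed\<^sup>2 + 2 * speed * \<sigma>)"
    and "B \<equiv> sqrt (1 + z\<^sup>2) + (2 * speed + (speed + \<sigma>)\<^sup>2) * (real N * \<delta>)"
  shows "\<bar>exp (- r * (real N * \<delta>)) * expectation (\<lambda>\<omega>. H (grid \<delta> N \<omega>)) - H z
       + (exp (r * \<delta>) - 1) / \<delta> * expectation (JN r \<delta> N (\<lambda>_. 0) H) - expectation (JN r \<delta> N H1 \<psi>)\<bar>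
     \<le> 2 * C * a * B + K * (real N * \<delta>) * (sqrt \<delta> / a)"
    (is "\<bar>?E\<bar> \<le> _")
proof -
  interpret test_function H H1 H2 C L by fact
  interpret step: reflected_step M "grid \<delta> k" "drift \<delta> k" "noise \<delta> k" speed \<delta> \<sigma> for k
    by (rule reflected_step_grid[OF \<delta> grid_integrable[OF \<delta>]])
  note [measurable] = grid_measurable[OF \<delta>(1)]
  have [measurable]: "\<psi> \<in> borel_measurable borel" unfolding \<psi>_def by measurable
  define S where "S k \<omega> = H (grid \<delta> (Suc k) \<omega>) - H (grid \<delta> k \<omega>) + H1 (grid \<delta> k \<omega>) * drift \<delta> k \<omega>
     - \<sigma>\<^sup>2 / 2 * \<delta> * H2 (grid \<delta> k \<omega>)" for k \<omega>
  define e where "e k = exp (- r * (real k * \<delta>))" for k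
  have e1: "0 \<le> e k" "e k \<le> 1" for k using r \<delta> by (auto simp: e_def)
  have Hi: "integrable M (\<lambda>\<omega>. H (grid \<delta> k \<omega>))" "integrable M (\<lambda>\<omega>. H1 (grid \<delta> k \<omega>))" "integrable M (\<lambda>\<omega>. H2 (grid \<delta> k \<omega>))" for k
    by (rule integrable_boundedI[where B = C]; simp add: H_le H1_le H2_le grid_nonneg)+
  have bi: "integrable M (\<lambda>\<omega>. H1 (grid \<delta> k \<omega>) * drift \<delta> k \<omega>)" for k
  proof (rule integrable_boundedI)
    show "\<bar>H1 (grid \<delta> k \<omega>) * drift \<delta> k \<omega>\<bar> \<le> C * (speed * \<delta>)" if "\<omega> \<in> space M" for \<omega>
      unfolding abs_mult using that C_nonneg by (intro mult_mono H1_le grid_nonneg drift_le \<delta>) auto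
    show "(\<lambda>\<omega>. H1 (grid \<delta> k \<omega>) * drift \<delta> k \<omega>) \<in> borel_measurable M"
      using step.b_meas[of k] by measurable
  qed
  have Si: "integrable M (S k)" for k
    unfolding S_def using Hi bi by (intro integrable_linear)
  have S_le: "\<bar>expectation (S k)\<bar> \<le> 2 * C * a * push \<delta> k + K * (\<delta> * sqrt \<delta> / a)" for k
  proof -
    have "expectation (S k) = expectation (\<lambda>\<omega>. H (step.D' k \<omega>) - H (grid \<delta> k \<omega>) + H1 (grid \<delta> k \<omega>) * drift \<delta> k \<omega>
     - \<sigma>\<^sup>2 / 2 * \<delta> * H2 (grid \<delta> k \<omega>))"
      unfolding S_def by (rule Bochner_Integration.integral_cong) (simp_all add: D'_eq_grid[OF \<delta>] del: grid.simps)
    then show ?thesis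
      unfolding push_def[OF \<delta>] K_def
      using step.one_step_error[OF borel taylor H_le H1_le H1_lin H2_le C_nonneg L_nonneg a, of k] by simp
  qed
  let ?P = "\<lambda>\<omega>. e N * H (grid \<delta> N \<omega>) - H z + (exp (r * \<delta>) - 1) / \<delta> * JN r \<delta> N (\<lambda>_. 0) H \<omega>
      - JN r \<delta> N H1 \<psi> \<omega>"
  have pointwise: "?P \<omega>
      = (\<Sum>k<N. e (Suc k) * S k \<omega>)" for \<omega>
  proof -
    \<comment> \<open>The ratio of consecutive discounts produces
      \<open>exp (r * \<delta>) - 1\<close>, the discrete counterpart of
      \<open>r * \<delta>\<close>.\<close>
    have e_Suc: "e k = e (Suc k) * exp (r * \<delta>)" for k
      by (simp add: e_def exp_add[symmetric] algebra_simps)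
    have JN_eq: "JN r \<delta> N \<phi> \<psi>' \<omega> = (\<Sum>k<N. e (Suc k) *
        (\<phi> (grid \<delta> k \<omega>) * step_U \<delta> k \<omega> + \<psi>' (grid \<delta> k \<omega>) * \<delta>))" for \<phi> \<psi>'
      by (simp add: JN_def e_def)
    have "e N * H (grid \<delta> N \<omega>) - H z = (\<Sum>k<N. e (Suc k) * H (grid \<delta> (Suc k) \<omega>) - e k * H (grid \<delta> k \<omega>))"
      by (subst sum_lessThan_telescope) (simp add: e_def)
    then have "?P \<omega>
      = (\<Sum>k<N. (e (Suc k) * H (grid \<delta> (Suc k) \<omega>) - e k * H (grid \<delta> k \<omega>))
          + (exp (r * \<delta>) - 1) / \<delta> * (e (Suc k) * (H (grid \<delta> k \<omega>) * \<delta>))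
          - e (Suc k) * (H1 (grid \<delta> k \<omega>) * step_U \<delta> k \<omega> + \<psi> (grid \<delta> k \<omega>) * \<delta>))"
      by (simp only: JN_eq sum_distrib_left sum.distrib sum_subtractf mult_zero_left add_0)
    also have "\<dots> = (\<Sum>k<N. e (Suc k) * S k \<omega>)"
    proof (rule sum.cong[OF refl])
      fix k
      have "(exp (r * \<delta>) - 1) / \<delta> * (e (Suc k) * (H (grid \<delta> k \<omega>) * \<delta>)) = (e k - e (Suc k)) * H (grid \<delta> k \<omega>)"
      proof -
        have "(exp (r * \<delta>) - 1) / \<delta> * (e (Suc k) * (H (grid \<delta> k \<omega>) * \<delta>)) = (exp (r * \<delta>) - 1) * (e (Suc k) * H (grid \<delta> k \<omega>))"
          using \<delta> by simp
        then show ?thesis by (simp add: e_Suc[of k] algebra_simps)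
      qed
      then show "(e (Suc k) * H (grid \<delta> (Suc k) \<omega>) - e k * H (grid \<delta> k \<omega>))
          + (exp (r * \<delta>) - 1) / \<delta> * (e (Suc k) * (H (grid \<delta> k \<omega>) * \<delta>))
          - e (Suc k) * (H1 (grid \<delta> k \<omega>) * step_U \<delta> k \<omega> + \<psi> (grid \<delta> k \<omega>) * \<delta>) = e (Suc k) * S k \<omega>"
        by (simp add: S_def drift_def \<psi>_def algebra_simps del: grid.simps)
    qed
    finally show ?thesis .
  qed
  have \<psi>_le: "\<bar>\<psi> x\<bar> \<le> (\<bar>\<mu>\<bar> + \<sigma>\<^sup>2 / 2 + 1) * C" if "0 \<le> x" for x
    unfolding \<psi>_def by (rule generator_le(1)) (use that in auto)
  have C_le: "C \<le> (\<bar>\<mu>\<bar> + \<sigma>\<^sup>2 / 2 + 1) * C" by (rule generator_le(2)[of 0]) auto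
  have Ji: "integrable M (JN r \<delta> N (\<lambda>_. 0) H)" "integrable M (JN r \<delta> N H1 \<psi>)"
    using \<delta> r H_le C_nonneg H1_le C_le \<psi>_le
    by (auto intro!: JN_integrable[where B = C] JN_integrable[where B = "(\<bar>\<mu>\<bar> + \<sigma>\<^sup>2 / 2 + 1) * C"]
        intro: order_trans)
  have "?E
      = expectation ?P"
    using Hi[of N] Ji by (simp add: prob_space e_def)
  also have "\<dots> = (\<Sum>k<N. e (Suc k) * expectation (S k))"
    unfolding pointwise using Si by simp
  finally have "\<bar>?E\<bar>
     \<le> (\<Sum>k<N. \<bar>e (Suc k) * expectation (S k)\<bar>)" by simp
  also have "\<dots> \<le> (\<Sum>k<N. 2 * C * a * push \<delta> k + K * (\<delta> * sqrt \<delta> / a))"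
  proof (rule sum_mono)
    fix k
    have "\<bar>e (Suc k) * expectation (S k)\<bar> \<le> 1 * \<bar>expectation (S k)\<bar>"
      unfolding abs_mult using e1[of "Suc k"] by (intro mult_right_mono) auto
    with S_le[of k] show "\<bar>e (Suc k) * expectation (S k)\<bar> \<le> 2 * C * a * push \<delta> k + K * (\<delta> * sqrt \<delta> / a)" by simp
  qed
  also have "\<dots> = 2 * C * a * (\<Sum>k<N. push \<delta> k) + K * (real N * \<delta>) * (sqrt \<delta> / a)"
    by (simp add: sum.distrib sum_distrib_left)
  also have "\<dots> \<le> 2 * C * a * B + K * (real N * \<delta>) * (sqrt \<delta> / a)"
    unfolding B_def using C_nonneg a by (intro add_right_mono mult_left_mono sum_push_bound \<delta>) auto
  finally show ?thesis .
qed

end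

section \<open>Passage to continuous time\<close>

lemma nat_floor_divide_iff:
  fixes t \<delta> :: real
  assumes "0 < \<delta>" "0 \<le> t"
  shows "t \<in> {real j * \<delta>..<real (Suc j) * \<delta>} \<longleftrightarrow> j = nat \<lfloor>t / \<delta>\<rfloor>"
proof -
  have "t \<in> {real j * \<delta>..<real (Suc j) * \<delta>} \<longleftrightarrow> \<lfloor>t / \<delta>\<rfloor> = int j"
    using assms(1) by (simp add: floor_eq_iff field_simps)
  also have "\<dots> \<longleftrightarrow> j = nat \<lfloor>t / \<delta>\<rfloor>"
    using assms by (auto simp: nat_eq_iff)
  finally show ?thesis .
qed

lemma nat_floor_divide_bounds:
  fixes t \<delta> :: real
  assumes "0 < \<delta>" "0 \<le> t"
  shows "real (nat \<lfloor>t / \<delta>\<rfloor>) * \<delta> \<le> t" "t < real (Suc (nat \<lfloor>t / \<delta>\<rfloor>)) * \<delta>"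
  using nat_floor_divide_iff[OF assms, of "nat \<lfloor>t / \<delta>\<rfloor>"] by auto

lemma left_grid_point_tendsto:
  fixes t :: real
  assumes "\<delta> \<longlonglongrightarrow> 0" "\<And>n. real (k n) * \<delta> n \<le> t" "\<And>n. t < real (Suc (k n)) * \<delta> n"
  shows "(\<lambda>n. real (k n) * \<delta> n) \<longlonglongrightarrow> t"
proof (rule tendsto_sandwich[where f = "\<lambda>n. t - \<delta> n" and h = "\<lambda>n. t"])
  show "(\<lambda>n. t - \<delta> n) \<longlonglongrightarrow> t" using tendsto_diff[OF tendsto_const assms(1), of t] by simp
  show "\<forall>\<^sub>F n in sequentially. t - \<delta> n \<le> real (k n) * \<delta> n"
    using assms(3) by (intro always_eventually allI) (simp add: algebra_simps less_imp_le)
qed (use assms(2) in auto)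

context controlled_drawdown
begin

definition drawdown :: "real \<Rightarrow> 'a \<Rightarrow> real" where "drawdown = Dproc W \<mu> \<sigma> U z"

lemma drawdown_eq: "drawdown t \<omega> = max z (Sup ((\<lambda>s. X s \<omega>) ` {0..t})) - X t \<omega>"
  by (simp add: drawdown_def Dproc_def Mproc_def X_def)

lemma X_attains_sup:
  assumes "good \<omega>" "0 \<le> t"
  obtains s where "0 \<le> s" "s \<le> t" "Sup ((\<lambda>s. X s \<omega>) ` {0..t}) = X s \<omega>" "\<And>r. 0 \<le> r \<Longrightarrow> r \<le> t \<Longrightarrow> X r \<omega> \<le> X s \<omega>"
proof -
  have "continuous_on {0..t} (\<lambda>s. X s \<omega>)"
    using continuous_X[OF assms(1)] by (rule continuous_on_subset) auto
  then obtain s where s: "s \<in> {0..t}" "\<forall>r\<in>{0..t}. X r \<omega> \<le> X s \<omega>"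
    using continuous_attains_sup[of "{0..t}" "\<lambda>s. X s \<omega>"] assms(2) by auto
  moreover have "Sup ((\<lambda>s. X s \<omega>) ` {0..t}) = X s \<omega>"
    using s by (intro cSup_eq_maximum) auto
  ultimately show ?thesis using that by auto
qed

lemma drawdown_nonneg:
  assumes "good \<omega>" "0 \<le> t"
  shows "0 \<le> drawdown t \<omega>"
proof -
  obtain s where "Sup ((\<lambda>s. X s \<omega>) ` {0..t}) = X s \<omega>" "\<And>r. 0 \<le> r \<Longrightarrow> r \<le> t \<Longrightarrow> X r \<omega> \<le> X s \<omega>"
    using X_attains_sup[OF assms] by metis
  with assms(2) have "X t \<omega> \<le> Sup ((\<lambda>s. X s \<omega>) ` {0..t})" by auto
  then show ?thesis by (simp add: drawdown_eq)
qed

text \<open>Solves the recursion: reflection at 0 amounts to raising the running maximum over the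
  grid points visited so far.\<close>

lemma grid_closed_form:
  assumes "good \<omega>"
  shows "grid \<delta> k \<omega> = max z (Max ((\<lambda>j. X (real j * \<delta>) \<omega>) ` {..k})) - X (real k * \<delta>) \<omega>"
proof (induction k)
  case 0
  show ?case using X_0[OF assms] z by simp
next
  case (Suc k)
  have "Max ((\<lambda>j. X (real j * \<delta>) \<omega>) ` {..Suc k}) = max (X (real (Suc k) * \<delta>) \<omega>) (Max ((\<lambda>j. X (real j * \<delta>) \<omega>) ` {..k}))"
    by (simp add: atMost_Suc del: of_nat_Suc)
  then show ?case using Suc by (simp add: max_def del: of_nat_Suc)
qed

text \<open>A continuous path attains its maximum over \<open>{0..t}\<close> at some
  \<open>s\<close>. The grid points just left of \<open>s\<close> converge to \<open>s\<close> and
  squeeze the maximum over the grid against the true one.\<close>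

lemma grid_tendsto:
  assumes g: "good \<omega>" and t: "0 \<le> t" and \<delta>: "\<And>n. 0 < \<delta> n" "\<delta> \<longlonglongrightarrow> 0"
    and k: "\<And>n. real (k n) * \<delta> n \<le> t" "\<And>n. t < real (Suc (k n)) * \<delta> n"
  shows "(\<lambda>n. grid (\<delta> n) (k n) \<omega>) \<longlonglongrightarrow> drawdown t \<omega>"
proof -
  have lim: "(\<lambda>n. X (s n) \<omega>) \<longlonglongrightarrow> X l \<omega>" if "s \<longlonglongrightarrow> l" "\<And>n. 0 \<le> s n" "0 \<le> l" for s l
    using continuous_on_tendsto_compose[OF continuous_X[OF g] that(1)] that by auto
  obtain s where s: "0 \<le> s" "s \<le> t" "Sup ((\<lambda>s. X s \<omega>) ` {0..t}) = X s \<omega>"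
      "\<And>r. 0 \<le> r \<Longrightarrow> r \<le> t \<Longrightarrow> X r \<omega> \<le> X s \<omega>"
    using X_attains_sup[OF g t] by metis
  define j where "j n = nat \<lfloor>s / \<delta> n\<rfloor>" for n
  have j: "real (j n) * \<delta> n \<le> s" "s < real (Suc (j n)) * \<delta> n" for n
    unfolding j_def by (rule nat_floor_divide_bounds[OF \<delta>(1) s(1)])+
  \<comment> \<open>The grid point left of the maximiser must be among those up to
    \<open>k n\<close> to take part in the maximum.\<close>
  have jk: "j n \<le> k n" for n
  proof -
    have "real (j n) * \<delta> n < real (Suc (k n)) * \<delta> n" using j(1)[of n] k(2)[of n] s(2) by linarith
    then have "real (j n) < real (Suc (k n))" using \<delta>(1)[of n] by (simp only: mult_less_cancel_right_pos)
    then show ?thesis by simp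
  qed
  have "(\<lambda>n. Max ((\<lambda>j. X (real j * \<delta> n) \<omega>) ` {..k n})) \<longlonglongrightarrow> X s \<omega>"
  proof (rule tendsto_sandwich)
    show "(\<lambda>n. X (real (j n) * \<delta> n) \<omega>) \<longlonglongrightarrow> X s \<omega>"
      using \<delta>(1) by (intro lim left_grid_point_tendsto \<delta> j s(1)) (simp add: less_imp_le)
    show "\<forall>\<^sub>F n in sequentially. X (real (j n) * \<delta> n) \<omega> \<le> Max ((\<lambda>j. X (real j * \<delta> n) \<omega>) ` {..k n})"
      using jk by (intro always_eventually allI Max_ge) auto
    show "\<forall>\<^sub>F n in sequentially. Max ((\<lambda>j. X (real j * \<delta> n) \<omega>) ` {..k n}) \<le> X s \<omega>"
    proof (intro always_eventually allI)
      fix n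
      have "X (real i * \<delta> n) \<omega> \<le> X s \<omega>" if "i \<le> k n" for i
      proof (rule s(4))
        have "real i * \<delta> n \<le> real (k n) * \<delta> n" using that \<delta>(1)[of n] by (intro mult_right_mono) auto
        then show "real i * \<delta> n \<le> t" using k(1)[of n] by linarith
      qed (use \<delta>(1)[of n] in simp)
      then show "Max ((\<lambda>j. X (real j * \<delta> n) \<omega>) ` {..k n}) \<le> X s \<omega>" by (subst Max_le_iff) auto
    qed
  qed auto
  moreover have "(\<lambda>n. X (real (k n) * \<delta> n) \<omega>) \<longlonglongrightarrow> X t \<omega>"
    using \<delta>(1) by (intro lim left_grid_point_tendsto \<delta> k t) (simp add: less_imp_le)
  ultimately have "(\<lambda>n. max z (Max ((\<lambda>j. X (real j * \<delta> n) \<omega>) ` {..k n})) - X (real (k n) * \<delta> n) \<omega>) \<longlonglongrightarrow> max z (X s \<omega>) - X t \<omega>"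
    by (intro tendsto_diff tendsto_max tendsto_const)
  then show ?thesis by (simp add: grid_closed_form[OF g] drawdown_eq s(3))
qed

lemma floor_grid_tendsto:
  assumes "good \<omega>" "0 \<le> t" "\<And>n. 0 < \<delta> n" "\<delta> \<longlonglongrightarrow> 0"
  shows "(\<lambda>n. grid (\<delta> n) (nat \<lfloor>t / \<delta> n\<rfloor>) \<omega>) \<longlonglongrightarrow> drawdown t \<omega>"
  using assms by (intro grid_tendsto nat_floor_divide_bounds) auto

lemma drawdown_borel:
  assumes g: "good \<omega>"
  shows "(\<lambda>t. indicator {0..} t * drawdown t \<omega>) \<in> borel_measurable borel"
proof (rule borel_measurable_LIMSEQ_real)
  define \<delta> where "\<delta> n = 1 / real (Suc n)" for n
  have \<delta>: "\<And>n. 0 < \<delta> n" "\<delta> \<longlonglongrightarrow> 0"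
    using LIMSEQ_inverse_real_of_nat by (simp_all add: \<delta>_def[abs_def] inverse_eq_divide)
  show "(\<lambda>n. indicator {0..} t * grid (\<delta> n) (nat \<lfloor>t / \<delta> n\<rfloor>) \<omega>) \<longlonglongrightarrow> indicator {0..} t * drawdown t \<omega>" for t
    using floor_grid_tendsto[OF g _ \<delta>, of t] by (auto simp: indicator_def)
  fix n
  have "(\<lambda>t. nat \<lfloor>t / \<delta> n\<rfloor>) \<in> measurable borel (count_space UNIV)" by measurable
  then have [measurable]: "(\<lambda>t. grid (\<delta> n) (nat \<lfloor>t / \<delta> n\<rfloor>) \<omega>) \<in> borel_measurable borel"
    by (rule measurable_compose) simp
  show "(\<lambda>t. indicator {0..} t * grid (\<delta> n) (nat \<lfloor>t / \<delta> n\<rfloor>) \<omega>) \<in> borel_measurable borel"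
    by measurable
qed

text \<open>One integrand for three purposes: the right-hand side of Ito's formula, the reward
  itself (\<open>\<phi>\<close> constant, \<open>\<psi>\<close> minus an indicator), and the
  difference between the value of a control and the candidate.\<close>

definition J_fun :: "real \<Rightarrow> (real \<Rightarrow> real) \<Rightarrow> (real \<Rightarrow> real) \<Rightarrow> 'a \<Rightarrow> real \<Rightarrow> real" where
  "J_fun r \<phi> \<psi> \<omega> t = exp (- r * t) * (\<phi> (drawdown t \<omega>) * U t \<omega> + \<psi> (drawdown t \<omega>))"

definition J :: "real \<Rightarrow> real set \<Rightarrow> (real \<Rightarrow> real) \<Rightarrow> (real \<Rightarrow> real) \<Rightarrow> 'a \<Rightarrow> real" where
  "J r A \<phi> \<psi> \<omega> = (LBINT t:A. J_fun r \<phi> \<psi> \<omega> t)"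

lemma J_fun_borel:
  assumes g: "good \<omega>" and [measurable]: "\<phi> \<in> borel_measurable borel" "\<psi> \<in> borel_measurable borel"
    and A [measurable]: "A \<in> sets borel" and sub: "A \<subseteq> {0..}"
  shows "set_borel_measurable lborel A (J_fun r \<phi> \<psi> \<omega>)"
proof -
  note [measurable] = drawdown_borel[OF g]
  have [measurable]: "(\<lambda>t. indicator {0..} t * U t \<omega>) \<in> borel_measurable borel"
    using U_borel[OF good_space[OF g]] by simp
  have "(\<lambda>t. indicator A t *\<^sub>R (exp (- r * t) * (\<phi> (indicator {0..} t * drawdown t \<omega>) * (indicator {0..} t * U t \<omega>)
      + \<psi> (indicator {0..} t * drawdown t \<omega>)))) \<in> borel_measurable lborel"
    by measurable
  also have "(\<lambda>t. indicator A t *\<^sub>R (exp (- r * t) * (\<phi> (indicator {0..} t * drawdown t \<omega>) * (indicator {0..} t * U t \<omega>)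
      + \<psi> (indicator {0..} t * drawdown t \<omega>)))) = (\<lambda>t. indicator A t *\<^sub>R J_fun r \<phi> \<psi> \<omega> t)"
    using sub by (auto simp: indicator_def J_fun_def fun_eq_iff)
  finally show ?thesis by (simp add: set_borel_measurable_def)
qed

lemma J_fun_le:
  assumes g: "good \<omega>" and t: "0 \<le> t"
    and \<phi>: "\<And>x. 0 \<le> x \<Longrightarrow> \<bar>\<phi> x\<bar> \<le> B" and \<psi>: "\<And>x. 0 \<le> x \<Longrightarrow> \<bar>\<psi> x\<bar> \<le> B"
  shows "\<bar>J_fun r \<phi> \<psi> \<omega> t\<bar> \<le> exp (- r * t) * (B * (u0 + 1))"
proof -
  have B: "0 \<le> B" using \<phi>[of 0] by auto
  have "\<bar>\<phi> (drawdown t \<omega>) * U t \<omega>\<bar> \<le> B * u0"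
    unfolding abs_mult using B by (intro mult_mono \<phi> drawdown_nonneg U_abs_le g t good_space[OF g]) auto
  moreover have "\<bar>\<psi> (drawdown t \<omega>)\<bar> \<le> B" by (intro \<psi> drawdown_nonneg g t)
  ultimately have "\<bar>\<phi> (drawdown t \<omega>) * U t \<omega> + \<psi> (drawdown t \<omega>)\<bar> \<le> B * (u0 + 1)"
    by (simp add: algebra_simps)
  then show ?thesis by (simp add: J_fun_def abs_mult)
qed

lemma J_fun_integrable:
  assumes g: "good \<omega>" and m: "\<phi> \<in> borel_measurable borel" "\<psi> \<in> borel_measurable borel"
    and A: "A \<in> sets borel" "A \<subseteq> {0..}" "set_integrable lborel A (\<lambda>t. exp (- r * t))"
    and \<phi>: "\<And>x. 0 \<le> x \<Longrightarrow> \<bar>\<phi> x\<bar> \<le> B" and \<psi>: "\<And>x. 0 \<le> x \<Longrightarrow> \<bar>\<psi> x\<bar> \<le> B"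
  shows "set_integrable lborel A (J_fun r \<phi> \<psi> \<omega>)"
proof (rule set_integrable_bound)
  show "set_integrable lborel A (\<lambda>t. exp (- r * t) * (B * (u0 + 1)))" using A by simp
  show "set_borel_measurable lborel A (J_fun r \<phi> \<psi> \<omega>)" by (rule J_fun_borel[OF g m A(1,2)])
  show "AE t in lborel. t \<in> A \<longrightarrow> norm (J_fun r \<phi> \<psi> \<omega> t) \<le> norm (exp (- r * t) * (B * (u0 + 1)))"
  proof (intro AE_I2 impI)
    fix t assume "t \<in> A"
    then have "0 \<le> t" using A(2) by auto
    from J_fun_le[where r = r, OF g this \<phi> \<psi>]
    show "norm (J_fun r \<phi> \<psi> \<omega> t) \<le> norm (exp (- r * t) * (B * (u0 + 1)))"
      unfolding real_norm_def by (rule order_trans[OF _ abs_ge_self])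
  qed
qed

lemma J_LIMSEQ:
  assumes g: "good \<omega>"
    and m: "\<And>n. \<phi>n n \<in> borel_measurable borel" "\<And>n. \<psi>n n \<in> borel_measurable borel"
      "\<phi> \<in> borel_measurable borel" "\<psi> \<in> borel_measurable borel"
    and A: "A \<in> sets borel" "A \<subseteq> {0..}" "set_integrable lborel A (\<lambda>t. exp (- r * t))"
    and \<phi>: "\<And>n x. 0 \<le> x \<Longrightarrow> \<bar>\<phi>n n x\<bar> \<le> B" and \<psi>: "\<And>n x. 0 \<le> x \<Longrightarrow> \<bar>\<psi>n n x\<bar> \<le> B"
    and lim: "\<And>x. 0 \<le> x \<Longrightarrow> (\<lambda>n. \<phi>n n x) \<longlonglongrightarrow> \<phi> x" "\<And>x. 0 \<le> x \<Longrightarrow> (\<lambda>n. \<psi>n n x) \<longlonglongrightarrow> \<psi> x"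
  shows "(\<lambda>n. J r A (\<phi>n n) (\<psi>n n) \<omega>) \<longlonglongrightarrow> J r A \<phi> \<psi> \<omega>"
  unfolding J_def set_lebesgue_integral_def
proof (rule integral_dominated_convergence)
  let ?f = "\<lambda>n t. indicator A t *\<^sub>R J_fun r (\<phi>n n) (\<psi>n n) \<omega> t"
    and ?g = "\<lambda>t. indicator A t *\<^sub>R J_fun r \<phi> \<psi> \<omega> t"
    and ?w = "\<lambda>t. indicator A t *\<^sub>R (exp (- r * t) * (B * (u0 + 1)))"
  show "integrable lborel ?w"
    using set_integrable_mult_left[OF A(3), of "B * (u0 + 1)"] by (simp add: set_integrable_def)
  show "?g \<in> borel_measurable lborel"
    using J_fun_borel[OF g m(3,4) A(1,2)] by (simp add: set_borel_measurable_def)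
  show "(?f n) \<in> borel_measurable lborel" for n
    using J_fun_borel[OF g m(1,2) A(1,2)] by (simp add: set_borel_measurable_def)
  show "AE t in lborel. norm (?f n t) \<le> ?w t" for n
  proof (rule AE_I2)
    fix t
    show "norm (?f n t) \<le> ?w t"
    proof (cases "t \<in> A")
      case True
      then have "0 \<le> t" using A(2) by auto
      then show ?thesis using J_fun_le[where r = r and \<phi> = "\<phi>n n" and \<psi> = "\<psi>n n", OF g \<open>0 \<le> t\<close> \<phi> \<psi>] True by simp
    qed simp
  qed
  show "AE t in lborel. (\<lambda>n. ?f n t) \<longlonglongrightarrow> ?g t"
  proof (rule AE_I2)
    fix t
    show "(\<lambda>n. ?f n t) \<longlonglongrightarrow> ?g t"
    proof (cases "t \<in> A")
      case True
      then have "0 \<le> t" using A(2) by auto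
      then have "0 \<le> drawdown t \<omega>" by (rule drawdown_nonneg[OF g])
      then show ?thesis unfolding J_fun_def by (intro tendsto_intros lim)
    qed simp
  qed
qed

text \<open>The sum is the integral of an integrand that is frozen on each cell except for the
  control, which remains the true one.\<close>

lemma JN_eq_integral:
  assumes \<omega>: "\<omega> \<in> space M" and \<delta>: "0 < \<delta>"
  shows "JN r \<delta> N \<phi> \<psi> \<omega> = (\<integral>t. (\<Sum>k<N. indicator {real k * \<delta>..<real (Suc k) * \<delta>} t *\<^sub>R
      (exp (- r * (real (Suc k) * \<delta>)) * (\<phi> (grid \<delta> k \<omega>) * U t \<omega> + \<psi> (grid \<delta> k \<omega>)))) \<partial>lborel)"
    and "integrable lborel (\<lambda>t. \<Sum>k<N. indicator {real k * \<delta>..<real (Suc k) * \<delta>} t *\<^sub>R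
      (exp (- r * (real (Suc k) * \<delta>)) * (\<phi> (grid \<delta> k \<omega>) * U t \<omega> + \<psi> (grid \<delta> k \<omega>))))"
proof -
  let ?I = "\<lambda>k. {real k * \<delta>..<real (Suc k) * \<delta>}"
  have I: "?I k \<subseteq> {0..real (Suc k) * \<delta>}" for k
  proof
    fix x assume "x \<in> ?I k"
    moreover have "0 \<le> real k * \<delta>" using \<delta> by simp
    ultimately show "x \<in> {0..real (Suc k) * \<delta>}" unfolding atLeastLessThan_iff atLeastAtMost_iff by linarith
  qed
  have Ui: "set_integrable lborel (?I k) (\<lambda>t. U t \<omega>)" for k
    by (rule U_integrable[OF \<omega> _ I]) simp
  have ci: "set_integrable lborel (?I k) (\<lambda>t. c)" for k and c :: real
    by (rule set_integrable_const_bounded[OF _ I]) simp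
  have si: "set_integrable lborel (?I k) (\<lambda>t. c * (p * U t \<omega> + q))" for k and c p q :: real
    using Ui ci by (intro set_integrable_mult_right set_integral_add(1)) auto
  have val: "(LBINT t:?I k. c * (p * U t \<omega> + q)) = c * (p * step_U \<delta> k \<omega> + q * \<delta>)" for k and c p q :: real
  proof -
    have "(LBINT t:?I k. p * U t \<omega> + q) = p * step_U \<delta> k \<omega> + q * \<delta>"
      using Ui ci \<delta>
      by (subst set_integral_add(2)) (auto simp: step_U_def U_int_def set_integral_const algebra_simps)
    then show ?thesis by simp
  qed
  show "integrable lborel (\<lambda>t. \<Sum>k<N. indicator (?I k) t *\<^sub>R
      (exp (- r * (real (Suc k) * \<delta>)) * (\<phi> (grid \<delta> k \<omega>) * U t \<omega> + \<psi> (grid \<delta> k \<omega>))))"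
    using si by (intro Bochner_Integration.integrable_sum) (simp add: set_integrable_def)
  show "JN r \<delta> N \<phi> \<psi> \<omega> = (\<integral>t. (\<Sum>k<N. indicator (?I k) t *\<^sub>R
      (exp (- r * (real (Suc k) * \<delta>)) * (\<phi> (grid \<delta> k \<omega>) * U t \<omega> + \<psi> (grid \<delta> k \<omega>)))) \<partial>lborel)"
    (is "_ = ?r")
  proof -
    have "?r = (\<Sum>k<N. LBINT t:?I k. exp (- r * (real (Suc k) * \<delta>)) * (\<phi> (grid \<delta> k \<omega>) * U t \<omega> + \<psi> (grid \<delta> k \<omega>)))"
      unfolding set_lebesgue_integral_def
      by (rule Bochner_Integration.integral_sum) (rule si[unfolded set_integrable_def])
    then show ?thesis unfolding val JN_def by simp
  qed
qed

lemma grid_sum_single: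
  fixes f :: "nat \<Rightarrow> real"
  assumes \<delta>: "0 < \<delta>" and N: "real N * \<delta> = T"
  shows "(\<Sum>k<N. indicator {real k * \<delta>..<real (Suc k) * \<delta>} t *\<^sub>R f k) = indicator {0..<T} t * f (nat \<lfloor>t / \<delta>\<rfloor>)"
proof (cases "0 \<le> t")
  case True
  have "(\<Sum>k<N. indicator {real k * \<delta>..<real (Suc k) * \<delta>} t *\<^sub>R f k) = (\<Sum>k<N. if k = nat \<lfloor>t / \<delta>\<rfloor> then f k else 0)"
    using nat_floor_divide_iff[OF \<delta> True] by (intro sum.cong) (simp_all add: indicator_def del: of_nat_Suc)
  also have "\<dots> = (if nat \<lfloor>t / \<delta>\<rfloor> < N then f (nat \<lfloor>t / \<delta>\<rfloor>) else 0)" by simp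
  also have "nat \<lfloor>t / \<delta>\<rfloor> < N \<longleftrightarrow> t < T"
  proof -
    have "t < T \<longleftrightarrow> t / \<delta> < real N" using \<delta> N by (simp add: field_simps)
    also have "\<dots> \<longleftrightarrow> \<lfloor>t / \<delta>\<rfloor> < int N" by (simp add: floor_less_iff)
    also have "\<dots> \<longleftrightarrow> nat \<lfloor>t / \<delta>\<rfloor> < N" using True \<delta> by (simp add: nat_less_iff)
    finally show ?thesis by simp
  qed
  finally show ?thesis using True by simp
next
  case False
  have "indicator {real k * \<delta>..<real (Suc k) * \<delta>} t = (0::real)" for k
  proof -
    have "0 \<le> real k * \<delta>" using \<delta> by simp
    then have "t \<notin> {real k * \<delta>..<real (Suc k) * \<delta>}" using False unfolding atLeastLessThan_iff by linarith
    then show ?thesis by simp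
  qed
  then show ?thesis using False by simp
qed

lemma exp_set_integrable_bounded: "set_integrable lborel {0..<T} (\<lambda>t. exp (- r * t) :: real)"
proof (rule set_integrable_subset)
  show "set_integrable lborel {0..T} (\<lambda>t. exp (- r * t) :: real)"
    by (intro borel_integrable_atLeastAtMost' continuous_intros)
qed auto

text \<open>At a fixed time the factor \<open>U t \<omega>\<close> does not depend on the mesh; only
  the drawdown and the discount converge. Hence continuity of \<open>\<phi>\<close> and
  \<open>\<psi>\<close> suffices for dominated convergence.\<close>

lemma JN_tendsto:
  assumes g: "good \<omega>" and r: "0 \<le> r" and T: "0 < T"
    and c: "continuous_on UNIV \<phi>" "continuous_on UNIV \<psi>"
    and \<phi>: "\<And>x. 0 \<le> x \<Longrightarrow> \<bar>\<phi> x\<bar> \<le> B" and \<psi>: "\<And>x. 0 \<le> x \<Longrightarrow> \<bar>\<psi> x\<bar> \<le> B"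
  shows "(\<lambda>n. JN r (T / real (Suc n)) (Suc n) \<phi> \<psi> \<omega>) \<longlonglongrightarrow> J r {0..<T} \<phi> \<psi> \<omega>"
proof -
  define \<delta> where "\<delta> n = T / real (Suc n)" for n
  have \<delta>: "\<And>n. 0 < \<delta> n" "\<delta> \<longlonglongrightarrow> 0"
    using T tendsto_mult[OF tendsto_const LIMSEQ_inverse_real_of_nat, of T]
    by (simp_all add: \<delta>_def[abs_def] divide_inverse)
  have NT: "real (Suc n) * \<delta> n = T" for n by (simp add: \<delta>_def)
  define k where "k n t = nat \<lfloor>t / \<delta> n\<rfloor>" for n and t :: real
  define f where "f n t = exp (- r * (real (Suc (k n t)) * \<delta> n)) * (\<phi> (grid (\<delta> n) (k n t) \<omega>) * U t \<omega> + \<psi> (grid (\<delta> n) (k n t) \<omega>))" for n t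
  have B: "0 \<le> B" using \<phi>[of 0] by auto
  have f_int: "integrable lborel (\<lambda>t. indicator {0..<T} t * f n t)"
    and JN: "JN r (\<delta> n) (Suc n) \<phi> \<psi> \<omega> = (\<integral>t. indicator {0..<T} t * f n t \<partial>lborel)" for n
    using JN_eq_integral[OF good_space[OF g] \<delta>(1)[of n], where N = "Suc n" and r = r and \<phi> = \<phi> and \<psi> = \<psi>]
    unfolding grid_sum_single[OF \<delta>(1)[of n] NT[of n]] f_def k_def by auto
  have f_le: "\<bar>f n t\<bar> \<le> B * (u0 + 1)" if t: "0 \<le> t" for n t
  proof -
    have "\<bar>\<phi> (grid (\<delta> n) (k n t) \<omega>) * U t \<omega>\<bar> \<le> B * u0"
      unfolding abs_mult using B by (intro mult_mono \<phi> grid_nonneg U_abs_le t good_space[OF g]) auto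
    moreover have "\<bar>\<psi> (grid (\<delta> n) (k n t) \<omega>)\<bar> \<le> B" by (intro \<psi> grid_nonneg)
    ultimately have "\<bar>\<phi> (grid (\<delta> n) (k n t) \<omega>) * U t \<omega> + \<psi> (grid (\<delta> n) (k n t) \<omega>)\<bar> \<le> B * (u0 + 1)"
      by (simp add: algebra_simps)
    moreover have "exp (- r * (real (Suc (k n t)) * \<delta> n)) \<le> 1" using r \<delta>(1)[of n] by simp
    ultimately have "exp (- r * (real (Suc (k n t)) * \<delta> n)) * \<bar>\<phi> (grid (\<delta> n) (k n t) \<omega>) * U t \<omega> + \<psi> (grid (\<delta> n) (k n t) \<omega>)\<bar> \<le> 1 * (B * (u0 + 1))"
      by (intro mult_mono) auto
    then show ?thesis by (simp add: f_def abs_mult)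
  qed
  have f_lim: "(\<lambda>n. f n t) \<longlonglongrightarrow> J_fun r \<phi> \<psi> \<omega> t" if t: "0 \<le> t" for t
  proof -
    have gl: "(\<lambda>n. grid (\<delta> n) (k n t) \<omega>) \<longlonglongrightarrow> drawdown t \<omega>"
      unfolding k_def by (rule floor_grid_tendsto[OF g t \<delta>])
    have "(\<lambda>n. real (k n t) * \<delta> n) \<longlonglongrightarrow> t"
      unfolding k_def by (rule left_grid_point_tendsto[OF \<delta>(2)]) (rule nat_floor_divide_bounds[OF \<delta>(1) t])+
    then have "(\<lambda>n. real (k n t) * \<delta> n + \<delta> n) \<longlonglongrightarrow> t + 0" by (rule tendsto_add) (rule \<delta>)
    then have "(\<lambda>n. real (Suc (k n t)) * \<delta> n) \<longlonglongrightarrow> t" by (simp add: algebra_simps)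
    then show ?thesis
      unfolding f_def J_fun_def
      by (intro tendsto_intros continuous_on_tendsto_compose[OF c(1) gl] continuous_on_tendsto_compose[OF c(2) gl]) auto
  qed
  have [measurable]: "\<phi> \<in> borel_measurable borel" "\<psi> \<in> borel_measurable borel"
    using c by (auto intro: borel_measurable_continuous_onI)
  have "(\<lambda>n. \<integral>t. indicator {0..<T} t * f n t \<partial>lborel) \<longlonglongrightarrow> (\<integral>t. indicator {0..<T} t * J_fun r \<phi> \<psi> \<omega> t \<partial>lborel)"
  proof (rule integral_dominated_convergence)
    have "set_integrable lborel {0..<T} (\<lambda>_. B * (u0 + 1))"
      by (rule set_integrable_const_bounded[where a = 0 and b = T]) auto
    then show "integrable lborel (\<lambda>t. indicator {0..<T} t * (B * (u0 + 1)))"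
      by (simp add: set_integrable_def)
    show "(\<lambda>t. indicator {0..<T} t * J_fun r \<phi> \<psi> \<omega> t) \<in> borel_measurable lborel"
    proof -
      have "set_borel_measurable lborel {0..<T} (J_fun r \<phi> \<psi> \<omega>)"
        by (rule J_fun_borel[OF g]) auto
      then show ?thesis by (simp add: set_borel_measurable_def)
    qed
    show "(\<lambda>t. indicator {0..<T} t * f n t) \<in> borel_measurable lborel" for n
      by (rule borel_measurable_integrable[OF f_int])
    show "AE t in lborel. norm (indicator {0..<T} t * f n t) \<le> indicator {0..<T} t * (B * (u0 + 1))" for n
      using f_le by (intro AE_I2) (auto simp: indicator_def)
    show "AE t in lborel. (\<lambda>n. indicator {0..<T} t * f n t) \<longlonglongrightarrow> indicator {0..<T} t * J_fun r \<phi> \<psi> \<omega> t"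
      using f_lim by (intro AE_I2) (auto simp: indicator_def)
  qed
  then show ?thesis
    unfolding J_def set_lebesgue_integral_def by (simp add: JN[symmetric] \<delta>_def)
qed

section \<open>Expectations as the mesh tends to 0\<close>

context
  fixes r T B :: real and \<phi> \<psi> :: "real \<Rightarrow> real"
  assumes r: "0 \<le> r" and T: "0 < T"
    and c: "continuous_on UNIV \<phi>" "continuous_on UNIV \<psi>"
    and \<phi>: "\<And>x. 0 \<le> x \<Longrightarrow> \<bar>\<phi> x\<bar> \<le> B" and \<psi>: "\<And>x. 0 \<le> x \<Longrightarrow> \<bar>\<psi> x\<bar> \<le> B"
begin

lemma test_borel: "\<phi> \<in> borel_measurable borel" "\<psi> \<in> borel_measurable borel"
  using c by (auto intro: borel_measurable_continuous_onI)

lemma mesh_pos: "0 < T / real (Suc n)"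
  using T by simp

lemma J_measurable: "J r {0..<T} \<phi> \<psi> \<in> borel_measurable M"
proof (rule borel_measurable_AE_LIMSEQ)
  show "JN r (T / real (Suc n)) (Suc n) \<phi> \<psi> \<in> borel_measurable M" for n
    by (rule JN_measurable[OF mesh_pos test_borel])
  show "AE \<omega> in M. (\<lambda>n. JN r (T / real (Suc n)) (Suc n) \<phi> \<psi> \<omega>) \<longlonglongrightarrow> J r {0..<T} \<phi> \<psi> \<omega>"
    using AE_good by eventually_elim (rule JN_tendsto[OF _ r T c \<phi> \<psi>])
qed

lemma JN_mesh_bound:
  assumes "\<omega> \<in> space M"
  shows "\<bar>JN r (T / real (Suc n)) (Suc n) \<phi> \<psi> \<omega>\<bar> \<le> B * (u0 + 1) * T"
  using JN_bound[where N = "Suc n", OF mesh_pos[of n] r assms \<phi> \<psi>] by (simp del: of_nat_Suc)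

lemma J_bound:
  assumes "good \<omega>"
  shows "\<bar>J r {0..<T} \<phi> \<psi> \<omega>\<bar> \<le> B * (u0 + 1) * T"
  using tendsto_rabs[OF JN_tendsto[OF assms r T c \<phi> \<psi>]] JN_mesh_bound[OF good_space[OF assms]]
  by (intro LIMSEQ_le_const2) auto

lemma J_integrable: "integrable M (J r {0..<T} \<phi> \<psi>)"
proof (rule integrable_const_bound[OF _ J_measurable])
  show "AE \<omega> in M. norm (J r {0..<T} \<phi> \<psi> \<omega>) \<le> B * (u0 + 1) * T"
    using AE_good by eventually_elim (simp add: J_bound)
qed

lemma expectation_JN_tendsto:
  "(\<lambda>n. expectation (JN r (T / real (Suc n)) (Suc n) \<phi> \<psi>)) \<longlonglongrightarrow> expectation (J r {0..<T} \<phi> \<psi>)"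
proof (rule integral_dominated_convergence)
  show "JN r (T / real (Suc n)) (Suc n) \<phi> \<psi> \<in> borel_measurable M" for n
    by (rule JN_measurable[OF mesh_pos test_borel])
  show "AE \<omega> in M. (\<lambda>n. JN r (T / real (Suc n)) (Suc n) \<phi> \<psi> \<omega>) \<longlonglongrightarrow> J r {0..<T} \<phi> \<psi> \<omega>"
    using AE_good by eventually_elim (rule JN_tendsto[OF _ r T c \<phi> \<psi>])
  show "AE \<omega> in M. norm (JN r (T / real (Suc n)) (Suc n) \<phi> \<psi> \<omega>) \<le> B * (u0 + 1) * T" for n
    using JN_mesh_bound by (intro AE_I2) simp
  show "integrable M (\<lambda>\<omega>. B * (u0 + 1) * T)" by simp
qed (rule J_measurable)

lemma grid_end_tendsto:
  assumes "good \<omega>"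
  shows "(\<lambda>n. \<phi> (grid (T / real (Suc n)) (Suc n) \<omega>)) \<longlonglongrightarrow> \<phi> (drawdown T \<omega>)"
proof (rule continuous_on_tendsto_compose[OF c(1)])
  have "(\<lambda>n. T / real (Suc n)) \<longlonglongrightarrow> 0"
    using tendsto_mult[OF tendsto_const LIMSEQ_inverse_real_of_nat, of T] by (simp add: divide_inverse)
  then show "(\<lambda>n. grid (T / real (Suc n)) (Suc n) \<omega>) \<longlonglongrightarrow> drawdown T \<omega>"
    \<comment> \<open>The final time is itself a grid point, namely the left end of the cell with
      index \<open>Suc n\<close>.\<close>
    using T by (intro grid_tendsto[OF assms]) (auto simp: field_simps)
qed auto

lemma drawdown_measurable: "(\<lambda>\<omega>. \<phi> (drawdown T \<omega>)) \<in> borel_measurable M"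
proof (rule borel_measurable_AE_LIMSEQ)
  show "(\<lambda>\<omega>. \<phi> (grid (T / real (Suc n)) (Suc n) \<omega>)) \<in> borel_measurable M" for n
    using grid_measurable[OF mesh_pos[of n], of "Suc n"] test_borel(1) by measurable
  show "AE \<omega> in M. (\<lambda>n. \<phi> (grid (T / real (Suc n)) (Suc n) \<omega>)) \<longlonglongrightarrow> \<phi> (drawdown T \<omega>)"
    using AE_good by eventually_elim (rule grid_end_tendsto)
qed

lemma expectation_grid_end_tendsto:
  "(\<lambda>n. expectation (\<lambda>\<omega>. \<phi> (grid (T / real (Suc n)) (Suc n) \<omega>))) \<longlonglongrightarrow> expectation (\<lambda>\<omega>. \<phi> (drawdown T \<omega>))"
proof (rule integral_dominated_convergence)
  show "(\<lambda>\<omega>. \<phi> (grid (T / real (Suc n)) (Suc n) \<omega>)) \<in> borel_measurable M" for n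
    using grid_measurable[OF mesh_pos[of n], of "Suc n"] test_borel(1) by measurable
  show "AE \<omega> in M. (\<lambda>n. \<phi> (grid (T / real (Suc n)) (Suc n) \<omega>)) \<longlonglongrightarrow> \<phi> (drawdown T \<omega>)"
    using AE_good by eventually_elim (rule grid_end_tendsto)
  show "AE \<omega> in M. norm (\<phi> (grid (T / real (Suc n)) (Suc n) \<omega>)) \<le> B" for n
    using \<phi> grid_nonneg by (intro AE_I2) (simp del: grid.simps)
  show "integrable M (\<lambda>\<omega>. B)" by simp
qed (rule drawdown_measurable)

end

lemma exp_difference_quotient:
  assumes T: "0 < T"
  shows "(\<lambda>n. (exp (r * (T / real (Suc n))) - 1) / (T / real (Suc n))) \<longlonglongrightarrow> r"
proof -
  have "((\<lambda>x. exp (r * x)) has_field_derivative r) (at 0)"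
    by (auto intro!: derivative_eq_intros)
  then have l: "((\<lambda>h. (exp (r * h) - 1) / h) \<longlongrightarrow> r) (at 0)"
    by (simp add: DERIV_def)
  have "(\<lambda>n. T / real (Suc n)) \<longlonglongrightarrow> 0"
    using tendsto_mult[OF tendsto_const LIMSEQ_inverse_real_of_nat, of T] by (simp add: divide_inverse)
  then have "filterlim (\<lambda>n. T / real (Suc n)) (at 0) sequentially"
    using T by (intro filterlim_atI always_eventually) auto
  then show ?thesis by (rule filterlim_compose[OF l])
qed

text \<open>Both sides are limits of their counterparts on the grids with \<open>Suc n\<close> cells
  in \<open>[0, T)\<close>; the test function, and with it \<open>C\<close> and \<open>L\<close>,
  stays fixed while the mesh shrinks. The term with \<open>r\<close> comes from the difference
  quotient of the discount and is merged into the integrand at the end.\<close>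

theorem ito_formula:
  assumes tf: "test_function H H1 H2 C L" and r: "0 \<le> r" and T: "0 < T"
  shows "exp (- r * T) * expectation (\<lambda>\<omega>. H (drawdown T \<omega>)) - H z
    = expectation (J r {0..<T} H1 (\<lambda>x. - r * H x - \<mu> * H1 x + \<sigma>\<^sup>2 / 2 * H2 x))"
proof -
  interpret test_function H H1 H2 C L by (rule tf)
  define \<psi> where "\<psi> x = - \<mu> * H1 x + \<sigma>\<^sup>2 / 2 * H2 x" for x
  define B where "B = (\<bar>\<mu>\<bar> + \<sigma>\<^sup>2 / 2 + 1) * C"
  have \<psi>_le: "\<bar>\<psi> x\<bar> \<le> B" if "0 \<le> x" for x
    unfolding \<psi>_def B_def by (rule generator_le(1)) (use that in auto)
  have C_le: "C \<le> B" unfolding B_def by (rule generator_le(2)[of 0]) auto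
  have H1_le': "\<bar>H1 x\<bar> \<le> B" if "0 \<le> x" for x using H1_le[OF that] C_le by simp
  have cont: "continuous_on UNIV \<psi>"
    unfolding \<psi>_def by (intro continuous_intros continuous)
  have zero: "\<And>x. 0 \<le> x \<Longrightarrow> \<bar>0::real\<bar> \<le> C" using C_nonneg by simp
  define \<delta> where "\<delta> n = T / real (Suc n)" for n
  have \<delta>: "\<And>n. 0 < \<delta> n" "\<delta> \<longlonglongrightarrow> 0"
    using T tendsto_mult[OF tendsto_const LIMSEQ_inverse_real_of_nat, of T]
    by (simp_all add: \<delta>_def[abs_def] divide_inverse)
  have NT: "real (Suc n) * \<delta> n = T" for n by (simp add: \<delta>_def)
  define F where "F n = exp (- r * T) * expectation (\<lambda>\<omega>. H (grid (\<delta> n) (Suc n) \<omega>)) - H z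
       + (exp (r * \<delta> n) - 1) / \<delta> n * expectation (JN r (\<delta> n) (Suc n) (\<lambda>_. 0) H) - expectation (JN r (\<delta> n) (Suc n) H1 \<psi>)" for n
  have F1: "F \<longlonglongrightarrow> exp (- r * T) * expectation (\<lambda>\<omega>. H (drawdown T \<omega>)) - H z
       + r * expectation (J r {0..<T} (\<lambda>_. 0) H) - expectation (J r {0..<T} H1 \<psi>)"
    unfolding F_def[abs_def] \<delta>_def
    by (intro tendsto_intros expectation_grid_end_tendsto[OF r T continuous(1) continuous(1) H_le H_le]
        exp_difference_quotient[OF T]
        expectation_JN_tendsto[OF r T continuous_on_const continuous(1) zero H_le]
        expectation_JN_tendsto[OF r T continuous(2) cont H1_le' \<psi>_le])
  define K where "K = (2 * C + L) * (4 * (speed ^ 3 + 2 * \<sigma> ^ 3)) + C / 2 * (speed\<^sup>2 + 2 * speed * \<sigma>)"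
  define B' where "B' = sqrt (1 + z\<^sup>2) + (2 * speed + (speed + \<sigma>)\<^sup>2) * T"
  \<comment> \<open>The fourth root of the mesh balances the two errors:
    \<open>sqrt (\<delta> n) / a n\<close> equals \<open>a n\<close> again.\<close>
  define a where "a n = sqrt (sqrt (\<delta> n))" for n
  have a: "a \<longlonglongrightarrow> 0"
    using tendsto_real_sqrt[OF tendsto_real_sqrt[OF \<delta>(2)]] by (simp add: a_def[abs_def])
  have F2: "F \<longlonglongrightarrow> 0"
  proof (rule Lim_null_comparison)
    show "(\<lambda>n. 2 * C * a n * B' + K * T * a n) \<longlonglongrightarrow> 0"
      using tendsto_add[OF tendsto_mult[OF tendsto_mult[OF tendsto_const a, of "2 * C"] tendsto_const, of B']
          tendsto_mult[OF tendsto_const a, of "K * T"]] by simp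
    have "\<forall>\<^sub>F n in sequentially. \<delta> n < 1" using \<delta>(2) by (rule order_tendstoD) simp
    then show "\<forall>\<^sub>F n in sequentially. norm (F n) \<le> 2 * C * a n * B' + K * T * a n"
    proof eventually_elim
      case (elim n)
      have a01: "0 < a n" "a n \<le> 1" using \<delta>(1)[of n] elim by (auto simp: a_def)
      have sa: "sqrt (\<delta> n) / a n = a n"
        using \<delta>(1)[of n] by (simp add: a_def real_div_sqrt)
      show ?case
        using discrete_ito_error[OF tf \<delta>(1)[of n] less_imp_le[OF elim] r a01, of "Suc n"]
        unfolding NT F_def \<psi>_def K_def B'_def sa real_norm_def by simp
    qed
  qed
  have "exp (- r * T) * expectation (\<lambda>\<omega>. H (drawdown T \<omega>)) - H z
       = expectation (J r {0..<T} H1 \<psi>) - r * expectation (J r {0..<T} (\<lambda>_. 0) H)"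
    using LIMSEQ_unique[OF F1 F2] by simp
  also have "\<dots> = expectation (\<lambda>\<omega>. J r {0..<T} H1 \<psi> \<omega> - r * J r {0..<T} (\<lambda>_. 0) H \<omega>)"
  proof -
    have "integrable M (J r {0..<T} (\<lambda>_. 0) H)"
      by (rule J_integrable[OF r T continuous_on_const continuous(1) zero H_le])
    moreover have "integrable M (J r {0..<T} H1 \<psi>)"
      by (rule J_integrable[OF r T continuous(2) cont H1_le' \<psi>_le])
    ultimately show ?thesis by simp
  qed
  also have "\<dots> = expectation (J r {0..<T} H1 (\<lambda>x. - r * H x - \<mu> * H1 x + \<sigma>\<^sup>2 / 2 * H2 x))"
  proof (rule integral_cong_AE)
    show m1: "(\<lambda>\<omega>. J r {0..<T} H1 \<psi> \<omega> - r * J r {0..<T} (\<lambda>_. 0) H \<omega>) \<in> borel_measurable M"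
    proof -
      have [measurable]: "J r {0..<T} (\<lambda>_. 0) H \<in> borel_measurable M"
        by (rule J_measurable[OF r T continuous_on_const continuous(1) zero H_le])
      have [measurable]: "J r {0..<T} H1 \<psi> \<in> borel_measurable M"
        by (rule J_measurable[OF r T continuous(2) cont H1_le' \<psi>_le])
      show ?thesis by measurable
    qed
    show e: "AE \<omega> in M. J r {0..<T} H1 \<psi> \<omega> - r * J r {0..<T} (\<lambda>_. 0) H \<omega>
        = J r {0..<T} H1 (\<lambda>x. - r * H x - \<mu> * H1 x + \<sigma>\<^sup>2 / 2 * H2 x) \<omega>"
      using AE_good
    proof eventually_elim
      case (elim \<omega>)
      have i1: "set_integrable lborel {0..<T} (J_fun r H1 \<psi> \<omega>)"
        using cont by (intro J_fun_integrable[OF elim _ _ _ _ _ H1_le' \<psi>_le] exp_set_integrable_bounded)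
           (auto intro: borel_measurable_continuous_onI)
      have i2: "set_integrable lborel {0..<T} (J_fun r (\<lambda>_. 0) H \<omega>)"
        by (intro J_fun_integrable[OF elim _ _ _ _ _ zero H_le] exp_set_integrable_bounded) auto
      have "J r {0..<T} H1 \<psi> \<omega> - r * J r {0..<T} (\<lambda>_. 0) H \<omega>
          = (LBINT t:{0..<T}. J_fun r H1 \<psi> \<omega> t - r * J_fun r (\<lambda>_. 0) H \<omega> t)"
        unfolding J_def using i1 i2 by (subst set_integral_diff(2)) auto
      also have "(\<lambda>t. J_fun r H1 \<psi> \<omega> t - r * J_fun r (\<lambda>_. 0) H \<omega> t)
          = J_fun r H1 (\<lambda>x. - r * H x - \<mu> * H1 x + \<sigma>\<^sup>2 / 2 * H2 x) \<omega>"
        by (simp add: J_fun_def fun_eq_iff \<psi>_def algebra_simps)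
      finally show ?case by (simp add: J_def)
    qed
    show "J r {0..<T} H1 (\<lambda>x. - r * H x - \<mu> * H1 x + \<sigma>\<^sup>2 / 2 * H2 x) \<in> borel_measurable M"
      by (rule measurable_AE_eq[OF m1 e]) simp
  qed
  finally show ?thesis .
qed

end

section \<open>Gluing two smooth functions\<close>

text \<open>The left branch is used at \<open>d\<close> itself. This fits the running cost, which is
  charged only strictly above \<open>d\<close>.\<close>

definition glue :: "real \<Rightarrow> (real \<Rightarrow> real) \<Rightarrow> (real \<Rightarrow> real) \<Rightarrow> real \<Rightarrow> real" where
  "glue d F G x = (if x \<le> d then F x else G x)"

lemma glue_has_derivative:
  assumes F: "\<And>x. (F has_real_derivative F1 x) (at x)" and G: "\<And>x. (G has_real_derivative G1 x) (at x)"
    and eq: "F d = G d" "F1 d = G1 d"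
  shows "(glue d F G has_real_derivative glue d F1 G1 x) (at x)"
proof -
  consider "x < d" | "x = d" | "d < x" by linarith
  then show ?thesis
  proof cases
    case 1
    have "(glue d F G has_real_derivative F1 x) (at x)"
      by (rule has_field_derivative_transform_within_open[OF F, of "{..<d}"]) (use 1 in \<open>auto simp: glue_def\<close>)
    then show ?thesis using 1 by (simp add: glue_def)
  next
    case 3
    have "(glue d F G has_real_derivative G1 x) (at x)"
      by (rule has_field_derivative_transform_within_open[OF G, of "{d<..}"]) (use 3 in \<open>auto simp: glue_def\<close>)
    then show ?thesis using 3 by (simp add: glue_def)
  next
    case 2
    have "((\<lambda>y. (glue d F G y - glue d F G d) / (y - d)) \<longlongrightarrow> F1 d) (at d)"
    proof (rule filterlim_split_at)
      have "((\<lambda>y. (F y - F d) / (y - d)) \<longlongrightarrow> F1 d) (at_left d)"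
        using F[of d] unfolding has_field_derivative_iff by (rule tendsto_mono[rotated]) (simp add: at_within_le_at)
      then show "((\<lambda>y. (glue d F G y - glue d F G d) / (y - d)) \<longlongrightarrow> F1 d) (at_left d)"
        by (rule Lim_transform_eventually) (auto simp: glue_def eventually_at_filter)
      have "((\<lambda>y. (G y - G d) / (y - d)) \<longlongrightarrow> F1 d) (at_right d)"
        using G[of d] unfolding has_field_derivative_iff eq by (rule tendsto_mono[rotated]) (simp add: at_within_le_at)
      then show "((\<lambda>y. (glue d F G y - glue d F G d) / (y - d)) \<longlongrightarrow> F1 d) (at_right d)"
        by (rule Lim_transform_eventually) (auto simp: glue_def eventually_at_filter eq)
    qed
    then show ?thesis using 2 by (simp add: has_field_derivative_iff glue_def)
  qed
qed

lemma glue_lipschitz: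
  assumes F: "\<And>x y. 0 \<le> x \<Longrightarrow> x \<le> d \<Longrightarrow> 0 \<le> y \<Longrightarrow> y \<le> d \<Longrightarrow> \<bar>F x - F y\<bar> \<le> L * \<bar>x - y\<bar>"
    and G: "\<And>x y. d \<le> x \<Longrightarrow> d \<le> y \<Longrightarrow> \<bar>G x - G y\<bar> \<le> L * \<bar>x - y\<bar>"
    and eq: "F d = G d" and d: "0 \<le> d" and xy: "0 \<le> x" "0 \<le> y"
  shows "\<bar>glue d F G x - glue d F G y\<bar> \<le> L * \<bar>x - y\<bar>"
proof -
  have mixed: "\<bar>F x - G y\<bar> \<le> L * \<bar>x - y\<bar>" if "0 \<le> x" "x \<le> d" "d \<le> y" for x y
  proof -
    have "\<bar>F x - G y\<bar> \<le> \<bar>F x - F d\<bar> + \<bar>G d - G y\<bar>" using eq by simp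
    also have "\<dots> \<le> L * \<bar>x - d\<bar> + L * \<bar>d - y\<bar>" using that d by (intro add_mono F G) auto
    also have "\<dots> = L * \<bar>x - y\<bar>" using that by (simp add: algebra_simps)
    finally show ?thesis .
  qed
  show ?thesis
    using F[of x y] G[of x y] mixed[of x y] mixed[of y x] xy
    by (auto simp: glue_def abs_minus_commute)
qed

lemma lipschitz_from_derivative:
  fixes f f' :: "real \<Rightarrow> real"
  assumes "convex S" "\<And>x. (f has_real_derivative f' x) (at x)" "\<And>x. x \<in> S \<Longrightarrow> \<bar>f' x\<bar> \<le> L" "x \<in> S" "y \<in> S"
  shows "\<bar>f x - f y\<bar> \<le> L * \<bar>x - y\<bar>"
  using field_differentiable_bound[OF assms(1), of f f' L x y] assms(2-5)
  by (auto intro: has_field_derivative_at_within)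

lemma test_functionI:
  assumes H: "\<And>x. (H has_real_derivative H1 x) (at x)"
    and H1: "\<And>x. (H1 has_real_derivative H2 x) (at x)"
    and Lip: "\<And>x y. 0 \<le> x \<Longrightarrow> 0 \<le> y \<Longrightarrow> \<bar>H2 x - H2 y\<bar> \<le> L * \<bar>x - y\<bar>" and L: "0 \<le> L"
    and H2: "continuous_on UNIV H2" and 0: "H1 0 = 0"
    and C: "\<And>x. 0 \<le> x \<Longrightarrow> \<bar>H x\<bar> \<le> C" "\<And>x. 0 \<le> x \<Longrightarrow> \<bar>H1 x\<bar> \<le> C" "\<And>x. 0 \<le> x \<Longrightarrow> \<bar>H2 x\<bar> \<le> C"
  shows "test_function H H1 H2 C L"
proof
  show "continuous_on UNIV H" "continuous_on UNIV H1"
    using H H1 by (auto intro!: DERIV_continuous_on)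
  show "\<bar>H y - H x - H1 x * (y - x) - H2 x / 2 * (y - x)\<^sup>2\<bar> \<le> L * \<bar>y - x\<bar> ^ 3" if "0 \<le> x" "0 \<le> y" for x y
    by (rule taylor2_lipschitz[OF H H1 Lip L that])
  show "\<bar>H1 x\<bar> \<le> C * x" if "0 \<le> x" for x
    using lipschitz_from_derivative[of "{0..}" H1 H2 C x 0] H1 C(3) that 0 by auto
qed (use H2 L C in auto)

text \<open>Values and first derivatives match at \<open>d\<close>, second derivatives may jump.
  Third derivatives are present only to make the second ones Lipschitz on either side.\<close>

locale glued_function =
  fixes d :: real and F F1 F2 F3 G G1 G2 G3 :: "real \<Rightarrow> real" and B :: real
  assumes d: "0 < d"
    and F: "\<And>x. (F has_real_derivative F1 x) (at x)" "\<And>x. (F1 has_real_derivative F2 x) (at x)"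
      "\<And>x. (F2 has_real_derivative F3 x) (at x)"
    and G: "\<And>x. (G has_real_derivative G1 x) (at x)" "\<And>x. (G1 has_real_derivative G2 x) (at x)"
      "\<And>x. (G2 has_real_derivative G3 x) (at x)"
    and F_le: "\<And>x. 0 \<le> x \<Longrightarrow> x \<le> d \<Longrightarrow> \<bar>F x\<bar> \<le> B \<and> \<bar>F1 x\<bar> \<le> B \<and> \<bar>F2 x\<bar> \<le> B \<and> \<bar>F3 x\<bar> \<le> B"
    and G_le: "\<And>x. d \<le> x \<Longrightarrow> \<bar>G x\<bar> \<le> B \<and> \<bar>G1 x\<bar> \<le> B \<and> \<bar>G2 x\<bar> \<le> B \<and> \<bar>G3 x\<bar> \<le> B"
    and match: "F d = G d" "F1 d = G1 d" and F1_0: "F1 0 = 0"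
begin

definition "h = glue d F G"
definition "h1 = glue d F1 G1"
definition "h2 = glue d F2 G2"
definition "jump = F2 d - G2 d"

text \<open>
  The correction added to \<open>G\<close> vanishes to first order at \<open>d\<close> and has second derivative \<open>jump\<close> there;
  its second derivative tends to \<open>0\<close> at every other point as \<open>n\<close> grows. Hence the approximations are
  \<open>C\<^sup>2\<close> and their second derivatives converge to that of \<open>h\<close> \<^emph>\<open>everywhere\<close>, with the left derivative
  at \<open>d\<close>; no information on the time that the drawdown spends at \<open>d\<close> is needed.
\<close>

definition "K n x = G x + jump / (real (Suc n))\<^sup>2 * ((1 - exp (- real (Suc n) * (x - d)))\<^sup>2 / 2)"
definition "K1 n x = G1 x + jump / real (Suc n) * ((1 - exp (- real (Suc n) * (x - d))) * exp (- real (Suc n) * (x - d)))"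
definition "K2 n x = G2 x + jump * (2 * (exp (- real (Suc n) * (x - d)))\<^sup>2 - exp (- real (Suc n) * (x - d)))"
definition "K3 n x = G3 x + jump * real (Suc n) * (exp (- real (Suc n) * (x - d)) - 4 * (exp (- real (Suc n) * (x - d)))\<^sup>2)"

lemma K_deriv:
  "(K n has_real_derivative K1 n x) (at x)" "(K1 n has_real_derivative K2 n x) (at x)"
  "(K2 n has_real_derivative K3 n x) (at x)"
proof -
  define N where "N = real (Suc n)"
  have N: "0 < N" by (simp add: N_def)
  show "(K n has_real_derivative K1 n x) (at x)"
    unfolding K_def[abs_def] K1_def N_def[symmetric]
    by (rule derivative_eq_intros G refl | use N in \<open>simp add: field_simps power2_eq_square\<close>)+
  show "(K1 n has_real_derivative K2 n x) (at x)"
    unfolding K1_def[abs_def] K2_def N_def[symmetric]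
    by (rule derivative_eq_intros G refl | use N in \<open>simp add: field_simps power2_eq_square\<close>)+
  show "(K2 n has_real_derivative K3 n x) (at x)"
    unfolding K2_def[abs_def] K3_def N_def[symmetric]
    by (rule derivative_eq_intros G refl | use N in \<open>simp add: field_simps power2_eq_square\<close>)+
qed

lemma K_match: "F d = K n d" "F1 d = K1 n d" "F2 d = K2 n d"
  by (simp_all add: K_def K1_def K2_def match jump_def)

lemma exp_decay:
  assumes "d \<le> x"
  shows "0 \<le> exp (- real (Suc n) * (x - d))" "exp (- real (Suc n) * (x - d)) \<le> 1"
  using assms by (auto simp del: of_nat_Suc)

text \<open>The first three bounds do not depend on \<open>n\<close> and serve as dominating
  constants. Only the third derivative, hence the Lipschitz constant, grows with \<open>n\<close>;
  that is harmless because \<open>ito_formula\<close>, applied for each fixed \<open>n\<close>, no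
  longer contains it.\<close>

lemma K_le:
  assumes x: "d \<le> x"
  shows "\<bar>K n x\<bar> \<le> B + 3 * \<bar>jump\<bar>" "\<bar>K1 n x\<bar> \<le> B + 3 * \<bar>jump\<bar>" "\<bar>K2 n x\<bar> \<le> B + 3 * \<bar>jump\<bar>"
    "\<bar>K3 n x\<bar> \<le> B + \<bar>jump\<bar> * real (Suc n) * 5"
proof -
  define e where "e = exp (- real (Suc n) * (x - d))"
  have e: "0 \<le> e" "e \<le> 1" using exp_decay[OF x] by (auto simp: e_def)
  have e2: "0 \<le> e\<^sup>2" "e\<^sup>2 \<le> 1" using e by (auto simp: power_le_one)
  have N: "1 \<le> real (Suc n)" by simp
  have add_le: "\<bar>p + j * q\<bar> \<le> B + \<bar>j\<bar> * c" if "\<bar>p\<bar> \<le> B" "\<bar>q\<bar> \<le> c" for p q j c :: real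
    using that by (intro order_trans[OF abs_triangle_ineq] add_mono) (auto simp: abs_mult intro: mult_left_mono)
  have j: "\<bar>jump / real (Suc n)\<bar> * 1 \<le> 3 * \<bar>jump\<bar>"
  proof -
    have "\<bar>jump\<bar> / real (Suc n) \<le> \<bar>jump\<bar> / 1" using N by (intro divide_left_mono) auto
    then show ?thesis by (simp del: of_nat_Suc)
  qed
  have j2: "\<bar>jump / (real (Suc n))\<^sup>2\<bar> * 1 \<le> 3 * \<bar>jump\<bar>"
  proof -
    have "\<bar>jump\<bar> / (real (Suc n))\<^sup>2 \<le> \<bar>jump\<bar> / 1" using one_le_power[OF N, of 2] by (intro divide_left_mono) auto
    then show ?thesis by (simp del: of_nat_Suc)
  qed
  have q1: "\<bar>(1 - e)\<^sup>2 / 2\<bar> \<le> 1"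
    using e power_le_one[of "1 - e" 2] by simp
  have q2: "\<bar>(1 - e) * e\<bar> \<le> 1" using e by (simp add: abs_mult mult_le_one)
  have q3: "\<bar>2 * e\<^sup>2 - e\<bar> \<le> 3" using e e2 by linarith
  have q4: "\<bar>e - 4 * e\<^sup>2\<bar> \<le> 5" using e e2 by linarith
  have g: "\<bar>G x\<bar> \<le> B" "\<bar>G1 x\<bar> \<le> B" "\<bar>G2 x\<bar> \<le> B" "\<bar>G3 x\<bar> \<le> B" using G_le[OF x] by auto
  show "\<bar>K n x\<bar> \<le> B + 3 * \<bar>jump\<bar>"
    using add_le[OF g(1) q1, of "jump / (real (Suc n))\<^sup>2"] j2 unfolding K_def e_def by linarith
  show "\<bar>K1 n x\<bar> \<le> B + 3 * \<bar>jump\<bar>"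
    using add_le[OF g(2) q2, of "jump / real (Suc n)"] j unfolding K1_def e_def by linarith
  show "\<bar>K2 n x\<bar> \<le> B + 3 * \<bar>jump\<bar>"
    using add_le[OF g(3) q3, of jump] unfolding K2_def e_def by linarith
  show "\<bar>K3 n x\<bar> \<le> B + \<bar>jump\<bar> * real (Suc n) * 5"
    using add_le[OF g(4) q4, of "jump * real (Suc n)"] unfolding K3_def e_def by (simp add: abs_mult)
qed

lemma B_nonneg: "0 \<le> B" using F_le[of 0] d by auto

lemma approx_test_function:
  "test_function (glue d F (K n)) (glue d F1 (K1 n)) (glue d F2 (K2 n))
     (B + 3 * \<bar>jump\<bar>) (B + \<bar>jump\<bar> * real (Suc n) * 5)"
proof (rule test_functionI)
  show "(glue d F (K n) has_real_derivative glue d F1 (K1 n) x) (at x)" for x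
    by (rule glue_has_derivative[OF F(1) K_deriv(1) K_match(1,2)])
  show "(glue d F1 (K1 n) has_real_derivative glue d F2 (K2 n) x) (at x)" for x
    by (rule glue_has_derivative[OF F(2) K_deriv(2) K_match(2,3)])
  show "0 \<le> B + \<bar>jump\<bar> * real (Suc n) * 5" using B_nonneg by simp
  show "\<bar>glue d F2 (K2 n) x - glue d F2 (K2 n) y\<bar> \<le> (B + \<bar>jump\<bar> * real (Suc n) * 5) * \<bar>x - y\<bar>"
    if "0 \<le> x" "0 \<le> y" for x y
  proof (rule glue_lipschitz[where F = F2 and G = "K2 n", OF _ _ K_match(3) less_imp_le[OF d] that])
    show "\<bar>F2 x - F2 y\<bar> \<le> (B + \<bar>jump\<bar> * real (Suc n) * 5) * \<bar>x - y\<bar>"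
      if "0 \<le> x" "x \<le> d" "0 \<le> y" "y \<le> d" for x y
    proof (rule lipschitz_from_derivative[of "{0..d}" F2 F3])
      show "\<bar>F3 t\<bar> \<le> B + \<bar>jump\<bar> * real (Suc n) * 5" if "t \<in> {0..d}" for t
        using F_le[of t] that by (auto intro: add_increasing2)
    qed (use F(3) that in auto)
    show "\<bar>K2 n x - K2 n y\<bar> \<le> (B + \<bar>jump\<bar> * real (Suc n) * 5) * \<bar>x - y\<bar>"
      if "d \<le> x" "d \<le> y" for x y
      by (rule lipschitz_from_derivative[of "{d..}" "K2 n" "K3 n"]) (use K_deriv(3) K_le(4) that in auto)
  qed
  have "continuous_on UNIV F2" "continuous_on UNIV (K2 n)"
    using F(3) K_deriv(3) by (auto intro!: DERIV_continuous_on)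
  \<comment> \<open>Clamping the argument at \<open>d\<close> displays the glued function as a sum
    of continuous functions.\<close>
  moreover have "glue d F2 (K2 n) = (\<lambda>x. F2 (min x d) + K2 n (max x d) - F2 d)"
    using K_match(3)[of n] by (auto simp: glue_def fun_eq_iff min_def max_def)
  ultimately show "continuous_on UNIV (glue d F2 (K2 n))"
    by (auto intro!: continuous_intros elim!: continuous_on_compose2)
  show "glue d F1 (K1 n) 0 = 0" using d F1_0 by (simp add: glue_def)
  fix x :: real assume "0 \<le> x"
  then show "\<bar>glue d F (K n) x\<bar> \<le> B + 3 * \<bar>jump\<bar>" "\<bar>glue d F1 (K1 n) x\<bar> \<le> B + 3 * \<bar>jump\<bar>"
      "\<bar>glue d F2 (K2 n) x\<bar> \<le> B + 3 * \<bar>jump\<bar>"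
    using F_le[of x] K_le[of x n] by (auto simp: glue_def)
qed

lemma approx_tendsto:
  "(\<lambda>n. glue d F (K n) x) \<longlonglongrightarrow> h x" "(\<lambda>n. glue d F1 (K1 n) x) \<longlonglongrightarrow> h1 x"
  "(\<lambda>n. glue d F2 (K2 n) x) \<longlonglongrightarrow> h2 x"
proof -
  \<comment> \<open>For \<open>x \<le> d\<close>, in particular at \<open>d\<close>, the
    approximations agree with the left branch for every \<open>n\<close>, so only points beyond
    \<open>d\<close> require a limit.\<close>
  have "(\<lambda>n. K n x) \<longlonglongrightarrow> G x \<and> (\<lambda>n. K1 n x) \<longlonglongrightarrow> G1 x \<and> (\<lambda>n. K2 n x) \<longlonglongrightarrow> G2 x" if x: "d < x"
  proof -
    have e: "(\<lambda>n. exp (- real (Suc n) * (x - d))) \<longlonglongrightarrow> 0"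
    proof -
      have "(\<lambda>n. exp (- (x - d)) ^ Suc n) \<longlonglongrightarrow> 0"
        using x by (intro LIMSEQ_Suc LIMSEQ_power_zero) auto
      moreover have "exp (- (x - d)) ^ Suc n = exp (- real (Suc n) * (x - d))" for n
        unfolding exp_of_nat_mult[symmetric] by (simp add: algebra_simps)
      ultimately show ?thesis by (simp only:)
    qed
    have i: "(\<lambda>n. jump / real (Suc n)) \<longlonglongrightarrow> 0"
      using tendsto_mult[OF tendsto_const LIMSEQ_inverse_real_of_nat, of jump] by (simp add: divide_inverse)
    have i2: "(\<lambda>n. jump / (real (Suc n))\<^sup>2) \<longlonglongrightarrow> 0"
      using tendsto_mult[OF i LIMSEQ_inverse_real_of_nat] by (simp add: divide_inverse power2_eq_square mult.assoc)
    have "(\<lambda>n. K n x) \<longlonglongrightarrow> G x + 0 * ((1 - 0)\<^sup>2 / 2)"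
      unfolding K_def by (intro tendsto_intros e i2)
        simp
    moreover have "(\<lambda>n. K1 n x) \<longlonglongrightarrow> G1 x + 0 * ((1 - 0) * 0)"
      unfolding K1_def by (intro tendsto_intros e i)
    moreover have "(\<lambda>n. K2 n x) \<longlonglongrightarrow> G2 x + jump * (2 * 0\<^sup>2 - 0)"
      unfolding K2_def by (intro tendsto_intros e)
    ultimately show ?thesis by simp
  qed
  then show "(\<lambda>n. glue d F (K n) x) \<longlonglongrightarrow> h x" "(\<lambda>n. glue d F1 (K1 n) x) \<longlonglongrightarrow> h1 x"
    "(\<lambda>n. glue d F2 (K2 n) x) \<longlonglongrightarrow> h2 x"
    by (auto simp: glue_def h_def h1_def h2_def)
qed

lemma h_le: "0 \<le> x \<Longrightarrow> \<bar>h x\<bar> \<le> B \<and> \<bar>h1 x\<bar> \<le> B \<and> \<bar>h2 x\<bar> \<le> B"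
  using F_le[of x] G_le[of x] by (auto simp: h_def h1_def h2_def glue_def)

lemma h1_continuous: "continuous_on UNIV h1"
proof -
  have "continuous_on UNIV F1" "continuous_on UNIV G1"
    using F(2) G(2) by (auto intro!: DERIV_continuous_on)
  moreover have "h1 = (\<lambda>x. F1 (min x d) + G1 (max x d) - F1 d)"
    using match(2) by (auto simp: h1_def glue_def fun_eq_iff min_def max_def)
  ultimately show ?thesis
    by (auto intro!: continuous_intros elim!: continuous_on_compose2)
qed

lemma h_continuous: "continuous_on UNIV h"
  unfolding h_def using glue_has_derivative[OF F(1) G(1) match] by (auto intro!: DERIV_continuous_on)

lemma h2_borel: "h2 \<in> borel_measurable borel"
proof -
  have "continuous_on UNIV F2" "continuous_on UNIV G2"
    using F(3) G(3) by (auto intro!: DERIV_continuous_on)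
  then have [measurable]: "F2 \<in> borel_measurable borel" "G2 \<in> borel_measurable borel"
    by (auto intro: borel_measurable_continuous_onI)
  show ?thesis unfolding h2_def glue_def[abs_def] by measurable
qed

end

section \<open>The value of an admissible control\<close>

lemma exp_set_integrable_atLeast:
  assumes "0 < (r::real)"
  shows "set_integrable lborel {0..} (\<lambda>t. exp (- r * t))"
proof -
  have "set_integrable lborel {0<..} (\<lambda>t. exp (- r * t))"
    using integrable_I0i_exp_mscale[OF assms] by (simp add: mult.commute)
  then show ?thesis
    by (subst set_integrable_discrete_difference[where X = "{0}" and B = "{0<..}"]) auto
qed

context controlled_drawdown
begin

text \<open>Dominated convergence in \<open>ito_formula\<close> along the smooth approximations. The
  limiting integrand may jump at \<open>d\<close>, so its integral obtains measurability as an
  almost sure limit as well.\<close>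

theorem ito_formula_glued:
  assumes gf: "glued_function d F F1 F2 F3 G G1 G2 G3 B" and r: "0 \<le> r" and T: "0 < T"
  defines "\<psi> \<equiv> \<lambda>x. - r * glue d F G x - \<mu> * glue d F1 G1 x + \<sigma>\<^sup>2 / 2 * glue d F2 G2 x"
  shows "J r {0..<T} (glue d F1 G1) \<psi> \<in> borel_measurable M"
    and "exp (- r * T) * expectation (\<lambda>\<omega>. glue d F G (drawdown T \<omega>)) - glue d F G z
      = expectation (J r {0..<T} (glue d F1 G1) \<psi>)"
proof -
  interpret glued_function d F F1 F2 F3 G G1 G2 G3 B by (rule gf)
  define a where "a n = glue d F (K n)" for n
  define a1 where "a1 n = glue d F1 (K1 n)" for n
  define a2 where "a2 n = glue d F2 (K2 n)" for n
  define C where "C = B + 3 * \<bar>jump\<bar>"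
  define \<psi>n where "\<psi>n n x = - r * a n x - \<mu> * a1 n x + \<sigma>\<^sup>2 / 2 * a2 n x" for n x
  have tf: "test_function (a n) (a1 n) (a2 n) C (B + \<bar>jump\<bar> * real (Suc n) * 5)" for n
    unfolding a_def a1_def a2_def C_def by (rule approx_test_function)
  have cont: "continuous_on UNIV (a n)" "continuous_on UNIV (a1 n)" "continuous_on UNIV (a2 n)" for n
    using test_function.continuous[OF tf] by auto
  have cont\<psi>: "continuous_on UNIV (\<psi>n n)" for n
    unfolding \<psi>n_def by (intro continuous_intros cont)
  have C: "0 \<le> C" by (rule test_function.C_nonneg[OF tf])
  define B' where "B' = (r + \<bar>\<mu>\<bar> + \<sigma>\<^sup>2 / 2 + 1) * C"
  have CB: "C \<le> B'" using C r by (simp add: B'_def distrib_right)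
  have a_le: "\<bar>a n x\<bar> \<le> C" "\<bar>a1 n x\<bar> \<le> C" "\<bar>a2 n x\<bar> \<le> C" if "0 \<le> x" for n x
    using test_function.H_le[OF tf that] test_function.H1_le[OF tf that] test_function.H2_le[OF tf that] by auto
  have a1_le: "\<bar>a1 n x\<bar> \<le> B'" if "0 \<le> x" for n x using a_le(2)[OF that] CB by (rule order_trans)
  have \<psi>n_le: "\<bar>\<psi>n n x\<bar> \<le> B'" if x: "0 \<le> x" for n x
  proof -
    have tri: "\<bar>- p - q + s\<bar> \<le> \<bar>p\<bar> + \<bar>q\<bar> + \<bar>s\<bar>" for p q s :: real by linarith
    have "\<bar>\<psi>n n x\<bar> \<le> \<bar>r * a n x\<bar> + \<bar>\<mu> * a1 n x\<bar> + \<bar>\<sigma>\<^sup>2 / 2 * a2 n x\<bar>"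
      unfolding \<psi>n_def using tri[of "r * a n x" "\<mu> * a1 n x" "\<sigma>\<^sup>2 / 2 * a2 n x"] by simp
    also have "\<dots> \<le> r * C + \<bar>\<mu>\<bar> * C + \<sigma>\<^sup>2 / 2 * C"
      unfolding abs_mult using a_le[OF x, of n] r by (intro add_mono mult_mono) auto
    finally show ?thesis using C by (simp add: B'_def distrib_right)
  qed
  have lim\<psi>: "(\<lambda>n. \<psi>n n x) \<longlonglongrightarrow> \<psi> x" for x
    unfolding \<psi>n_def \<psi>_def a_def a1_def a2_def
    by (intro tendsto_intros approx_tendsto[unfolded h_def h1_def h2_def])
  have m [measurable]: "glue d F G \<in> borel_measurable borel" "glue d F1 G1 \<in> borel_measurable borel"
      "glue d F2 G2 \<in> borel_measurable borel"
    using h_continuous h1_continuous h2_borel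
    by (auto simp: h_def h1_def h2_def intro: borel_measurable_continuous_onI)
  have m\<psi>: "\<psi> \<in> borel_measurable borel" unfolding \<psi>_def by measurable
  have mn: "a1 n \<in> borel_measurable borel" "\<psi>n n \<in> borel_measurable borel" for n
    using cont cont\<psi> by (auto intro: borel_measurable_continuous_onI)
  have J_lim: "AE \<omega> in M. (\<lambda>n. J r {0..<T} (a1 n) (\<psi>n n) \<omega>) \<longlonglongrightarrow> J r {0..<T} (glue d F1 G1) \<psi> \<omega>"
    using AE_good
  proof eventually_elim
    case (elim \<omega>)
    have sub: "{0..<T} \<subseteq> {0..}" by auto
    show ?case
      by (rule J_LIMSEQ[OF elim mn m(2) m\<psi> _ sub exp_set_integrable_bounded a1_le \<psi>n_le _ lim\<psi>])
         (use approx_tendsto(2) in \<open>simp_all add: a1_def h1_def\<close>)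
  qed
  have Jn: "J r {0..<T} (a1 n) (\<psi>n n) \<in> borel_measurable M" for n
    by (rule J_measurable[OF r T cont(2) cont\<psi> a1_le \<psi>n_le])
  show meas: "J r {0..<T} (glue d F1 G1) \<psi> \<in> borel_measurable M"
    by (rule borel_measurable_AE_LIMSEQ[OF Jn J_lim])
  have R: "(\<lambda>n. expectation (J r {0..<T} (a1 n) (\<psi>n n))) \<longlonglongrightarrow> expectation (J r {0..<T} (glue d F1 G1) \<psi>)"
  proof (rule integral_dominated_convergence[OF meas Jn _ J_lim])
    show "AE \<omega> in M. norm (J r {0..<T} (a1 n) (\<psi>n n) \<omega>) \<le> B' * (u0 + 1) * T" for n
      using AE_good by eventually_elim (simp add: J_bound[OF r T cont(2) cont\<psi> a1_le \<psi>n_le])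
    show "integrable M (\<lambda>\<omega>. B' * (u0 + 1) * T)" by simp
  qed
  have hc: "continuous_on UNIV (glue d F G)" using h_continuous by (simp add: h_def)
  have h_le': "\<And>x. 0 \<le> x \<Longrightarrow> \<bar>glue d F G x\<bar> \<le> B" using h_le by (simp add: h_def)
  have E: "(\<lambda>n. expectation (\<lambda>\<omega>. a n (drawdown T \<omega>))) \<longlonglongrightarrow> expectation (\<lambda>\<omega>. glue d F G (drawdown T \<omega>))"
  proof (rule integral_dominated_convergence)
    show "(\<lambda>\<omega>. glue d F G (drawdown T \<omega>)) \<in> borel_measurable M"
      by (rule drawdown_measurable[OF r T hc hc h_le' h_le'])
    show "(\<lambda>\<omega>. a n (drawdown T \<omega>)) \<in> borel_measurable M" for n
      by (rule drawdown_measurable[OF r T cont(1) cont(1) a_le(1) a_le(1)])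
    show "AE \<omega> in M. norm (a n (drawdown T \<omega>)) \<le> C" for n
      using AE_good by eventually_elim (use T in \<open>simp add: a_le(1) drawdown_nonneg\<close>)
    show "AE \<omega> in M. (\<lambda>n. a n (drawdown T \<omega>)) \<longlonglongrightarrow> glue d F G (drawdown T \<omega>)"
      using approx_tendsto(1) by (simp add: a_def h_def)
    show "integrable M (\<lambda>\<omega>. C)" by simp
  qed
  have "exp (- r * T) * expectation (\<lambda>\<omega>. a n (drawdown T \<omega>)) - a n z = expectation (J r {0..<T} (a1 n) (\<psi>n n))" for n
    unfolding \<psi>n_def by (rule ito_formula[OF tf r T])
  then have L: "(\<lambda>n. exp (- r * T) * expectation (\<lambda>\<omega>. a n (drawdown T \<omega>)) - a n z) \<longlonglongrightarrow> expectation (J r {0..<T} (glue d F1 G1) \<psi>)"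
    using R by simp
  have "(\<lambda>n. exp (- r * T) * expectation (\<lambda>\<omega>. a n (drawdown T \<omega>)) - a n z)
     \<longlonglongrightarrow> exp (- r * T) * expectation (\<lambda>\<omega>. glue d F G (drawdown T \<omega>)) - glue d F G z"
    using approx_tendsto(1) by (intro tendsto_intros E) (simp add: a_def h_def)
  then show "exp (- r * T) * expectation (\<lambda>\<omega>. glue d F G (drawdown T \<omega>)) - glue d F G z
      = expectation (J r {0..<T} (glue d F1 G1) \<psi>)"
    using L by (rule LIMSEQ_unique)
qed

section \<open>Passage to the infinite horizon\<close>

context
  fixes r B :: real and \<phi> \<psi> :: "real \<Rightarrow> real"
  assumes r: "0 < r" and m: "\<phi> \<in> borel_measurable borel" "\<psi> \<in> borel_measurable borel"
    and \<phi>: "\<And>x. 0 \<le> x \<Longrightarrow> \<bar>\<phi> x\<bar> \<le> B" and \<psi>: "\<And>x. 0 \<le> x \<Longrightarrow> \<bar>\<psi> x\<bar> \<le> B"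
begin

lemma J_fun_integrable_atLeast: "good \<omega> \<Longrightarrow> set_integrable lborel {0..} (J_fun r \<phi> \<psi> \<omega>)"
  by (rule J_fun_integrable[OF _ m _ _ exp_set_integrable_atLeast[OF r] \<phi> \<psi>]) auto

lemma J_uniform_bound:
  assumes g: "good \<omega>" and A: "A \<in> sets borel" "A \<subseteq> {0..}"
  shows "\<bar>J r A \<phi> \<psi> \<omega>\<bar> \<le> (LBINT t:{0..}. exp (- r * t) * (B * (u0 + 1)))"
proof -
  have B: "0 \<le> B" using \<phi>[of 0] by auto
  have i: "set_integrable lborel A (J_fun r \<phi> \<psi> \<omega>)"
    by (rule set_integrable_subset[OF J_fun_integrable_atLeast[OF g]]) (use A in auto)
  have e: "set_integrable lborel {0..} (\<lambda>t. exp (- r * t) * (B * (u0 + 1)))"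
    using exp_set_integrable_atLeast[OF r] by simp
  have "\<bar>J r A \<phi> \<psi> \<omega>\<bar> \<le> (\<integral>t. \<bar>indicator A t *\<^sub>R J_fun r \<phi> \<psi> \<omega> t\<bar> \<partial>lborel)"
    unfolding J_def set_lebesgue_integral_def by (rule integral_abs_bound)
  also have "\<dots> \<le> (LBINT t:{0..}. exp (- r * t) * (B * (u0 + 1)))"
    unfolding set_lebesgue_integral_def
  proof (rule integral_mono)
    show "integrable lborel (\<lambda>t. \<bar>indicator A t *\<^sub>R J_fun r \<phi> \<psi> \<omega> t\<bar>)"
      using i by (intro integrable_abs) (simp only: set_integrable_def)
    show "integrable lborel (\<lambda>t. indicator {0..} t *\<^sub>R (exp (- r * t) * (B * (u0 + 1))))"
      using e by (simp only: set_integrable_def)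
    show "\<bar>indicator A t *\<^sub>R J_fun r \<phi> \<psi> \<omega> t\<bar> \<le> indicator {0..} t *\<^sub>R (exp (- r * t) * (B * (u0 + 1)))" for t
    proof (cases "t \<in> A")
      case True
      then have "0 \<le> t" using A by auto
      with J_fun_le[where r = r, OF g this \<phi> \<psi>] True show ?thesis by simp
    next
      case False
      then show ?thesis using B u0 by simp
    qed
  qed
  finally show ?thesis .
qed

lemma J_horizon_tendsto:
  assumes g: "good \<omega>"
  shows "(\<lambda>n. J r {0..<real (Suc n)} \<phi> \<psi> \<omega>) \<longlonglongrightarrow> J r {0..} \<phi> \<psi> \<omega>"
proof -
  have un: "(\<Union>n. {0..<real (Suc n)}) = {0..}"
  proof (intro equalityI subsetI)
    fix x :: real assume "x \<in> {0..}"
    moreover obtain n where "x < real n" using reals_Archimedean2 by auto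
    ultimately show "x \<in> (\<Union>n. {0..<real (Suc n)})" by (auto intro!: exI[of _ n])
  qed auto
  have "(\<lambda>n. LBINT t:{0..<real (Suc n)}. J_fun r \<phi> \<psi> \<omega> t) \<longlonglongrightarrow> (LBINT t:(\<Union>n. {0..<real (Suc n)}). J_fun r \<phi> \<psi> \<omega> t)"
    using J_fun_integrable_atLeast[OF g] unfolding un[symmetric]
    by (intro set_integral_cont_up) (auto simp: incseq_def)
  then show ?thesis unfolding J_def un .
qed

text \<open>Measurability at finite horizons is a hypothesis because \<open>J_measurable\<close>
  covers continuous integrands only; the integrand of the glued function has it from
  \<open>ito_formula_glued\<close>.\<close>

lemma J_atLeast_measurable:
  assumes "\<And>T. 0 < T \<Longrightarrow> J r {0..<T} \<phi> \<psi> \<in> borel_measurable M"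
  shows "J r {0..} \<phi> \<psi> \<in> borel_measurable M"
    and "integrable M (J r {0..} \<phi> \<psi>)"
    and "(\<lambda>n. expectation (J r {0..<real (Suc n)} \<phi> \<psi>)) \<longlonglongrightarrow> expectation (J r {0..} \<phi> \<psi>)"
proof -
  have mn: "J r {0..<real (Suc n)} \<phi> \<psi> \<in> borel_measurable M" for n by (rule assms) simp
  have lim: "AE \<omega> in M. (\<lambda>n. J r {0..<real (Suc n)} \<phi> \<psi> \<omega>) \<longlonglongrightarrow> J r {0..} \<phi> \<psi> \<omega>"
    using AE_good by eventually_elim (rule J_horizon_tendsto)
  show meas: "J r {0..} \<phi> \<psi> \<in> borel_measurable M"
    by (rule borel_measurable_AE_LIMSEQ[OF mn lim])
  let ?C = "LBINT t:{0..}. exp (- r * t) * (B * (u0 + 1))"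
  have b: "AE \<omega> in M. norm (J r A \<phi> \<psi> \<omega>) \<le> ?C" if "A \<in> sets borel" "A \<subseteq> {0..}" for A
    using AE_good by eventually_elim (use J_uniform_bound[OF _ that] in simp)
  show "integrable M (J r {0..} \<phi> \<psi>)"
    by (rule integrable_const_bound[OF b meas]) auto
  show "(\<lambda>n. expectation (J r {0..<real (Suc n)} \<phi> \<psi>)) \<longlonglongrightarrow> expectation (J r {0..} \<phi> \<psi>)"
    by (rule integral_dominated_convergence[OF meas mn _ lim b]) auto
qed

end

text \<open>On good paths both integrands are integrable, so the two reward integrals combine into
  one. The assumed measurability is obtained in \<open>value_identity\<close>.\<close>

lemma vU_eq_J:
  assumes "J r {0..} (\<lambda>_. \<beta>) (\<lambda>x. - indicator {d<..} x) \<in> borel_measurable M" and r: "0 < r"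
  shows "vU M W \<mu> \<sigma> r \<beta> d U z = expectation (J r {0..} (\<lambda>_. \<beta>) (\<lambda>x. - indicator {d<..} x))"
proof -
  let ?v = "\<lambda>\<omega>. \<beta> * (LBINT t:{0..}. exp (- r * t) * U t \<omega>)
          - (LBINT t:{0..}. exp (- r * t) * indicator {s. drawdown s \<omega> > d} t)"
  have eq: "AE \<omega> in M. J r {0..} (\<lambda>_. \<beta>) (\<lambda>x. - indicator {d<..} x) \<omega> = ?v \<omega>"
    using AE_good
  proof eventually_elim
    case (elim \<omega>)
    have 1: "set_integrable lborel {0..} (J_fun r (\<lambda>_. 1) (\<lambda>_. 0) \<omega>)"
      by (rule J_fun_integrable_atLeast[where B = 1, OF r _ _ _ _ elim]) auto
    have 2: "set_integrable lborel {0..} (J_fun r (\<lambda>_. 0) (indicator {d<..}) \<omega>)"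
      by (rule J_fun_integrable_atLeast[where B = 1, OF r _ _ _ _ elim]) (auto simp: indicator_def)
    have "?v \<omega> = \<beta> * (LBINT t:{0..}. J_fun r (\<lambda>_. 1) (\<lambda>_. 0) \<omega> t) - (LBINT t:{0..}. J_fun r (\<lambda>_. 0) (indicator {d<..}) \<omega> t)"
      by (simp add: J_fun_def indicator_def)
    also have "\<dots> = (LBINT t:{0..}. \<beta> * J_fun r (\<lambda>_. 1) (\<lambda>_. 0) \<omega> t - J_fun r (\<lambda>_. 0) (indicator {d<..}) \<omega> t)"
      using 1 2 by (subst set_integral_diff(2)) auto
    also have "(\<lambda>t. \<beta> * J_fun r (\<lambda>_. 1) (\<lambda>_. 0) \<omega> t - J_fun r (\<lambda>_. 0) (indicator {d<..}) \<omega> t)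
        = J_fun r (\<lambda>_. \<beta>) (\<lambda>x. - indicator {d<..} x) \<omega>"
      by (simp add: J_fun_def fun_eq_iff algebra_simps)
    finally show ?case by (simp add: J_def)
  qed
  have "?v \<in> borel_measurable M" by (rule measurable_AE_eq[OF assms(1) eq]) simp
  then show ?thesis
    unfolding vU_def drawdown_def[symmetric] using assms(1) eq by (intro integral_cong_AE) auto
qed

text \<open>The equation for the constant control turns the integrand of Ito's formula into
  \<open>- u0 * \<phi> x\<close> plus the indicator of \<open>{d<..}\<close>. Subtracting it from
  the integrand with \<open>\<phi>\<close> and \<open>- u0 * \<phi>\<close> leaves exactly the
  reward, as \<open>\<phi>\<close> exceeds the slope by \<open>\<beta>\<close>, while Ito's formula
  on the whole half-line has mean minus the candidate at \<open>z\<close>.\<close>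

theorem value_identity:
  assumes gf: "glued_function d F F1 F2 F3 G G1 G2 G3 B" and r: "0 < r"
    and ode: "\<And>x. 0 \<le> x \<Longrightarrow> - r * glue d F G x - (\<mu> - u0) * glue d F1 G1 x + \<sigma>\<^sup>2 / 2 * glue d F2 G2 x
      = - \<beta> * u0 + indicator {d<..} x"
  defines "\<phi> \<equiv> \<lambda>x. glue d F1 G1 x + \<beta>"
  shows "vU M W \<mu> \<sigma> r \<beta> d U z = glue d F G z + expectation (J r {0..} \<phi> (\<lambda>x. - u0 * \<phi> x))"
    and "integrable M (J r {0..} \<phi> (\<lambda>x. - u0 * \<phi> x))"
proof -
  interpret glued_function d F F1 F2 F3 G G1 G2 G3 B by (rule gf)
  let ?h = "glue d F G" and ?h1 = "glue d F1 G1" and ?h2 = "glue d F2 G2"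
  define \<psi> where "\<psi> = (\<lambda>x. - r * ?h x - \<mu> * ?h1 x + \<sigma>\<^sup>2 / 2 * ?h2 x)"
  have hb: "\<bar>?h x\<bar> \<le> B" "\<bar>?h1 x\<bar> \<le> B" "\<bar>?h2 x\<bar> \<le> B" if "0 \<le> x" for x
    using h_le[OF that] by (auto simp: h_def h1_def h2_def)
  have m [measurable]: "?h \<in> borel_measurable borel" "?h1 \<in> borel_measurable borel" "?h2 \<in> borel_measurable borel"
    using h_continuous h1_continuous h2_borel
    by (auto simp: h_def h1_def h2_def intro: borel_measurable_continuous_onI)
  have m\<psi> [measurable]: "\<psi> \<in> borel_measurable borel" and m\<phi> [measurable]: "\<phi> \<in> borel_measurable borel"
    unfolding \<psi>_def \<phi>_def by measurable
  have c\<phi>: "continuous_on UNIV \<phi>"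
    unfolding \<phi>_def using h1_continuous by (intro continuous_intros) (simp add: h1_def)
  \<comment> \<open>One constant for all four coefficient functions; the summand 1 pays for the
    indicator.\<close>
  define C where "C = (u0 + 1) * (B + \<bar>\<beta>\<bar>) + 1"
  have BC: "B \<le> C" "B + \<bar>\<beta>\<bar> \<le> C" "u0 * (B + \<bar>\<beta>\<bar>) \<le> C"
    using B_nonneg u0 by (auto simp: C_def algebra_simps add_increasing2)
  have \<psi>_eq: "\<psi> x = - u0 * \<phi> x + indicator {d<..} x" if "0 \<le> x" for x
    using ode[OF that] by (simp add: \<psi>_def \<phi>_def algebra_simps)
  have \<phi>_le0: "\<bar>\<phi> x\<bar> \<le> B + \<bar>\<beta>\<bar>" if "0 \<le> x" for x
    unfolding \<phi>_def using hb(2)[OF that] by (intro order_trans[OF abs_triangle_ineq]) auto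
  have \<phi>_le: "\<bar>\<phi> x\<bar> \<le> C" "\<bar>- u0 * \<phi> x\<bar> \<le> C" if "0 \<le> x" for x
  proof -
    show "\<bar>\<phi> x\<bar> \<le> C" using \<phi>_le0[OF that] BC by simp
    have "\<bar>- u0 * \<phi> x\<bar> \<le> u0 * (B + \<bar>\<beta>\<bar>)"
      using \<phi>_le0[OF that] u0 by (simp add: abs_mult)
    then show "\<bar>- u0 * \<phi> x\<bar> \<le> C" using BC by simp
  qed
  have \<psi>_le: "\<bar>\<psi> x\<bar> \<le> C" if "0 \<le> x" for x
  proof -
    have "\<bar>\<psi> x\<bar> \<le> \<bar>u0 * \<phi> x\<bar> + 1"
      unfolding \<psi>_eq[OF that] by (rule order_trans[OF abs_triangle_ineq]) (simp add: indicator_def)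
    also have "\<bar>u0 * \<phi> x\<bar> \<le> u0 * (B + \<bar>\<beta>\<bar>)" using \<phi>_le0[OF that] u0 by (simp add: abs_mult)
    finally show ?thesis using B_nonneg by (simp add: C_def algebra_simps)
  qed
  have h1_le: "\<bar>?h1 x\<bar> \<le> C" if "0 \<le> x" for x using hb(2)[OF that] BC by simp
  note r' = less_imp_le[OF r]
  note ito = ito_formula_glued[OF gf r', folded \<psi>_def]
  note JA = J_atLeast_measurable[OF r m(2) m\<psi> h1_le \<psi>_le ito(1)]
  have m\<phi>': "(\<lambda>x. - u0 * \<phi> x) \<in> borel_measurable borel" by measurable
  have c\<phi>': "continuous_on UNIV (\<lambda>x. - u0 * \<phi> x)" by (intro continuous_intros c\<phi>)
  note JB = J_atLeast_measurable[OF r m\<phi> m\<phi>' \<phi>_le J_measurable[OF r' _ c\<phi> c\<phi>' \<phi>_le]]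
  show int: "integrable M (J r {0..} \<phi> (\<lambda>x. - u0 * \<phi> x))" by (rule JB(2))
  \<comment> \<open>The candidate is bounded, so discounting removes the term at the
    horizon.\<close>
  have "(\<lambda>n. expectation (J r {0..<real (Suc n)} ?h1 \<psi>)) \<longlonglongrightarrow> - ?h z"
  proof -
    have "(\<lambda>n. exp (- r * real (Suc n)) * expectation (\<lambda>\<omega>. ?h (drawdown (real (Suc n)) \<omega>))) \<longlonglongrightarrow> 0"
    proof (rule Lim_null_comparison)
      show "\<forall>\<^sub>F n in sequentially. norm (exp (- r * real (Suc n)) * expectation (\<lambda>\<omega>. ?h (drawdown (real (Suc n)) \<omega>)))
         \<le> exp (- r) ^ Suc n * B"
      proof (intro always_eventually allI)
        fix n
        have "\<bar>expectation (\<lambda>\<omega>. ?h (drawdown (real (Suc n)) \<omega>))\<bar> \<le> expectation (\<lambda>\<omega>. \<bar>?h (drawdown (real (Suc n)) \<omega>)\<bar>)"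
          by (rule integral_abs_bound)
        also have "\<dots> \<le> B"
        proof (rule integral_real_bounded[OF B_nonneg])
          show "(\<integral>\<^sup>+ \<omega>. ennreal \<bar>?h (drawdown (real (Suc n)) \<omega>)\<bar> \<partial>M) \<le> ennreal B"
          proof -
            have "AE \<omega> in M. ennreal \<bar>?h (drawdown (real (Suc n)) \<omega>)\<bar> \<le> ennreal B"
              using AE_good by eventually_elim (auto intro!: ennreal_leI hb drawdown_nonneg)
            then have "(\<integral>\<^sup>+ \<omega>. ennreal \<bar>?h (drawdown (real (Suc n)) \<omega>)\<bar> \<partial>M) \<le> (\<integral>\<^sup>+ \<omega>. ennreal B \<partial>M)"
              by (rule nn_integral_mono_AE)
            then show ?thesis by (simp add: emeasure_space_1)
          qed
        qed
        finally have "\<bar>expectation (\<lambda>\<omega>. ?h (drawdown (real (Suc n)) \<omega>))\<bar> \<le> B" .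
        moreover have "exp (- r * real (Suc n)) = exp (- r) ^ Suc n"
          by (simp only: exp_of_nat_mult[symmetric] mult.commute)
        ultimately show "norm (exp (- r * real (Suc n)) * expectation (\<lambda>\<omega>. ?h (drawdown (real (Suc n)) \<omega>)))
           \<le> exp (- r) ^ Suc n * B"
          by (simp add: abs_mult mult_left_mono del: power_Suc of_nat_Suc)
      qed
      have "(\<lambda>n. exp (- r) ^ Suc n) \<longlonglongrightarrow> 0" using r by (intro LIMSEQ_Suc LIMSEQ_power_zero) auto
      then show "(\<lambda>n. exp (- r) ^ Suc n * B) \<longlonglongrightarrow> 0" by (rule tendsto_mult_left_zero)
    qed
    from tendsto_diff[OF this tendsto_const, of "?h z"] show ?thesis
      using ito(2) by (simp del: of_nat_Suc)
  qed
  from LIMSEQ_unique[OF JA(3) this] have EA: "expectation (J r {0..} ?h1 \<psi>) = - ?h z" .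
  let ?D = "\<lambda>\<omega>. J r {0..} \<phi> (\<lambda>x. - u0 * \<phi> x) \<omega> - J r {0..} ?h1 \<psi> \<omega>"
  have eq: "AE \<omega> in M. ?D \<omega> = J r {0..} (\<lambda>_. \<beta>) (\<lambda>x. - indicator {d<..} x) \<omega>"
    using AE_good
  proof eventually_elim
    case (elim \<omega>)
    have "?D \<omega> = (LBINT t:{0..}. J_fun r \<phi> (\<lambda>x. - u0 * \<phi> x) \<omega> t - J_fun r ?h1 \<psi> \<omega> t)"
      unfolding J_def
      using J_fun_integrable_atLeast[OF r m\<phi> m\<phi>' \<phi>_le elim] J_fun_integrable_atLeast[OF r m(2) m\<psi> h1_le \<psi>_le elim]
      by (subst set_integral_diff(2)) auto
    also have "\<dots> = J r {0..} (\<lambda>_. \<beta>) (\<lambda>x. - indicator {d<..} x) \<omega>"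
      unfolding J_def
    proof (rule set_lebesgue_integral_cong)
      show "\<forall>t. t \<in> {0..} \<longrightarrow> J_fun r \<phi> (\<lambda>x. - u0 * \<phi> x) \<omega> t - J_fun r ?h1 \<psi> \<omega> t
          = J_fun r (\<lambda>_. \<beta>) (\<lambda>x. - indicator {d<..} x) \<omega> t"
      proof (intro allI impI)
        fix t :: real assume "t \<in> {0..}"
        then have "\<psi> (drawdown t \<omega>) = - u0 * \<phi> (drawdown t \<omega>) + indicator {d<..} (drawdown t \<omega>)"
          by (intro \<psi>_eq drawdown_nonneg elim) simp
        then show "J_fun r \<phi> (\<lambda>x. - u0 * \<phi> x) \<omega> t - J_fun r ?h1 \<psi> \<omega> t
          = J_fun r (\<lambda>_. \<beta>) (\<lambda>x. - indicator {d<..} x) \<omega> t"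
          by (simp only: J_fun_def) (simp add: \<phi>_def algebra_simps)
      qed
    qed simp
    finally show ?case .
  qed
  have mD: "?D \<in> borel_measurable M" using JA(1) JB(1) by simp
  \<comment> \<open>The reward functional inherits measurability from the difference
    \<open>?D\<close>, with which it agrees almost surely.\<close>
  have mJ: "J r {0..} (\<lambda>_. \<beta>) (\<lambda>x. - indicator {d<..} x) \<in> borel_measurable M"
    by (rule measurable_AE_eq[OF mD eq]) simp
  have "vU M W \<mu> \<sigma> r \<beta> d U z = expectation (J r {0..} (\<lambda>_. \<beta>) (\<lambda>x. - indicator {d<..} x))"
    by (rule vU_eq_J[OF mJ r])
  also have "\<dots> = expectation ?D" using mD mJ eq by (intro integral_cong_AE) auto
  also have "\<dots> = expectation (J r {0..} \<phi> (\<lambda>x. - u0 * \<phi> x)) + ?h z"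
    using JA(2) JB(2) EA by simp
  finally show "vU M W \<mu> \<sigma> r \<beta> d U z = ?h z + expectation (J r {0..} \<phi> (\<lambda>x. - u0 * \<phi> x))" by simp
qed

end

section \<open>The candidate value function\<close>

lemma integral_nonpos_AE:
  fixes f :: "'a \<Rightarrow> real"
  assumes "AE x in M. f x \<le> 0"
  shows "integral\<^sup>L M f \<le> 0"
proof -
  have "0 \<le> integral\<^sup>L M (\<lambda>x. - f x)" using assms by (intro integral_nonneg_AE) auto
  then show ?thesis by simp
qed

section \<open>Small times, sign and boundedness of the gain\<close>

context controlled_drawdown
begin

lemma drawdown_0: "good \<omega> \<Longrightarrow> drawdown 0 \<omega> = z"
  using z X_0 by (simp add: drawdown_eq)

text \<open>A maximiser \<open>s t\<close> of the path over \<open>{0..t}\<close> is squeezed to 0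
  together with \<open>t\<close>, so the running supremum tends to \<open>X 0 \<omega>\<close>,
  which is 0.\<close>

lemma drawdown_tendsto_0:
  assumes g: "good \<omega>"
  shows "((\<lambda>t. drawdown t \<omega>) \<longlongrightarrow> z) (at 0 within {0..})"
proof -
  define s where "s t = (SOME s. 0 \<le> s \<and> s \<le> t \<and> Sup ((\<lambda>s. X s \<omega>) ` {0..t}) = X s \<omega>)" for t
  have s: "0 \<le> s t \<and> s t \<le> t \<and> Sup ((\<lambda>s. X s \<omega>) ` {0..t}) = X (s t) \<omega>" if "0 \<le> t" for t
    unfolding s_def by (rule someI_ex) (rule X_attains_sup[OF g that], blast)
  have ev: "\<forall>\<^sub>F t in at 0 within {0..}. 0 \<le> (t::real)" by (auto simp: eventually_at_filter)
  have id: "((\<lambda>t. t) \<longlongrightarrow> 0) (at (0::real) within {0..})" by (rule tendsto_ident_at)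
  have "(s \<longlongrightarrow> 0) (at 0 within {0..})"
    by (rule tendsto_sandwich[OF _ _ tendsto_const id]) (rule eventually_mono[OF ev], simp add: s)+
  then have "((\<lambda>t. X (s t) \<omega>) \<longlongrightarrow> X 0 \<omega>) (at 0 within {0..})"
    by (rule continuous_on_tendsto_compose[OF continuous_X[OF g]]) (simp, rule eventually_mono[OF ev], simp add: s)
  moreover have "((\<lambda>t. X t \<omega>) \<longlongrightarrow> X 0 \<omega>) (at 0 within {0..})"
    using continuous_X[OF g] by (auto simp: continuous_on_def)
  ultimately have "((\<lambda>t. max z (X (s t) \<omega>) - X t \<omega>) \<longlongrightarrow> max z (X 0 \<omega>) - X 0 \<omega>) (at 0 within {0..})"
    by (intro tendsto_diff tendsto_max tendsto_const)
  moreover have "max z (X 0 \<omega>) - X 0 \<omega> = z" using X_0[OF g] z by simp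
  moreover have "\<forall>\<^sub>F t in at 0 within {0..}. max z (X (s t) \<omega>) - X t \<omega> = drawdown t \<omega>"
    by (rule eventually_mono[OF ev]) (simp only: drawdown_eq s)
  ultimately show ?thesis by (simp only:) (rule Lim_transform_eventually)
qed

text \<open>This is the right derivative at time 0 of the expected functional, along the times
  \<open>1 / real (Suc n)\<close>: the drawdown starts at \<open>z\<close> and is right-continuous
  there. The control coefficient is 0 because the use is with the idle control.\<close>

lemma J_small_time:
  assumes r: "0 < r" and c: "continuous_on UNIV \<psi>" and \<psi>: "\<And>x. 0 \<le> x \<Longrightarrow> \<bar>\<psi> x\<bar> \<le> B"
  shows "(\<lambda>n. real (Suc n) * expectation (J r {0..<1 / real (Suc n)} (\<lambda>_. 0) \<psi>)) \<longlonglongrightarrow> \<psi> z"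
proof -
  have B: "0 \<le> B" using \<psi>[of 0] by auto
  have zero: "\<And>x. 0 \<le> x \<Longrightarrow> \<bar>0::real\<bar> \<le> B" using B by simp
  have m: "\<psi> \<in> borel_measurable borel" using c by (rule borel_measurable_continuous_onI)
  have pos: "0 < 1 / real (Suc n)" for n by simp
  have path: "(\<lambda>n. real (Suc n) * J r {0..<1 / real (Suc n)} (\<lambda>_. 0) \<psi> \<omega>) \<longlonglongrightarrow> \<psi> z" if g: "good \<omega>" for \<omega>
  proof (rule LIMSEQ_I)
    fix e :: real assume e: "0 < e"
    have "((\<lambda>t. \<psi> (drawdown t \<omega>)) \<longlongrightarrow> \<psi> z) (at 0 within {0..})"
      by (rule continuous_on_tendsto_compose[OF c drawdown_tendsto_0[OF g]]) auto
    then have "((\<lambda>t. J_fun r (\<lambda>_. 0) \<psi> \<omega> t) \<longlongrightarrow> exp (- r * 0) * (0 * 0 + \<psi> z)) (at 0 within {0..})"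
      unfolding J_fun_def mult_zero_left by (intro tendsto_intros)
    then have "\<forall>\<^sub>F t in at 0 within {0..}. dist (J_fun r (\<lambda>_. 0) \<psi> \<omega> t) (\<psi> z) < e / 2"
      using e by (intro tendstoD) auto
    then obtain \<eta> where \<eta>: "0 < \<eta>" "\<And>t. 0 \<le> t \<Longrightarrow> t \<noteq> 0 \<Longrightarrow> t < \<eta> \<Longrightarrow> \<bar>J_fun r (\<lambda>_. 0) \<psi> \<omega> t - \<psi> z\<bar> < e / 2"
      unfolding eventually_at by (auto simp: dist_real_def)
    have close: "\<bar>J_fun r (\<lambda>_. 0) \<psi> \<omega> t - \<psi> z\<bar> \<le> e / 2" if "0 \<le> t" "t < \<eta>" for t
      using \<eta>(2)[of t] that e by (cases "t = 0") (auto simp: J_fun_def drawdown_0[OF g])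
    obtain N where N: "1 / \<eta> < real N" using reals_Archimedean2 by blast
    show "\<exists>N. \<forall>n\<ge>N. norm (real (Suc n) * J r {0..<1 / real (Suc n)} (\<lambda>_. 0) \<psi> \<omega> - \<psi> z) < e"
    proof (intro exI[of _ N] allI impI)
      fix n assume n: "N \<le> n"
      define \<epsilon> where "\<epsilon> = 1 / real (Suc n)"
      have \<epsilon>: "0 < \<epsilon>" "real (Suc n) * \<epsilon> = 1" by (auto simp: \<epsilon>_def)
      have "1 / \<eta> < real (Suc n)" using N n by simp
      then have \<epsilon>\<eta>: "\<epsilon> < \<eta>" using \<eta>(1) by (simp add: \<epsilon>_def field_simps)
      have i: "set_integrable lborel {0..<\<epsilon>} (J_fun r (\<lambda>_. 0) \<psi> \<omega>)"
        by (rule set_integrable_subset[OF J_fun_integrable_atLeast[OF r _ m zero \<psi> g]]) auto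
      have ci: "set_integrable lborel {0..<\<epsilon>} (\<lambda>_. c)" for c :: real
        by (rule set_integrable_const_bounded[where a = 0 and b = \<epsilon>]) auto
      have diff: "J r {0..<\<epsilon>} (\<lambda>_. 0) \<psi> \<omega> - \<epsilon> * \<psi> z = (LBINT t:{0..<\<epsilon>}. J_fun r (\<lambda>_. 0) \<psi> \<omega> t - \<psi> z)"
      proof -
        have "(LBINT t:{0..<\<epsilon>}. J_fun r (\<lambda>_. 0) \<psi> \<omega> t - \<psi> z) = J r {0..<\<epsilon>} (\<lambda>_. 0) \<psi> \<omega> - (LBINT t:{0..<\<epsilon>}. \<psi> z)"
          unfolding J_def by (rule set_integral_diff(2)[OF i ci])
        also have "(LBINT t:{0..<\<epsilon>}. \<psi> z) = \<epsilon> * \<psi> z" using \<epsilon>(1) by (simp add: set_integral_const)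
        finally show ?thesis by simp
      qed
      have "\<bar>J r {0..<\<epsilon>} (\<lambda>_. 0) \<psi> \<omega> - \<epsilon> * \<psi> z\<bar> \<le> (\<integral>t. \<bar>indicator {0..<\<epsilon>} t *\<^sub>R (J_fun r (\<lambda>_. 0) \<psi> \<omega> t - \<psi> z)\<bar> \<partial>lborel)"
        unfolding diff set_lebesgue_integral_def by (rule integral_abs_bound)
      also have "\<dots> \<le> (LBINT t:{0..<\<epsilon>}. e / 2)"
        unfolding set_lebesgue_integral_def
      proof (rule integral_mono)
        show "integrable lborel (\<lambda>t. \<bar>indicator {0..<\<epsilon>} t *\<^sub>R (J_fun r (\<lambda>_. 0) \<psi> \<omega> t - \<psi> z)\<bar>)"
          by (rule integrable_abs[OF set_integral_diff(1)[OF i ci, unfolded set_integrable_def]])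
        show "integrable lborel (\<lambda>t. indicator {0..<\<epsilon>} t *\<^sub>R (e / 2))"
          by (rule ci[unfolded set_integrable_def])
        show "\<bar>indicator {0..<\<epsilon>} t *\<^sub>R (J_fun r (\<lambda>_. 0) \<psi> \<omega> t - \<psi> z)\<bar> \<le> indicator {0..<\<epsilon>} t *\<^sub>R (e / 2)" for t
          using close[of t] \<epsilon>\<eta> by (auto simp: indicator_def)
      qed
      also have "\<dots> = \<epsilon> * (e / 2)" using \<epsilon>(1) by (simp add: set_integral_const)
      finally have le: "\<bar>J r {0..<\<epsilon>} (\<lambda>_. 0) \<psi> \<omega> - \<epsilon> * \<psi> z\<bar> \<le> \<epsilon> * (e / 2)" .
      have "real (Suc n) * \<bar>J r {0..<\<epsilon>} (\<lambda>_. 0) \<psi> \<omega> - \<epsilon> * \<psi> z\<bar> \<le> real (Suc n) * (\<epsilon> * (e / 2))"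
        by (intro mult_left_mono le) simp
      also have "\<dots> = e / 2" using \<epsilon>(2) by (simp only: mult.assoc[symmetric] mult_1)
      finally have le': "real (Suc n) * \<bar>J r {0..<\<epsilon>} (\<lambda>_. 0) \<psi> \<omega> - \<epsilon> * \<psi> z\<bar> \<le> e / 2" .
      have "real (Suc n) * \<bar>J r {0..<\<epsilon>} (\<lambda>_. 0) \<psi> \<omega> - \<epsilon> * \<psi> z\<bar>
          = \<bar>real (Suc n) * J r {0..<\<epsilon>} (\<lambda>_. 0) \<psi> \<omega> - (real (Suc n) * \<epsilon>) * \<psi> z\<bar>"
        by (subst abs_mult_pos') (simp_all only: of_nat_0_le_iff right_diff_distrib mult.assoc)
      with le' show "norm (real (Suc n) * J r {0..<1 / real (Suc n)} (\<lambda>_. 0) \<psi> \<omega> - \<psi> z) < e"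
        using e by (simp only: \<epsilon>(2) real_norm_def mult_1 \<epsilon>_def[symmetric])
    qed
  qed
  have Jm: "J r {0..<1 / real (Suc n)} (\<lambda>_. 0) \<psi> \<in> borel_measurable M" for n
    by (rule J_measurable[OF less_imp_le[OF r] pos continuous_on_const c zero \<psi>])
  have "(\<lambda>n. expectation (\<lambda>\<omega>. real (Suc n) * J r {0..<1 / real (Suc n)} (\<lambda>_. 0) \<psi> \<omega>)) \<longlonglongrightarrow> expectation (\<lambda>\<omega>. \<psi> z)"
  proof (rule integral_dominated_convergence)
    show "(\<lambda>\<omega>. real (Suc n) * J r {0..<1 / real (Suc n)} (\<lambda>_. 0) \<psi> \<omega>) \<in> borel_measurable M" for n
      using Jm by measurable
    show "AE \<omega> in M. (\<lambda>n. real (Suc n) * J r {0..<1 / real (Suc n)} (\<lambda>_. 0) \<psi> \<omega>) \<longlonglongrightarrow> \<psi> z"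
      using AE_good by eventually_elim (rule path)
    show "AE \<omega> in M. norm (real (Suc n) * J r {0..<1 / real (Suc n)} (\<lambda>_. 0) \<psi> \<omega>) \<le> B * (u0 + 1)" for n
      using AE_good
    proof eventually_elim
      case (elim \<omega>)
      have "\<bar>J r {0..<1 / real (Suc n)} (\<lambda>_. 0) \<psi> \<omega>\<bar> \<le> B * (u0 + 1) * (1 / real (Suc n))"
        by (rule J_bound[OF less_imp_le[OF r] pos continuous_on_const c zero \<psi> elim])
      then have "real (Suc n) * \<bar>J r {0..<1 / real (Suc n)} (\<lambda>_. 0) \<psi> \<omega>\<bar> \<le> B * (u0 + 1)"
        by (simp add: pos_le_divide_eq mult.commute del: of_nat_Suc)
      then show ?case by (simp add: abs_mult del: of_nat_Suc)
    qed
  qed auto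
  then show ?thesis by (simp add: prob_space)
qed

lemma J_nonpos:
  assumes "\<And>x. 0 \<le> x \<Longrightarrow> 0 \<le> \<phi> x"
  shows "expectation (J r {0..} \<phi> (\<lambda>x. - u0 * \<phi> x)) \<le> 0"
proof (rule integral_nonpos_AE)
  show "AE \<omega> in M. J r {0..} \<phi> (\<lambda>x. - u0 * \<phi> x) \<omega> \<le> 0"
    using AE_good
  proof eventually_elim
    case (elim \<omega>)
    have "indicator {0..} t *\<^sub>R J_fun r \<phi> (\<lambda>x. - u0 * \<phi> x) \<omega> t \<le> 0" for t
    proof (cases "0 \<le> t")
      case True
      have "J_fun r \<phi> (\<lambda>x. - u0 * \<phi> x) \<omega> t = - (exp (- r * t) * (\<phi> (drawdown t \<omega>) * (u0 - U t \<omega>)))"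
        by (simp add: J_fun_def algebra_simps)
      also have "\<dots> \<le> 0"
        using U_bounds[OF True good_space[OF elim]] assms[OF drawdown_nonneg[OF elim True]] by simp
      finally show ?thesis using True by simp
    qed simp
    then show ?case
      unfolding J_def set_lebesgue_integral_def by (intro integral_nonpos_AE AE_I2)
  qed
qed

text \<open>A real supremum dominates its members only if they are bounded above; this bound is the
  same for all controls.\<close>

lemma J_expectation_le:
  assumes r: "0 < r" and m: "\<phi> \<in> borel_measurable borel" "\<psi> \<in> borel_measurable borel"
    and \<phi>: "\<And>x. 0 \<le> x \<Longrightarrow> \<bar>\<phi> x\<bar> \<le> B" and \<psi>: "\<And>x. 0 \<le> x \<Longrightarrow> \<bar>\<psi> x\<bar> \<le> B"
    and i: "integrable M (J r {0..} \<phi> \<psi>)"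
  shows "expectation (J r {0..} \<phi> \<psi>) \<le> (LBINT t:{0..}. exp (- r * t) * (B * (u0 + 1)))"
proof (rule integral_le_const[OF i])
  show "AE \<omega> in M. J r {0..} \<phi> \<psi> \<omega> \<le> (LBINT t:{0..}. exp (- r * t) * (B * (u0 + 1)))"
    using AE_good
  proof eventually_elim
    case (elim \<omega>)
    show ?case using J_uniform_bound[OF r m \<phi> \<psi> elim, of "{0..}"] by simp
  qed
qed

end

lemma deterministic_admissible:
  assumes m: "g \<in> borel_measurable borel" and g: "\<And>t. 0 \<le> t \<Longrightarrow> 0 \<le> g t \<and> g t \<le> u0"
  shows "(\<lambda>t \<omega>. g t) \<in> admissible M W u0"
proof -
  have "(\<lambda>(s, \<omega>). g s) \<in> borel_measurable (restrict_space lborel {0..t} \<Otimes>\<^sub>M filt M W t)" for t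
  proof -
    have "g \<in> borel_measurable (restrict_space lborel {0..t})"
      using m by (intro measurable_restrict_space1) simp
    from measurable_compose[OF measurable_fst this] show ?thesis by (simp add: split_beta')
  qed
  then show ?thesis using g by (auto simp: admissible_def)
qed

text \<open>Before \<open>\<epsilon>\<close> the two controls agree and so do their drawdowns;
  afterwards the control equals \<open>u0\<close> and the integrand cancels.\<close>

lemma J_delayed_control:
  assumes c: "controlled_drawdown M W (\<lambda>t \<omega>. if t < \<epsilon> then 0 else u0) \<sigma> u0 z"
    and c0: "controlled_drawdown M W (\<lambda>t \<omega>. 0) \<sigma> u0 z"
  shows "controlled_drawdown.J W (\<lambda>t \<omega>. if t < \<epsilon> then 0 else u0) \<mu> \<sigma> z r {0..} \<phi> (\<lambda>x. - u0 * \<phi> x)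
     = controlled_drawdown.J W (\<lambda>t \<omega>. 0) \<mu> \<sigma> z r {0..<\<epsilon>} (\<lambda>_. 0) (\<lambda>x. - u0 * \<phi> x)"
proof
  fix \<omega>
  interpret E: controlled_drawdown M W "\<lambda>t \<omega>. if t < \<epsilon> then 0 else u0" \<mu> \<sigma> u0 z by (rule c)
  interpret Z: controlled_drawdown M W "\<lambda>t \<omega>. 0" \<mu> \<sigma> u0 z by (rule c0)
  have X: "E.X t \<omega> = Z.X t \<omega>" if "0 \<le> t" "t < \<epsilon>" for t
  proof -
    have "E.U_int {0..t} \<omega> = Z.U_int {0..t} \<omega>"
      unfolding E.U_int_def Z.U_int_def using that by (intro set_lebesgue_integral_cong) auto
    then show ?thesis using that by (simp add: E.X_eq Z.X_eq)
  qed
  have D: "E.drawdown t \<omega> = Z.drawdown t \<omega>" if "0 \<le> t" "t < \<epsilon>" for t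
  proof -
    have "(\<lambda>s. E.X s \<omega>) ` {0..t} = (\<lambda>s. Z.X s \<omega>) ` {0..t}" using that X by (intro image_cong) auto
    then show ?thesis using X[OF that] by (simp only: E.drawdown_eq Z.drawdown_eq)
  qed
  show "E.J r {0..} \<phi> (\<lambda>x. - u0 * \<phi> x) \<omega> = Z.J r {0..<\<epsilon>} (\<lambda>_. 0) (\<lambda>x. - u0 * \<phi> x) \<omega>"
    unfolding E.J_def Z.J_def set_lebesgue_integral_def
    by (rule Bochner_Integration.integral_cong[OF refl])
      (auto simp: indicator_def E.J_fun_def Z.J_fun_def D algebra_simps)
qed

section \<open>Explicit solution of the equation for the constant control\<close>

locale candidate =
  fixes \<mu> \<sigma> u0 r \<beta> d :: real
  assumes \<sigma>: "0 < \<sigma>" and r: "0 < r" and d: "0 < d"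
begin

definition "p = theta1 \<mu> \<sigma> r u0"
definition "q = theta2 \<mu> \<sigma> r u0"
definition "A = 1 / (r * (p + q) * exp (p * d))"
definition "\<zeta> = p * q * (exp (p * d) - exp (- q * d)) / (r * (p + q) * exp (p * d))"

text \<open>Constant particular solution plus the combination of the two exponentials whose
  derivative vanishes at 0, the Neumann condition of the reflection.\<close>

definition "F x = \<beta> * u0 / r - A * (q * exp (p * x) + p * exp (- q * x))"
definition "F1 x = - A * p * q * (exp (p * x) - exp (- q * x))"
definition "F2 x = - A * p * q * (p * exp (p * x) + q * exp (- q * x))"
definition "F3 x = - A * p * q * (p\<^sup>2 * exp (p * x) - q\<^sup>2 * exp (- q * x))"
definition "G x = (\<beta> * u0 - 1) / r + \<zeta> / q * exp (- q * (x - d))"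
definition "G1 x = - \<zeta> * exp (- q * (x - d))"
definition "G2 x = \<zeta> * q * exp (- q * (x - d))"
definition "G3 x = - \<zeta> * q\<^sup>2 * exp (- q * (x - d))"

lemma theta_pos: "0 < p" "0 < q"
proof -
  have "(\<mu> - u0)\<^sup>2 < (\<mu> - u0)\<^sup>2 + 2 * r * \<sigma>\<^sup>2" using r \<sigma> by simp
  then have "\<bar>\<mu> - u0\<bar> < sqrt ((\<mu> - u0)\<^sup>2 + 2 * r * \<sigma>\<^sup>2)" by (intro real_less_rsqrt) simp
  then show "0 < p" "0 < q" using \<sigma> by (auto simp: p_def q_def theta1_def theta2_def)
qed

text \<open>So \<open>exp (p * x)\<close> and \<open>exp (- q * x)\<close> solve the homogeneous
  equation. The drift appears as minus \<open>\<mu> - u0\<close> because the drawdown moves against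
  \<open>X\<close>.\<close>

lemma characteristic_roots:
  "\<sigma>\<^sup>2 / 2 * p\<^sup>2 - (\<mu> - u0) * p = r" "\<sigma>\<^sup>2 / 2 * q\<^sup>2 + (\<mu> - u0) * q = r"
proof -
  define s where "s = sqrt ((\<mu> - u0)\<^sup>2 + 2 * r * \<sigma>\<^sup>2)"
  have s: "s\<^sup>2 = (\<mu> - u0)\<^sup>2 + 2 * r * \<sigma>\<^sup>2" using r by (simp add: s_def add_nonneg_nonneg)
  have p: "\<sigma>\<^sup>2 * p = s + (\<mu> - u0)" and q: "\<sigma>\<^sup>2 * q = s - (\<mu> - u0)"
    using \<sigma> by (auto simp: p_def q_def theta1_def theta2_def s_def)
  have "\<sigma>\<^sup>2 * (\<sigma>\<^sup>2 / 2 * p\<^sup>2 - (\<mu> - u0) * p) = (\<sigma>\<^sup>2 * p)\<^sup>2 / 2 - (\<mu> - u0) * (\<sigma>\<^sup>2 * p)"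
    by (simp add: power2_eq_square algebra_simps)
  also have "\<dots> = \<sigma>\<^sup>2 * r" unfolding p using s by (simp add: power2_eq_square field_simps)
  finally show "\<sigma>\<^sup>2 / 2 * p\<^sup>2 - (\<mu> - u0) * p = r" using \<sigma> by (simp only: mult_cancel_left) simp
  have "\<sigma>\<^sup>2 * (\<sigma>\<^sup>2 / 2 * q\<^sup>2 + (\<mu> - u0) * q) = (\<sigma>\<^sup>2 * q)\<^sup>2 / 2 + (\<mu> - u0) * (\<sigma>\<^sup>2 * q)"
    by (simp add: power2_eq_square algebra_simps)
  also have "\<dots> = \<sigma>\<^sup>2 * r" unfolding q using s by (simp add: power2_eq_square field_simps)
  finally show "\<sigma>\<^sup>2 / 2 * q\<^sup>2 + (\<mu> - u0) * q = r" using \<sigma> by (simp only: mult_cancel_left) simp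
qed

lemma A_pos: "0 < A" using theta_pos r by (simp add: A_def)

lemma \<zeta>_eq: "\<zeta> = A * p * q * (exp (p * d) - exp (- q * d))"
  by (simp add: \<zeta>_def A_def)

lemma \<zeta>_pos: "0 < \<zeta>"
proof -
  have "- q * d < p * d" using theta_pos d by (intro mult_strict_right_mono) auto
  then show ?thesis using theta_pos A_pos by (simp add: \<zeta>_eq)
qed

lemma F_deriv:
  "(F has_real_derivative F1 x) (at x)" "(F1 has_real_derivative F2 x) (at x)" "(F2 has_real_derivative F3 x) (at x)"
  unfolding F_def[abs_def] F1_def[abs_def] F2_def[abs_def] F3_def
  by (auto intro!: derivative_eq_intros simp: algebra_simps power2_eq_square)

lemma G_deriv:
  "(G has_real_derivative G1 x) (at x)" "(G1 has_real_derivative G2 x) (at x)" "(G2 has_real_derivative G3 x) (at x)"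
  unfolding G_def[abs_def] G1_def[abs_def] G2_def[abs_def] G3_def using theta_pos
  by (auto intro!: derivative_eq_intros simp: algebra_simps power2_eq_square)

lemma match: "F d = G d" "F1 d = G1 d"
proof -
  \<comment> \<open>The origin of \<open>A\<close>: the constant particular solutions on the two
    sides of \<open>d\<close> differ by \<open>1 / r\<close>, and the exponential parts must make up
    for it.\<close>
  have r_inv: "1 / r = A * (p + q) * exp (p * d)"
    using theta_pos r by (simp add: A_def)
  have "\<zeta> / q = A * p * (exp (p * d) - exp (- q * d))" using theta_pos by (simp add: \<zeta>_eq)
  then show "F d = G d"
    by (simp add: F_def G_def diff_divide_distrib r_inv algebra_simps)
  show "F1 d = G1 d" by (simp add: F1_def G1_def \<zeta>_eq)
qed

lemma glued: "\<exists>B. glued_function d F F1 F2 F3 G G1 G2 G3 B"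
proof -
  have bnd: "\<exists>B. 0 \<le> B \<and> (\<forall>x\<in>{0..d}. \<bar>f x\<bar> \<le> B)" if "continuous_on {0..d} f" for f :: "real \<Rightarrow> real"
    using continuous_on_compact_bound[OF compact_Icc that] by (metis real_norm_def)
  have "continuous_on {0..d} F" unfolding F_def[abs_def] by (intro continuous_intros)
  from bnd[OF this] obtain a where a: "0 \<le> a" "\<forall>x\<in>{0..d}. \<bar>F x\<bar> \<le> a" by auto
  have "continuous_on {0..d} F1" unfolding F1_def[abs_def] by (intro continuous_intros)
  from bnd[OF this] obtain b where b: "0 \<le> b" "\<forall>x\<in>{0..d}. \<bar>F1 x\<bar> \<le> b" by auto
  have "continuous_on {0..d} F2" unfolding F2_def[abs_def] by (intro continuous_intros)
  from bnd[OF this] obtain c where c: "0 \<le> c" "\<forall>x\<in>{0..d}. \<bar>F2 x\<bar> \<le> c" by auto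
  have "continuous_on {0..d} F3" unfolding F3_def[abs_def] by (intro continuous_intros)
  from bnd[OF this] obtain e where e: "0 \<le> e" "\<forall>x\<in>{0..d}. \<bar>F3 x\<bar> \<le> e" by auto
  note F_le = a b c e
  define g where "g = \<bar>(\<beta> * u0 - 1) / r\<bar> + \<zeta> / q + \<zeta> + \<zeta> * q + \<zeta> * q\<^sup>2"
  have nn: "0 \<le> \<bar>(\<beta> * u0 - 1) / r\<bar>" "0 \<le> \<zeta> / q" "0 \<le> \<zeta>" "0 \<le> \<zeta> * q" "0 \<le> \<zeta> * q\<^sup>2"
    using \<zeta>_pos theta_pos by (simp_all add: less_imp_le)
  have g0: "0 \<le> g" using nn unfolding g_def by linarith
  have G_le: "\<bar>G x\<bar> \<le> g" "\<bar>G1 x\<bar> \<le> g" "\<bar>G2 x\<bar> \<le> g" "\<bar>G3 x\<bar> \<le> g" if "d \<le> x" for x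
  proof -
    have e1: "exp (- q * (x - d)) \<le> 1" using that theta_pos by simp
    have m: "\<bar>y * exp (- q * (x - d))\<bar> \<le> y" if "0 \<le> y" for y
      using mult_left_mono[OF e1 that] that by (simp add: abs_mult)
    have "\<bar>G x\<bar> \<le> \<bar>(\<beta> * u0 - 1) / r\<bar> + \<zeta> / q"
      unfolding G_def by (intro order_trans[OF abs_triangle_ineq] add_left_mono m nn)
    moreover have "\<bar>G1 x\<bar> \<le> \<zeta>" using m[OF nn(3)] by (simp add: G1_def)
    moreover have "\<bar>G2 x\<bar> \<le> \<zeta> * q" using m[OF nn(4)] by (simp add: G2_def)
    moreover have "\<bar>G3 x\<bar> \<le> \<zeta> * q\<^sup>2" using m[OF nn(5)] by (simp add: G3_def)
    ultimately show "\<bar>G x\<bar> \<le> g" "\<bar>G1 x\<bar> \<le> g" "\<bar>G2 x\<bar> \<le> g" "\<bar>G3 x\<bar> \<le> g"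
      using nn unfolding g_def by linarith+
  qed
  have "glued_function d F F1 F2 F3 G G1 G2 G3 (a + b + c + e + g)"
  proof
    fix x
    show "(F has_real_derivative F1 x) (at x)" "(F1 has_real_derivative F2 x) (at x)" "(F2 has_real_derivative F3 x) (at x)"
      by (rule F_deriv)+
    show "(G has_real_derivative G1 x) (at x)" "(G1 has_real_derivative G2 x) (at x)" "(G2 has_real_derivative G3 x) (at x)"
      by (rule G_deriv)+
    assume "0 \<le> x" "x \<le> d"
    then have "\<bar>F x\<bar> \<le> a" "\<bar>F1 x\<bar> \<le> b" "\<bar>F2 x\<bar> \<le> c" "\<bar>F3 x\<bar> \<le> e" using F_le by auto
    then show "\<bar>F x\<bar> \<le> a + b + c + e + g \<and> \<bar>F1 x\<bar> \<le> a + b + c + e + g \<and> \<bar>F2 x\<bar> \<le> a + b + c + e + g \<and> \<bar>F3 x\<bar> \<le> a + b + c + e + g"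
      using F_le(1,3,5,7) g0 by (intro conjI; linarith)
  next
    fix x assume "d \<le> x"
    from G_le[OF this]
    show "\<bar>G x\<bar> \<le> a + b + c + e + g \<and> \<bar>G1 x\<bar> \<le> a + b + c + e + g \<and> \<bar>G2 x\<bar> \<le> a + b + c + e + g \<and> \<bar>G3 x\<bar> \<le> a + b + c + e + g"
      using F_le(1,3,5,7) by (intro conjI; linarith)
  qed (use d match in \<open>simp_all add: F1_def\<close>)
  then show ?thesis ..
qed

text \<open>On each side the coefficient of every exponential is a characteristic polynomial at its
  root. At \<open>d\<close> the left branch and the indicator, 0 there, are consistent.\<close>

lemma ode:
  "- r * glue d F G x - (\<mu> - u0) * glue d F1 G1 x + \<sigma>\<^sup>2 / 2 * glue d F2 G2 x = - \<beta> * u0 + indicator {d<..} x"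
proof (cases "x \<le> d")
  case True
  define P Q where "P = exp (p * x)" and "Q = exp (- q * x)"
  have "- r * F x - (\<mu> - u0) * F1 x + \<sigma>\<^sup>2 / 2 * F2 x
     = - \<beta> * u0 - A * (q * P * (\<sigma>\<^sup>2 / 2 * p\<^sup>2 - (\<mu> - u0) * p - r) + p * Q * (\<sigma>\<^sup>2 / 2 * q\<^sup>2 + (\<mu> - u0) * q - r))"
    unfolding F_def F1_def F2_def P_def[symmetric] Q_def[symmetric]
    using r by (simp add: power2_eq_square algebra_simps)
  also have "\<dots> = - \<beta> * u0" unfolding characteristic_roots by simp
  finally show ?thesis using True by (simp add: glue_def)
next
  case False
  define Q where "Q = exp (- q * (x - d))"
  have "- r * G x - (\<mu> - u0) * G1 x + \<sigma>\<^sup>2 / 2 * G2 x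
     = - \<beta> * u0 + 1 + \<zeta> / q * Q * (\<sigma>\<^sup>2 / 2 * q\<^sup>2 + (\<mu> - u0) * q - r)"
    unfolding G_def G1_def G2_def Q_def[symmetric]
    using r theta_pos by (simp add: power2_eq_square field_simps)
  also have "\<dots> = - \<beta> * u0 + 1" unfolding characteristic_roots by simp
  finally show ?thesis using False by (simp add: glue_def)
qed

lemma slope_at_d: "glue d F1 G1 d = - \<zeta>"
  by (simp add: glue_def match G1_def)

text \<open>The slope falls on the left of \<open>d\<close>, where
  \<open>exp (p * x) - exp (- q * x)\<close> increases, and rises to 0 on the right.\<close>

lemma slope_ge:
  assumes "0 \<le> x"
  shows "- \<zeta> \<le> glue d F1 G1 x"
proof (cases "x \<le> d")
  case True
  have "exp (p * x) - exp (- q * x) \<le> exp (p * d) - exp (- q * d)"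
    using True theta_pos by (intro diff_mono) auto
  then have "A * p * q * (exp (p * x) - exp (- q * x)) \<le> \<zeta>"
    unfolding \<zeta>_eq using A_pos theta_pos by (intro mult_left_mono) auto
  then show ?thesis using True by (simp add: glue_def F1_def)
next
  case False
  then have "exp (- q * (x - d)) \<le> 1" using theta_pos by simp
  from mult_left_mono[OF this less_imp_le[OF \<zeta>_pos]] show ?thesis using False by (simp add: glue_def G1_def)
qed

end

theorem theorem3p1:
  fixes M :: "'a measure" and W :: "real \<Rightarrow> 'a \<Rightarrow> real"
    and \<mu> \<sigma> u0 r \<beta> d :: real
  assumes "prob_space M" and "complete_measure M" and "std_BM M W"
    and "\<sigma> > 0" and "u0 > 0" and "r > 0" and "\<beta> > 0" and "d > 0"
  defines "\<alpha>1 \<equiv> theta1 \<mu> \<sigma> r u0" and "\<alpha>2 \<equiv> theta2 \<mu> \<sigma> r u0"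
  defines "fbar \<equiv> (\<lambda>z. \<beta> * u0 / r
              - (1 / r) * (\<alpha>2 * exp (\<alpha>1 * z) + \<alpha>1 * exp (- \<alpha>2 * z)) / ((\<alpha>1 + \<alpha>2) * exp (\<alpha>1 * d)))"
  defines "gbar \<equiv> (\<lambda>z. (\<beta> * u0 - 1) / r
              + (1 / r) * (\<alpha>1 * (exp (\<alpha>1 * d) - exp (- \<alpha>2 * d)) / ((\<alpha>1 + \<alpha>2) * exp (\<alpha>1 * d)))
                * exp (- \<alpha>2 * (z - d)))"
  defines "\<zeta> \<equiv> \<alpha>1 * \<alpha>2 * (exp (\<alpha>1 * d) - exp (- \<alpha>2 * d)) / (r * (\<alpha>1 + \<alpha>2) * exp (\<alpha>1 * d))"
  shows "\<zeta> > 0 \<and>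
         ((\<forall>z\<ge>0. vfun M W \<mu> \<sigma> u0 r \<beta> d z
                 = fbar z * indicator {0..d} z + gbar z * indicator {d<..} z) \<longleftrightarrow> \<beta> \<ge> \<zeta>) \<and>
         (\<beta> \<ge> \<zeta> \<longrightarrow> (\<lambda>t \<omega>. u0) \<in> admissible M W u0 \<and>
           (\<forall>z\<ge>0. vU M W \<mu> \<sigma> r \<beta> d (\<lambda>t \<omega>. u0) z = vfun M W \<mu> \<sigma> u0 r \<beta> d z))"
proof -
  note \<sigma> = \<open>\<sigma> > 0\<close> and u0 = \<open>u0 > 0\<close> and r = \<open>r > 0\<close> and d = \<open>d > 0\<close>
  interpret prob_space M by fact
  interpret candidate \<mu> \<sigma> u0 r \<beta> d by unfold_locales (fact \<sigma> r d)+
  let ?h = "glue d F G"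
  define \<phi> where "\<phi> x = glue d F1 G1 x + \<beta>" for x
  have \<alpha>: "\<alpha>1 = p" "\<alpha>2 = q" by (simp_all add: \<alpha>1_def \<alpha>2_def p_def q_def)
  have \<zeta>': "\<zeta> = candidate.\<zeta> \<mu> \<sigma> u0 r d" by (simp add: assms(13) \<zeta>_def \<alpha>)
  have fbar: "fbar z = F z" for z
    by (simp add: fbar_def F_def A_def \<alpha>)
  have gbar: "gbar z = G z" for z
    using theta_pos by (simp add: gbar_def G_def \<zeta>_def \<alpha>)
  have h: "fbar z * indicator {0..d} z + gbar z * indicator {d<..} z = ?h z" if "0 \<le> z" for z
    using that by (simp add: fbar gbar glue_def indicator_def)
  obtain B where gf: "glued_function d F F1 F2 F3 G G1 G2 G3 B" using glued ..
  interpret glued_function d F F1 F2 F3 G G1 G2 G3 B by (rule gf)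
  have ctrl: "controlled_drawdown M W U \<sigma> u0 z" if "U \<in> admissible M W u0" "0 \<le> z" for U z
    using prob_space_axioms assms(2,3) \<sigma> u0 that
    by (intro controlled_drawdown.intro controlled_drawdown_axioms.intro)
  have value_eq: "vU M W \<mu> \<sigma> r \<beta> d U z = ?h z + expectation (controlled_drawdown.J W U \<mu> \<sigma> z r {0..} \<phi> (\<lambda>x. - u0 * \<phi> x))"
    and J_int: "integrable M (controlled_drawdown.J W U \<mu> \<sigma> z r {0..} \<phi> (\<lambda>x. - u0 * \<phi> x))"
    if "U \<in> admissible M W u0" "0 \<le> z" for U z
    unfolding \<phi>_def using controlled_drawdown.value_identity[OF ctrl[OF that] gf r ode] by auto
  have max_adm: "(\<lambda>t \<omega>. u0) \<in> admissible M W u0"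
    by (rule deterministic_admissible) (use u0 in auto)
  have max_value: "vU M W \<mu> \<sigma> r \<beta> d (\<lambda>t \<omega>. u0) z = ?h z" if z: "0 \<le> z" for z
  proof -
    interpret C: controlled_drawdown M W "\<lambda>t \<omega>. u0" \<mu> \<sigma> u0 z by (rule ctrl[OF max_adm z])
    \<comment> \<open>With full control, \<open>\<phi>\<close> times the control cancels against
      \<open>u0 * \<phi>\<close> pointwise.\<close>
    have J_eq: "C.J r {0..} \<phi> (\<lambda>x. - u0 * \<phi> x) = (\<lambda>\<omega>. 0)"
      by (rule ext) (simp add: C.J_def C.J_fun_def set_lebesgue_integral_def)
    show ?thesis unfolding value_eq[OF max_adm z] J_eq by simp
  qed
  have optimal: "vfun M W \<mu> \<sigma> u0 r \<beta> d z = ?h z" if \<beta>: "\<beta> \<ge> \<zeta>" and z: "0 \<le> z" for z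
    unfolding vfun_def
  \<comment> \<open>The full control attains the bound, so the supremum is a maximum and boundedness
    comes for free.\<close>
  proof (rule cSup_eq_maximum)
    show "?h z \<in> (\<lambda>U. vU M W \<mu> \<sigma> r \<beta> d U z) ` admissible M W u0"
      using max_adm max_value[OF z] by (metis image_eqI)
    fix y assume "y \<in> (\<lambda>U. vU M W \<mu> \<sigma> r \<beta> d U z) ` admissible M W u0"
    then obtain U where U: "U \<in> admissible M W u0" "y = vU M W \<mu> \<sigma> r \<beta> d U z" by auto
    interpret C: controlled_drawdown M W U \<mu> \<sigma> u0 z by (rule ctrl[OF U(1) z])
    have "0 \<le> \<phi> x" if "0 \<le> x" for x
      using slope_ge[OF that] \<beta> by (simp add: \<phi>_def \<zeta>')
    then show "y \<le> ?h z"
      unfolding U(2) value_eq[OF U(1) z] using C.J_nonpos[of \<phi> r] by simp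
  qed
  have not_optimal: "?h d < vfun M W \<mu> \<sigma> u0 r \<beta> d d" if \<beta>: "\<beta> < \<zeta>"
  proof -
    define \<psi> where "\<psi> x = - u0 * \<phi> x" for x
    define C where "C = (u0 + 1) * (B + \<bar>\<beta>\<bar>)"
    have \<phi>_le: "\<bar>\<phi> x\<bar> \<le> B + \<bar>\<beta>\<bar>" if "0 \<le> x" for x
      unfolding \<phi>_def using h_le[OF that] by (intro order_trans[OF abs_triangle_ineq]) (auto simp: h1_def)
    have \<psi>_le: "\<bar>\<psi> x\<bar> \<le> C" and \<phi>_le': "\<bar>\<phi> x\<bar> \<le> C" if "0 \<le> x" for x
    proof -
      have nn: "0 \<le> B + \<bar>\<beta>\<bar>" "0 \<le> u0 * (B + \<bar>\<beta>\<bar>)" using B_nonneg u0 by auto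
      have "\<bar>\<psi> x\<bar> \<le> u0 * (B + \<bar>\<beta>\<bar>)" using \<phi>_le[OF that] u0 by (simp add: \<psi>_def abs_mult)
      moreover have "C = u0 * (B + \<bar>\<beta>\<bar>) + (B + \<bar>\<beta>\<bar>)" by (simp add: C_def algebra_simps)
      ultimately show "\<bar>\<psi> x\<bar> \<le> C" "\<bar>\<phi> x\<bar> \<le> C"
        using \<phi>_le[OF that] nn by simp_all
    qed
    have cont: "continuous_on UNIV \<phi>" "continuous_on UNIV \<psi>"
      unfolding \<psi>_def \<phi>_def using h1_continuous by (auto intro!: continuous_intros simp: h1_def)
    have meas: "\<phi> \<in> borel_measurable borel" "\<psi> \<in> borel_measurable borel"
      using cont by (auto intro: borel_measurable_continuous_onI)
    have zero_adm: "(\<lambda>t \<omega>. 0) \<in> admissible M W u0"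
      by (rule deterministic_admissible) (use u0 in auto)
    have d0: "0 \<le> d" using d by simp
    interpret Z: controlled_drawdown M W "\<lambda>t \<omega>. 0" \<mu> \<sigma> u0 d by (rule ctrl[OF zero_adm d0])
    \<comment> \<open>At \<open>d\<close> the slope is \<open>- \<zeta>\<close>, so this is
      \<open>\<psi> d\<close>, the gain per unit of idle time for a start at
      \<open>d\<close>.\<close>
    have "0 < u0 * (\<zeta> - \<beta>)" using \<beta> u0 by simp
    then have \<psi>_d: "0 < \<psi> d" using slope_at_d by (simp add: \<psi>_def \<phi>_def \<zeta>' algebra_simps)
    have "\<forall>\<^sub>F n in sequentially. 0 < real (Suc n) * expectation (Z.J r {0..<1 / real (Suc n)} (\<lambda>_. 0) \<psi>)"
      by (rule order_tendstoD(1)[OF Z.J_small_time[OF r cont(2) \<psi>_le] \<psi>_d])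
    then obtain n where n: "0 < real (Suc n) * expectation (Z.J r {0..<1 / real (Suc n)} (\<lambda>_. 0) \<psi>)"
      by (auto simp: eventually_sequentially simp del: of_nat_Suc)
    define \<epsilon> where "\<epsilon> = 1 / real (Suc n)"
    have pos: "0 < expectation (Z.J r {0..<\<epsilon>} (\<lambda>_. 0) \<psi>)"
      using n unfolding \<epsilon>_def by (simp only: zero_less_mult_iff) auto
    have delayed_adm: "(\<lambda>t \<omega>. if t < \<epsilon> then 0 else u0) \<in> admissible M W u0"
      by (rule deterministic_admissible) (use u0 in auto)
    have "vU M W \<mu> \<sigma> r \<beta> d (\<lambda>t \<omega>. if t < \<epsilon> then 0 else u0) d
        = ?h d + expectation (Z.J r {0..<\<epsilon>} (\<lambda>_. 0) (\<lambda>x. - u0 * \<phi> x))"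
      unfolding value_eq[OF delayed_adm d0]
      by (simp only: J_delayed_control[OF ctrl[OF delayed_adm d0] ctrl[OF zero_adm d0]])
    then have "?h d < vU M W \<mu> \<sigma> r \<beta> d (\<lambda>t \<omega>. if t < \<epsilon> then 0 else u0) d"
      using pos unfolding \<psi>_def by simp
    also have "\<dots> \<le> vfun M W \<mu> \<sigma> u0 r \<beta> d d"
      unfolding vfun_def
    proof (rule cSUP_upper[OF delayed_adm], rule bdd_aboveI2)
      fix U assume U: "U \<in> admissible M W u0"
      interpret C: controlled_drawdown M W U \<mu> \<sigma> u0 d by (rule ctrl[OF U d0])
      show "vU M W \<mu> \<sigma> r \<beta> d U d \<le> ?h d + (LBINT t:{0..}. exp (- r * t) * (C * (u0 + 1)))"
        unfolding value_eq[OF U d0] \<psi>_def[symmetric]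
        by (intro add_left_mono C.J_expectation_le[OF r meas \<phi>_le' \<psi>_le])
          (use J_int[OF U d0] in \<open>simp_all add: \<psi>_def[abs_def]\<close>)
    qed
    finally show ?thesis .
  qed
  show ?thesis
  proof (intro conjI iffI impI allI)
    show "0 < \<zeta>" unfolding \<zeta>' by (rule \<zeta>_pos)
    show "vfun M W \<mu> \<sigma> u0 r \<beta> d z = fbar z * indicator {0..d} z + gbar z * indicator {d<..} z"
      if "\<zeta> \<le> \<beta>" "0 \<le> z" for z
      using optimal[OF that] h[OF that(2)] by simp
    show "vU M W \<mu> \<sigma> r \<beta> d (\<lambda>t \<omega>. u0) z = vfun M W \<mu> \<sigma> u0 r \<beta> d z"
      if "\<zeta> \<le> \<beta>" "0 \<le> z" for z
      using optimal[OF that] max_value[OF that(2)] by simp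
    assume *: "\<forall>z\<ge>0. vfun M W \<mu> \<sigma> u0 r \<beta> d z = fbar z * indicator {0..d} z + gbar z * indicator {d<..} z"
    show "\<zeta> \<le> \<beta>"
    proof (rule ccontr)
      assume "\<not> \<zeta> \<le> \<beta>"
      then have "?h d < vfun M W \<mu> \<sigma> u0 r \<beta> d d" by (intro not_optimal) simp
      then show False using * h[of d] d by auto
    qed
  qed (rule max_adm)
qed

end
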